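(* Let $k$ be a field of characteristic zero and let $D$ be a locally nilpotent derivation of the free Poisson algebra $P=P\langle x_1,x_2\rangle$ over $k$. Then there exist a tame automorphism $\varphi$ of $P$ and a polynomial $f(x_2)\in k[x_2]$ such that $$\varphi^{-1}D\varphi=f(x_2)\frac{\partial}{\partial x_1}.$$
   Context: A Poisson algebra over a field $k$ is a $k$-vector space $B$ with two bilinear operations $x\cdot y$ and $\{x,y\}$ such that $B$ is a commutative associative algebra under $\cdot$, a Lie algebra under $\{\,,\,\}$, and $\{x,y\cdot z\}=\{x,y\}\cdot z+y\cdot\{x,z\}$ for all $x,y,z$. The free Poisson algebra $P\langle x_1,\dots,x_n\rangle$ is the symmetric algebra $S(g)$ of the free Lie algebra $g$ on $x_1,\dots,x_n$, i.e. the polynomial algebra on a linear basis $e_1,e_2,\dots$ of $g$, with Poisson bracket determined by $\{e_i,e_j\}=[e_i,e_j]$ and the Leibniz identity; it is free as a Poisson algebra on $x_1,\dots,x_n$. A derivation of a Poisson algebra $B$ is a $k$-linear map $D:B\to B$ with $D(yz)=D(y)z+yD(z)$ and $D\{y,z\}=\{D(y),z\}+\{y,D(z)\}$. For $f_1,\dots,f_n\in P\langle x_1,\dots,x_n\rangle$, $\sum_i f_i\frac{\partial}{\partial x_i}$ denotes the unique derivation $D$ of $P\langle x_1,\dots,x_n\rangle$ with $D(x_i)=f_i$ for all $i$. Thus $f(x_2)\frac{\partial}{\partial x_1}$ is the derivation sending $x_1\mapsto f(x_2)$ and $x_2\mapsto 0$. A derivation $D$ is locally nilpotent if for every $a$ there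 is a natural number $m=m(a)$ with $D^m(a)=0$. Automorphisms are automorphisms of Poisson $k$-algebras. An automorphism of $P\langle x_1,\dots,x_n\rangle$ is elementary if for some $i$ it sends $x_i\mapsto \alpha x_i+h$ with $0\neq\alpha\in k$, $h\in P\langle x_j : j\neq i\rangle$, and fixes $x_j$ for $j\ne i$; it is tame if it is a composition of elementary automorphisms. (For $n=2$, $P\langle x_j\rangle=k[x_j]$.) *)

theory Defs
  imports "HOL-Library.Poly_Mapping" "HOL-Library.Product_Plus"
    "HOL-Computational_Algebra.Polynomial"
begin

locale lie_algebra = vector_space scale
  for scale :: "'k::field \<Rightarrow> 'a::ab_group_add \<Rightarrow> 'a" +
  fixes bracket :: "'a \<Rightarrow> 'a \<Rightarrow> 'a"
  assumes bracket_add_left: "bracket (x + y) z = bracket x z + bracket y z"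
    and bracket_add_right: "bracket x (y + z) = bracket x y + bracket x z"
    and bracket_scale_left: "bracket (scale c x) y = scale c (bracket x y)"
    and bracket_scale_right: "bracket x (scale c y) = scale c (bracket x y)"
    and bracket_self: "bracket x x = 0"
    and jacobi: "bracket x (bracket y z) + bracket y (bracket z x) + bracket z (bracket x y) = 0"

locale poisson_algebra = lie_algebra scale bracket
  for scale :: "'k::field \<Rightarrow> 'a::comm_ring_1 \<Rightarrow> 'a" and bracket :: "'a \<Rightarrow> 'a \<Rightarrow> 'a" +
  assumes scale_mult_left: "scale c x * y = scale c (x * y)"
    and leibniz: "bracket x (y * z) = bracket x y * z + y * bracket x z"

text \<open>The free Lie algebra on the set of all elements of a type: formal Lie expressions
  modulo the least congruence containing the vector space and Lie algebra identities.\<close>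

datatype ('k, 'x) lie_term =
    LGen 'x
  | LZero
  | LAdd "('k, 'x) lie_term" "('k, 'x) lie_term"
  | LScale 'k "('k, 'x) lie_term"
  | LBr "('k, 'x) lie_term" "('k, 'x) lie_term"

inductive lie_eq :: "('k::field, 'x) lie_term \<Rightarrow> ('k, 'x) lie_term \<Rightarrow> bool" where
  refl: "lie_eq s s"
| sym: "lie_eq s t \<Longrightarrow> lie_eq t s"
| trans: "lie_eq s t \<Longrightarrow> lie_eq t u \<Longrightarrow> lie_eq s u"
| cong_add: "lie_eq s s' \<Longrightarrow> lie_eq t t' \<Longrightarrow> lie_eq (LAdd s t) (LAdd s' t')"
| cong_scale: "lie_eq s s' \<Longrightarrow> lie_eq (LScale c s) (LScale c s')"
| cong_br: "lie_eq s s' \<Longrightarrow> lie_eq t t' \<Longrightarrow> lie_eq (LBr s t) (LBr s' t')"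
| add_assoc: "lie_eq (LAdd (LAdd s t) u) (LAdd s (LAdd t u))"
| add_commute: "lie_eq (LAdd s t) (LAdd t s)"
| add_zero: "lie_eq (LAdd LZero s) s"
| add_neg: "lie_eq (LAdd (LScale (-1) s) s) LZero"
| scale_add_right: "lie_eq (LScale c (LAdd s t)) (LAdd (LScale c s) (LScale c t))"
| scale_add_left: "lie_eq (LScale (c + d) s) (LAdd (LScale c s) (LScale d s))"
| scale_scale: "lie_eq (LScale c (LScale d s)) (LScale (c * d) s)"
| scale_one: "lie_eq (LScale 1 s) s"
| br_add_left: "lie_eq (LBr (LAdd s t) u) (LAdd (LBr s u) (LBr t u))"
| br_add_right: "lie_eq (LBr s (LAdd t u)) (LAdd (LBr s t) (LBr s u))"
| br_scale_left: "lie_eq (LBr (LScale c s) t) (LScale c (LBr s t))"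
| br_scale_right: "lie_eq (LBr s (LScale c t)) (LScale c (LBr s t))"
| br_self: "lie_eq (LBr s s) LZero"
| br_jacobi: "lie_eq (LAdd (LAdd (LBr s (LBr t u)) (LBr t (LBr u s))) (LBr u (LBr s t))) LZero"

quotient_type (overloaded) ('k, 'x) free_lie = "('k::field, 'x) lie_term" / lie_eq
  by (intro equivpI reflpI sympI transpI) (blast intro: lie_eq.intros)+

instantiation free_lie :: (field, type) ab_group_add
begin

lift_definition zero_free_lie :: "('a, 'b) free_lie" is LZero .

lift_definition plus_free_lie ::
  "('a, 'b) free_lie \<Rightarrow> ('a, 'b) free_lie \<Rightarrow> ('a, 'b) free_lie" is LAdd
  by (rule lie_eq.cong_add)

lift_definition uminus_free_lie :: "('a, 'b) free_lie \<Rightarrow> ('a, 'b) free_lie" is "LScale (-1)"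
  by (rule lie_eq.cong_scale)

definition minus_free_lie :: "('a, 'b) free_lie \<Rightarrow> ('a, 'b) free_lie \<Rightarrow> ('a, 'b) free_lie"
  where "minus_free_lie u v = u + - v"

instance
proof
  fix a b c :: "('a, 'b) free_lie"
  show "a + b + c = a + (b + c)" by transfer (rule lie_eq.add_assoc)
  show "a + b = b + a" by transfer (rule lie_eq.add_commute)
  show "0 + a = a" by transfer (rule lie_eq.add_zero)
  show "- a + a = 0" by transfer (rule lie_eq.add_neg)
  show "a - b = a + - b" by (rule minus_free_lie_def)
qed

end

lift_definition lie_scale :: "'k::field \<Rightarrow> ('k, 'x) free_lie \<Rightarrow> ('k, 'x) free_lie" is LScale
  by (rule lie_eq.cong_scale)

lift_definition lie_bracket ::
  "('k::field, 'x) free_lie \<Rightarrow> ('k, 'x) free_lie \<Rightarrow> ('k, 'x) free_lie" is LBr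
  by (rule lie_eq.cong_br)

lift_definition lie_gen :: "'x \<Rightarrow> ('k::field, 'x) free_lie" is LGen .

interpretation free_lie: lie_algebra lie_scale lie_bracket
proof
  fix a b :: "'k::field" and x y z :: "('k, 'x) free_lie"
  show "lie_scale a (x + y) = lie_scale a x + lie_scale a y"
    by transfer (rule lie_eq.scale_add_right)
  show "lie_scale (a + b) x = lie_scale a x + lie_scale b x"
    by transfer (rule lie_eq.scale_add_left)
  show "lie_scale a (lie_scale b x) = lie_scale (a * b) x"
    by transfer (rule lie_eq.scale_scale)
  show "lie_scale 1 x = x" by transfer (rule lie_eq.scale_one)
  show "lie_bracket (x + y) z = lie_bracket x z + lie_bracket y z"
    by transfer (rule lie_eq.br_add_left)
  show "lie_bracket x (y + z) = lie_bracket x y + lie_bracket x z"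
    by transfer (rule lie_eq.br_add_right)
  show "lie_bracket (lie_scale a x) y = lie_scale a (lie_bracket x y)"
    by transfer (rule lie_eq.br_scale_left)
  show "lie_bracket x (lie_scale a y) = lie_scale a (lie_bracket x y)"
    by transfer (rule lie_eq.br_scale_right)
  show "lie_bracket x x = 0" by transfer (rule lie_eq.br_self)
  show "lie_bracket x (lie_bracket y z) + lie_bracket y (lie_bracket z x)
      + lie_bracket z (lie_bracket x y) = 0"
    by transfer (rule lie_eq.br_jacobi)
qed

lemma free_lie_cases:
  obtains t where "u = abs_free_lie t"
  using Quotient3_abs_rep[OF Quotient3_free_lie, of u] by metis

lemma free_lie_induct [case_names gen zero add scale bracket]:
  assumes "\<And>x. P (lie_gen x)" and "P 0"
    and "\<And>u v. P u \<Longrightarrow> P v \<Longrightarrow> P (u + v)"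
    and "\<And>c u. P u \<Longrightarrow> P (lie_scale c u)"
    and "\<And>u v. P u \<Longrightarrow> P v \<Longrightarrow> P (lie_bracket u v)"
  shows "P u"
proof -
  have "P (abs_free_lie t)" for t
    by (induction t)
      (use assms in \<open>auto simp: lie_gen.abs_eq[symmetric] zero_free_lie.abs_eq[symmetric]
        plus_free_lie.abs_eq[symmetric] lie_scale.abs_eq[symmetric] lie_bracket.abs_eq[symmetric]\<close>)
  then show ?thesis by (metis free_lie_cases)
qed

context lie_algebra
begin

primrec eval_lie_term :: "('x \<Rightarrow> 'a) \<Rightarrow> ('k, 'x) lie_term \<Rightarrow> 'a" where
  "eval_lie_term f (LGen x) = f x"
| "eval_lie_term f LZero = 0"
| "eval_lie_term f (LAdd s t) = eval_lie_term f s + eval_lie_term f t"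
| "eval_lie_term f (LScale c s) = scale c (eval_lie_term f s)"
| "eval_lie_term f (LBr s t) = bracket (eval_lie_term f s) (eval_lie_term f t)"

lemma eval_lie_term_eq: "lie_eq s t \<Longrightarrow> eval_lie_term f s = eval_lie_term f t"
proof (induction rule: lie_eq.induct)
  case (br_jacobi s t u)
  then show ?case by (simp add: jacobi)
qed (simp_all add: add_ac scale_left_distrib scale_right_distrib bracket_add_left
  bracket_add_right bracket_scale_left bracket_scale_right bracket_self)

theorem free_lie_universal:
  fixes f :: "'x \<Rightarrow> 'a"
  shows "\<exists>!h :: ('k, 'x) free_lie \<Rightarrow> 'a. Vector_Spaces.linear lie_scale scale h \<and>
    (\<forall>u v. h (lie_bracket u v) = bracket (h u) (h v)) \<and> (\<forall>x. h (lie_gen x) = f x)"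
proof (rule ex_ex1I)
  define h :: "('k, 'x) free_lie \<Rightarrow> 'a" where "h u = eval_lie_term f (rep_free_lie u)" for u
  have h: "h (abs_free_lie t) = eval_lie_term f t" for t
    unfolding h_def
    by (intro eval_lie_term_eq) (rule Quotient3_rep_abs[OF Quotient3_free_lie lie_eq.refl])
  have "h (u + v) = h u + h v" for u v
    by (cases u rule: free_lie_cases, cases v rule: free_lie_cases) (simp add: plus_free_lie.abs_eq h)
  moreover have "h (lie_scale c u) = scale c (h u)" for c u
    by (cases u rule: free_lie_cases) (simp add: lie_scale.abs_eq h)
  moreover have "h (lie_bracket u v) = bracket (h u) (h v)" for u v
    by (cases u rule: free_lie_cases, cases v rule: free_lie_cases) (simp add: lie_bracket.abs_eq h)
  moreover have "h (lie_gen x) = f x" for x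
    by (simp add: lie_gen.abs_eq h)
  ultimately show "\<exists>h. Vector_Spaces.linear lie_scale scale h \<and>
    (\<forall>u v. h (lie_bracket u v) = bracket (h u) (h v)) \<and> (\<forall>x. h (lie_gen x) = f x)"
    by (intro exI[of _ h]) (simp add: Vector_Spaces.linear_iff vector_space_axioms free_lie.vector_space_axioms)
next
  fix h h' :: "('k, 'x) free_lie \<Rightarrow> 'a"
  assume h: "Vector_Spaces.linear lie_scale scale h \<and>
      (\<forall>u v. h (lie_bracket u v) = bracket (h u) (h v)) \<and> (\<forall>x. h (lie_gen x) = f x)"
    and h': "Vector_Spaces.linear lie_scale scale h' \<and>
      (\<forall>u v. h' (lie_bracket u v) = bracket (h' u) (h' v)) \<and> (\<forall>x. h' (lie_gen x) = f x)"
  interpret h: Vector_Spaces.linear lie_scale scale h by (rule conjunct1[OF h])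
  interpret h': Vector_Spaces.linear lie_scale scale h' by (rule conjunct1[OF h'])
  have "h u = h' u" for u
    by (induction u rule: free_lie_induct)
      (simp_all add: h h' h.add h'.add h.scale h'.scale h.zero h'.zero)
  then show "h = h'" by (rule ext)
qed

end

lemma lie_gen_nonzero: "(lie_gen x :: ('k::field, 'x) free_lie) \<noteq> 0"
proof
  assume 0: "(lie_gen x :: ('k, 'x) free_lie) = 0"
  interpret ab: lie_algebra "(*) :: 'k \<Rightarrow> 'k \<Rightarrow> 'k" "\<lambda>_ _. 0"
    by unfold_locales (simp_all add: distrib_left distrib_right mult.assoc)
  obtain h :: "('k, 'x) free_lie \<Rightarrow> 'k"
    where h: "Vector_Spaces.linear lie_scale (*) h \<and> (\<forall>u v. h (lie_bracket u v) = 0) \<and>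
      (\<forall>x. h (lie_gen x) = 1)"
    using ab.free_lie_universal[of "\<lambda>_ :: 'x. 1"] by (rule ex1E)
  interpret h: Vector_Spaces.linear lie_scale "(*)" h by (rule conjunct1[OF h])
  have "h (lie_gen x) = 1" using h by blast
  then show False by (simp add: 0 h.zero)
qed

inductive_set lie_monomials :: "('k::field, 'x) free_lie set" where
  gen: "lie_gen x \<in> lie_monomials"
| bracket: "u \<in> lie_monomials \<Longrightarrow> v \<in> lie_monomials \<Longrightarrow> lie_bracket u v \<in> lie_monomials"

text \<open>Any linear basis yields the same symmetric algebra. A basis consisting of iterated brackets
  of generators has the advantage of being homogeneous.\<close>

definition lie_basis :: "('k::field, 'x) free_lie set" where
  "lie_basis = (SOME B. B \<subseteq> lie_monomials \<and> free_lie.independent B \<and> free_lie.span B = UNIV)"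

lemma span_lie_monomials: "free_lie.span (lie_monomials :: ('k::field, 'x) free_lie set) = UNIV"
proof -
  let ?S = "free_lie.span (lie_monomials :: ('k, 'x) free_lie set)"
  have br1: "lie_bracket u v \<in> ?S" if "u \<in> ?S" "v \<in> lie_monomials" for u v :: "('k, 'x) free_lie"
    using that(1)
  proof (induction rule: free_lie.span_induct_alt)
    case base
    then show ?case using free_lie.bracket_scale_left[of 0 0 v] by (simp add: free_lie.span_zero)
  next
    case (step c x y)
    then have "lie_bracket x v \<in> ?S" using that
      by (intro free_lie.span_base lie_monomials.bracket)
    then show ?case using step
      by (simp add: free_lie.bracket_add_left free_lie.bracket_scale_left free_lie.span_add
        free_lie.span_scale)
  qed
  have br: "lie_bracket u v \<in> ?S" if "u \<in> ?S" "v \<in> ?S" for u v :: "('k, 'x) free_lie"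
    using that(2)
  proof (induction rule: free_lie.span_induct_alt)
    case base
    then show ?case using free_lie.bracket_scale_right[of u 0 0] by (simp add: free_lie.span_zero)
  next
    case (step c x y)
    then show ?case using br1[OF that(1), of x]
      by (simp add: free_lie.bracket_add_right free_lie.bracket_scale_right free_lie.span_add
        free_lie.span_scale)
  qed
  have "u \<in> ?S" for u :: "('k, 'x) free_lie"
    by (induction u rule: free_lie_induct)
      (auto intro: free_lie.span_base lie_monomials.gen free_lie.span_zero free_lie.span_add
        free_lie.span_scale br)
  then show ?thesis by blast
qed

lemma
  shows lie_basis_subset: "(lie_basis :: ('k::field, 'x) free_lie set) \<subseteq> lie_monomials"
    and independent_lie_basis: "free_lie.independent (lie_basis :: ('k, 'x) free_lie set)"
    and span_lie_basis: "free_lie.span (lie_basis :: ('k, 'x) free_lie set) = UNIV"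
proof -
  obtain B :: "('k, 'x) free_lie set" where "B \<subseteq> lie_monomials" "free_lie.independent B"
    "lie_monomials \<subseteq> free_lie.span B"
    using free_lie.maximal_independent_subset by blast
  moreover from this have "free_lie.span B = UNIV"
    by (metis free_lie.span_minimal free_lie.subspace_span span_lie_monomials top.extremum_uniqueI)
  ultimately have "\<exists>B :: ('k, 'x) free_lie set.
    B \<subseteq> lie_monomials \<and> free_lie.independent B \<and> free_lie.span B = UNIV" by blast
  from someI_ex[OF this]
  show "(lie_basis :: ('k, 'x) free_lie set) \<subseteq> lie_monomials"
    "free_lie.independent (lie_basis :: ('k, 'x) free_lie set)"
    "free_lie.span (lie_basis :: ('k, 'x) free_lie set) = UNIV"
    unfolding lie_basis_def by auto
qed

typedef (overloaded) ('k, 'x) lie_basis_elem = "lie_basis :: ('k::field, 'x) free_lie set"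
proof (rule ccontr)
  assume "\<nexists>x. x \<in> (lie_basis :: ('k, 'x) free_lie set)"
  then have "free_lie.span ({} :: ('k, 'x) free_lie set) = UNIV"
    using span_lie_basis by (metis equals0I)
  then show False using lie_gen_nonzero by (metis UNIV_I free_lie.span_empty singletonD)
qed

text \<open>The symmetric algebra of the free Lie algebra, that is, the polynomial algebra on its
  basis.\<close>

type_synonym ('k, 'x) free_poisson = "(('k, 'x) lie_basis_elem \<Rightarrow>\<^sub>0 nat) \<Rightarrow>\<^sub>0 'k"

definition pois_const :: "'k::field \<Rightarrow> ('k, 'x) free_poisson" where
  "pois_const c = Poly_Mapping.single 0 c"

definition pois_scale :: "'k::field \<Rightarrow> ('k, 'x) free_poisson \<Rightarrow> ('k, 'x) free_poisson" where
  "pois_scale c p = pois_const c * p"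

definition pois_var :: "('k::field, 'x) lie_basis_elem \<Rightarrow> ('k, 'x) free_poisson" where
  "pois_var e = Poly_Mapping.single (Poly_Mapping.single e 1) 1"

definition lie_coord :: "('k::field, 'x) free_lie \<Rightarrow> ('k, 'x) lie_basis_elem \<Rightarrow> 'k" where
  "lie_coord u e = free_lie.representation lie_basis u (Rep_lie_basis_elem e)"

text \<open>The inclusion of the free Lie algebra as the span of the polynomial variables.\<close>

definition lie_incl :: "('k::field, 'x) free_lie \<Rightarrow> ('k, 'x) free_poisson" where
  "lie_incl u = (\<Sum>e | lie_coord u e \<noteq> 0. pois_scale (lie_coord u e) (pois_var e))"

definition pois_gen :: "'x \<Rightarrow> ('k::field, 'x) free_poisson" where
  "pois_gen x = lie_incl (lie_gen x)"

definition pois_vars :: "('k::field, 'x) free_poisson \<Rightarrow> ('k, 'x) lie_basis_elem set" where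
  "pois_vars p = (\<Union>m \<in> Poly_Mapping.keys p. Poly_Mapping.keys m)"

definition pois_pdiff ::
  "('k::field, 'x) lie_basis_elem \<Rightarrow> ('k, 'x) free_poisson \<Rightarrow> ('k, 'x) free_poisson" where
  "pois_pdiff e p = (\<Sum>m \<in> Poly_Mapping.keys p.
     Poly_Mapping.single (m - Poly_Mapping.single e 1)
       (of_nat (Poly_Mapping.lookup m e) * Poly_Mapping.lookup p m))"

text \<open>The only bilinear biderivation that restricts to the Lie bracket on the variables.\<close>

definition pois_bracket ::
  "('k::field, 'x) free_poisson \<Rightarrow> ('k, 'x) free_poisson \<Rightarrow> ('k, 'x) free_poisson" where
  "pois_bracket p q = (\<Sum>e \<in> pois_vars p. \<Sum>e' \<in> pois_vars q. pois_pdiff e p * pois_pdiff e' q *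
     lie_incl (lie_bracket (Rep_lie_basis_elem e) (Rep_lie_basis_elem e')))"

lemma poly_mapping_add_induct [case_names zero add]:
  assumes "P 0"
    and "\<And>k c p. P p \<Longrightarrow> P (Poly_Mapping.single k c + p)"
  shows "P (p :: 'b \<Rightarrow>\<^sub>0 'c::comm_monoid_add)"
proof (induction p rule: Poly_Mapping.update_induct)
  case const
  then show ?case by (rule assms(1))
next
  case (update f a b)
  have "Poly_Mapping.update a b f = Poly_Mapping.single a b + f"
    using update(1) by (intro poly_mapping_eqI)
      (auto simp: lookup_update lookup_add lookup_single in_keys_iff when_def)
  then show ?case using update assms(2) by simp
qed

lemma pois_const_simps [simp]:
  "pois_const 0 = 0" "pois_const 1 = 1" "pois_const (a + b) = pois_const a + pois_const b"
  "pois_const (a * b) = pois_const a * pois_const b"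
  by (simp_all add: pois_const_def single_add mult_single)

interpretation pois: vector_space pois_scale
  by unfold_locales (simp_all add: pois_scale_def algebra_simps)

lemma pois_induct [case_names const var add mult]:
  fixes p :: "('k::field, 'x) free_poisson"
  assumes const: "\<And>c. P (pois_const c)" and var: "\<And>e. P (pois_var e)"
    and add: "\<And>p q. P p \<Longrightarrow> P q \<Longrightarrow> P (p + q)" and mult: "\<And>p q. P p \<Longrightarrow> P q \<Longrightarrow> P (p * q)"
  shows "P p"
proof -
  have pow: "P (Poly_Mapping.single (Poly_Mapping.single e n) 1)" for e n
  proof (induction n)
    case 0
    show ?case using const[of 1] by (simp add: pois_const_def)
  next
    case (Suc n)
    have "Poly_Mapping.single (Poly_Mapping.single e (Suc n)) 1 =
      pois_var e * (Poly_Mapping.single (Poly_Mapping.single e n) 1 :: ('k, 'x) free_poisson)"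
      by (simp add: pois_var_def mult_single single_add[symmetric])
    then show ?case using mult[OF var Suc] by simp
  qed
  have mono: "P (Poly_Mapping.single m 1)" for m
  proof (induction m rule: poly_mapping_add_induct)
    case zero
    show ?case using const[of 1] by (simp add: pois_const_def)
  next
    case (add e n m)
    have "Poly_Mapping.single (Poly_Mapping.single e n + m) 1 =
      Poly_Mapping.single (Poly_Mapping.single e n) 1 *
      (Poly_Mapping.single m 1 :: ('k, 'x) free_poisson)"
      by (simp add: mult_single)
    then show ?case using mult[OF pow add] by simp
  qed
  have "P (Poly_Mapping.single m c)" for m c
    using mult[OF const mono, of c m] by (simp add: pois_const_def mult_single)
  then show ?thesis
    using const[of 0] by (induction p rule: poly_mapping_add_induct) (simp_all add: add)
qed

lemma lie_coord_add: "lie_coord (u + v) e = lie_coord u e + lie_coord v e"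
  by (simp add: lie_coord_def free_lie.representation_add independent_lie_basis span_lie_basis)

lemma lie_coord_scale: "lie_coord (lie_scale c u) e = c * lie_coord u e"
  by (simp add: lie_coord_def free_lie.representation_scale independent_lie_basis span_lie_basis)

lemma lie_coord_basis: "lie_coord (Rep_lie_basis_elem e) e' = (if e' = e then 1 else 0)"
  by (simp add: lie_coord_def free_lie.representation_basis independent_lie_basis
      Rep_lie_basis_elem Rep_lie_basis_elem_inject)

lemma finite_lie_coord: "finite {e. lie_coord u e \<noteq> 0}"
proof -
  have "finite (Rep_lie_basis_elem -` {b. free_lie.representation lie_basis u b \<noteq> 0})"
    by (intro finite_vimageI free_lie.finite_representation)
      (simp add: inj_def Rep_lie_basis_elem_inject)
  then show ?thesis by (simp add: lie_coord_def vimage_def)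
qed

lemma lie_incl_eq:
  assumes "finite V" "{e. lie_coord u e \<noteq> 0} \<subseteq> V"
  shows "lie_incl u = (\<Sum>e \<in> V. pois_scale (lie_coord u e) (pois_var e))"
  unfolding lie_incl_def using assms
  by (intro sum.mono_neutral_left) (auto simp: pois_scale_def)

lemma lie_incl_add: "lie_incl (u + v) = lie_incl u + lie_incl v"
proof -
  let ?V = "{e. lie_coord u e \<noteq> 0} \<union> {e. lie_coord v e \<noteq> 0}"
  have "finite ?V" by (simp add: finite_lie_coord)
  then show ?thesis
    by (subst (1 2 3) lie_incl_eq[of ?V])
      (auto simp: lie_coord_add pois.scale_left_distrib sum.distrib)
qed

lemma lie_incl_scale: "lie_incl (lie_scale c u) = pois_scale c (lie_incl u)"
proof -
  let ?V = "{e. lie_coord u e \<noteq> 0}"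
  have "finite ?V" by (simp add: finite_lie_coord)
  then show ?thesis
    by (subst (1 2) lie_incl_eq[of ?V]) (auto simp: lie_coord_scale pois.scale_sum_right)
qed

lemma linear_lie_incl: "Vector_Spaces.linear lie_scale pois_scale lie_incl"
  unfolding Vector_Spaces.linear_iff
  by (simp add: pois.vector_space_axioms free_lie.vector_space_axioms lie_incl_add lie_incl_scale)

lemma lie_incl_basis: "lie_incl (Rep_lie_basis_elem e) = pois_var e"
  by (simp add: lie_incl_def lie_coord_basis if_distrib cong: if_cong)

lemma free_lie_linear_induct [case_names basis zero add scale]:
  assumes "\<And>e. P (Rep_lie_basis_elem e)" and "P 0"
    and "\<And>u v. P u \<Longrightarrow> P v \<Longrightarrow> P (u + v)" and "\<And>c u. P u \<Longrightarrow> P (lie_scale c u)"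
  shows "P u"
proof -
  have "u \<in> free_lie.span lie_basis" by (simp add: span_lie_basis)
  then show ?thesis
  proof (induction rule: free_lie.span_induct_alt)
    case base
    then show ?case by (rule assms(2))
  next
    case (step c x y)
    then show ?case by (metis assms Abs_lie_basis_elem_inverse)
  qed
qed

lemma lie_incl_zero: "lie_incl 0 = 0"
  using lie_incl_scale[of 0 0] by simp

lemma pois_pdiff_add: "pois_pdiff e (p + q) = pois_pdiff e p + pois_pdiff e q"
  unfolding pois_pdiff_def
  by (rule setsum_keys_plus_distrib) (simp_all add: distrib_left single_add)

lemma pois_pdiff_single:
  "pois_pdiff e (Poly_Mapping.single m c) =
    Poly_Mapping.single (m - Poly_Mapping.single e 1) (of_nat (Poly_Mapping.lookup m e) * c)"
  by (cases "c = 0") (simp_all add: pois_pdiff_def)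

lemma pois_pdiff_zero: "pois_pdiff e 0 = 0"
  by (simp add: pois_pdiff_def)

lemma pois_pdiff_const: "pois_pdiff e (pois_const c) = 0"
  by (simp add: pois_const_def pois_pdiff_single)

lemma pois_pdiff_var: "pois_pdiff e (pois_var e') = (if e = e' then 1 else 0)"
  by (auto simp: pois_var_def pois_pdiff_single lookup_single)

lemma pois_pdiff_mult_single:
  "pois_pdiff e (Poly_Mapping.single m a * Poly_Mapping.single n b) =
    pois_pdiff e (Poly_Mapping.single m a) * Poly_Mapping.single n b +
    Poly_Mapping.single m a * pois_pdiff e (Poly_Mapping.single n b)"
proof -
  have *: "m + n - Poly_Mapping.single e 1 = m - Poly_Mapping.single e 1 + n"
    if "Poly_Mapping.lookup m e \<noteq> 0" for m n :: "('a, 'b) lie_basis_elem \<Rightarrow>\<^sub>0 nat"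
    using that by (intro poly_mapping_eqI)
      (auto simp: lookup_add minus_poly_mapping.rep_eq lookup_single when_def)
  have "Poly_Mapping.single (m + n - Poly_Mapping.single e 1) (of_nat (Poly_Mapping.lookup m e) * a * b)
      = Poly_Mapping.single (m - Poly_Mapping.single e 1 + n) (of_nat (Poly_Mapping.lookup m e) * a * b)"
    using *[of m n] by (cases "Poly_Mapping.lookup m e = 0") simp_all
  moreover have "Poly_Mapping.single (m + n - Poly_Mapping.single e 1) (of_nat (Poly_Mapping.lookup n e) * a * b)
      = Poly_Mapping.single (m + (n - Poly_Mapping.single e 1)) (of_nat (Poly_Mapping.lookup n e) * a * b)"
    using *[of n m] by (cases "Poly_Mapping.lookup n e = 0") (simp_all add: add.commute)
  ultimately show ?thesis
    by (simp add: mult_single pois_pdiff_single lookup_add algebra_simps single_add)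
qed

lemma pois_pdiff_mult: "pois_pdiff e (p * q) = pois_pdiff e p * q + p * pois_pdiff e q"
proof (induction p rule: poly_mapping_add_induct)
  case zero
  then show ?case by (simp add: pois_pdiff_zero)
next
  case (add m c p)
  have "pois_pdiff e (Poly_Mapping.single m c * q) =
      pois_pdiff e (Poly_Mapping.single m c) * q + Poly_Mapping.single m c * pois_pdiff e q"
    by (induction q rule: poly_mapping_add_induct)
      (simp_all add: pois_pdiff_zero distrib_left pois_pdiff_add pois_pdiff_mult_single)
  with add show ?case by (simp add: distrib_right pois_pdiff_add)
qed

lemma finite_pois_vars: "finite (pois_vars p)"
  by (simp add: pois_vars_def)

lemma pois_pdiff_notin_vars: "e \<notin> pois_vars p \<Longrightarrow> pois_pdiff e p = 0"
  by (auto simp: pois_pdiff_def pois_vars_def in_keys_iff intro!: sum.neutral)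

definition pois_der :: "(('k::field, 'x) lie_basis_elem \<Rightarrow> ('k, 'x) free_poisson) \<Rightarrow>
    ('k, 'x) free_poisson \<Rightarrow> ('k, 'x) free_poisson" where
  "pois_der d p = (\<Sum>e \<in> pois_vars p. pois_pdiff e p * d e)"

lemma pois_der_eq:
  "finite V \<Longrightarrow> pois_vars p \<subseteq> V \<Longrightarrow> pois_der d p = (\<Sum>e \<in> V. pois_pdiff e p * d e)"
  unfolding pois_der_def
  by (intro sum.mono_neutral_left) (auto simp: pois_pdiff_notin_vars)

lemma pois_der_const: "pois_der d (pois_const c) = 0"
  by (simp add: pois_der_def pois_pdiff_const)

lemma pois_der_var: "pois_der d (pois_var e) = d e"
  by (subst pois_der_eq[of "insert e (pois_vars (pois_var e))"])
    (auto simp: finite_pois_vars pois_pdiff_var sum.If_cases if_distrib if_distribR cong: if_cong)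

lemma pois_der_add: "pois_der d (p + q) = pois_der d p + pois_der d q"
proof -
  let ?V = "pois_vars p \<union> pois_vars q \<union> pois_vars (p + q)"
  have "finite ?V" by (simp add: finite_pois_vars)
  then show ?thesis
    by (subst (1 2 3) pois_der_eq[of ?V])
      (auto simp: pois_pdiff_add distrib_right sum.distrib)
qed

lemma pois_der_mult: "pois_der d (p * q) = pois_der d p * q + p * pois_der d q"
proof -
  let ?V = "pois_vars p \<union> pois_vars q \<union> pois_vars (p * q)"
  have "finite ?V" by (simp add: finite_pois_vars)
  then show ?thesis
    by (subst (1 2 3) pois_der_eq[of ?V])
      (auto simp: pois_pdiff_mult distrib_right sum.distrib sum_distrib_left sum_distrib_right
        algebra_simps)
qed

lemma pois_der_scale: "pois_der d (pois_scale c p) = pois_scale c (pois_der d p)"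
  by (simp add: pois_scale_def pois_der_mult pois_der_const)

lemma pois_bracket_left: "pois_bracket p q =
  pois_der (\<lambda>e. pois_der (\<lambda>e'. lie_incl (lie_bracket (Rep_lie_basis_elem e) (Rep_lie_basis_elem e'))) q) p"
  by (simp add: pois_bracket_def pois_der_def sum_distrib_left mult.assoc)

lemma pois_bracket_right: "pois_bracket p q =
  pois_der (\<lambda>e'. pois_der (\<lambda>e. lie_incl (lie_bracket (Rep_lie_basis_elem e) (Rep_lie_basis_elem e'))) p) q"
  unfolding pois_bracket_def pois_der_def
  by (subst sum.swap) (simp add: sum_distrib_left mult_ac)

lemma pois_bracket_var:
  "pois_bracket (pois_var e) (pois_var e') =
    lie_incl (lie_bracket (Rep_lie_basis_elem e) (Rep_lie_basis_elem e'))"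
  by (simp add: pois_bracket_left pois_der_var)

lemma pois_bracket_simps_left:
  "pois_bracket (p + q) r = pois_bracket p r + pois_bracket q r"
  "pois_bracket (pois_scale c p) r = pois_scale c (pois_bracket p r)"
  "pois_bracket (p * q) r = pois_bracket p r * q + p * pois_bracket q r"
  "pois_bracket (pois_const c) r = 0"
  by (simp_all only: pois_bracket_left pois_der_add pois_der_mult pois_der_scale pois_der_const)

lemma pois_bracket_simps_right:
  "pois_bracket r (p + q) = pois_bracket r p + pois_bracket r q"
  "pois_bracket r (pois_scale c p) = pois_scale c (pois_bracket r p)"
  "pois_bracket r (p * q) = pois_bracket r p * q + p * pois_bracket r q"
  "pois_bracket r (pois_const c) = 0"
  by (simp_all only: pois_bracket_right pois_der_add pois_der_mult pois_der_scale pois_der_const)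

lemmas pois_bracket_simps = pois_bracket_simps_left pois_bracket_simps_right

lemma pois_bracket_zero: "pois_bracket 0 r = 0" "pois_bracket r 0 = 0"
  using pois_bracket_simps(4)[of 0 r] pois_bracket_simps(8)[of r 0] by simp_all

lemma pois_bracket_minus:
  "pois_bracket (- p) r = - pois_bracket p r" "pois_bracket r (- p) = - pois_bracket r p"
  using pois_bracket_simps(1)[of p "- p" r] pois_bracket_simps(5)[of r p "- p"]
  by (simp_all add: pois_bracket_zero eq_neg_iff_add_eq_0 add.commute)

lemma pois_bracket_diff:
  "pois_bracket (p - q) r = pois_bracket p r - pois_bracket q r"
  "pois_bracket r (p - q) = pois_bracket r p - pois_bracket r q"
  by (simp_all only: diff_conv_add_uminus pois_bracket_simps pois_bracket_minus)

lemma lie_bracket_zero: "lie_bracket 0 u = 0" "lie_bracket u 0 = 0"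
  using free_lie.bracket_scale_left[of 0 0 u] free_lie.bracket_scale_right[of u 0 0] by simp_all

lemma pois_bracket_lie_incl: "pois_bracket (lie_incl u) (lie_incl v) = lie_incl (lie_bracket u v)"
proof (induction u rule: free_lie_linear_induct)
  case (basis e)
  show ?case
    by (induction v rule: free_lie_linear_induct)
      (simp_all add: lie_incl_basis pois_bracket_var lie_incl_zero pois_bracket_zero lie_bracket_zero
        lie_incl_add lie_incl_scale pois_bracket_simps free_lie.bracket_add_right
        free_lie.bracket_scale_right)
qed (simp_all add: lie_incl_zero pois_bracket_zero lie_bracket_zero lie_incl_add lie_incl_scale
      pois_bracket_simps free_lie.bracket_add_left free_lie.bracket_scale_left)

lemma lie_bracket_anti: "lie_bracket u v = - lie_bracket v u"
proof -
  have "lie_bracket u v + lie_bracket v u = 0"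
    using free_lie.bracket_self[of "u + v"] free_lie.bracket_self[of u] free_lie.bracket_self[of v]
    by (simp add: free_lie.bracket_add_left free_lie.bracket_add_right add.commute)
  then show ?thesis by (simp add: eq_neg_iff_add_eq_0)
qed

lemma lie_incl_minus: "lie_incl (- u) = - lie_incl u"
  by (metis add.right_inverse lie_incl_add lie_incl_zero minus_unique)

lemma pois_bracket_anti: "pois_bracket p q = - pois_bracket q p"
proof (induction p rule: pois_induct)
  case (var e)
  show ?case
  proof (induction q rule: pois_induct)
    case (var e')
    show ?case unfolding pois_bracket_var by (subst lie_bracket_anti) (rule lie_incl_minus)
  next
    case (add p q)
    then show ?case by (simp only: pois_bracket_simps) simp
  next
    case (mult p q)
    then show ?case by (simp only: pois_bracket_simps) simp
  qed (simp add: pois_bracket_simps)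
next
  case (add p q)
  then show ?case by (simp only: pois_bracket_simps) simp
next
  case (mult p q)
  then show ?case by (simp only: pois_bracket_simps) simp
qed (simp add: pois_bracket_simps)

lemma pois_bracket_self: "pois_bracket p p = 0"
proof (induction p rule: pois_induct)
  case (var e)
  show ?case by (simp add: pois_bracket_var free_lie.bracket_self lie_incl_zero)
next
  case (add p q)
  then show ?case using pois_bracket_anti[of p q] by (simp add: pois_bracket_simps)
next
  case (mult p q)
  then show ?case using pois_bracket_anti[of p q] by (simp add: pois_bracket_simps algebra_simps)
qed (simp add: pois_bracket_simps)

lemma pois_jacobi:
  "pois_bracket p (pois_bracket q r) + pois_bracket q (pois_bracket r p) +
    pois_bracket r (pois_bracket p q) = 0"
proof -
  define J :: "('a, 'b) free_poisson \<Rightarrow> ('a, 'b) free_poisson \<Rightarrow> ('a, 'b) free_poisson \<Rightarrow>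
    ('a, 'b) free_poisson" where
    "J p q r = pois_bracket p (pois_bracket q r) + pois_bracket q (pois_bracket r p) +
      pois_bracket r (pois_bracket p q)" for p q r
  have J_cyclic: "J p q r = J q r p" for p q r
    by (simp add: J_def add_ac)
  have J_const: "J (pois_const c) q r = 0" for c q r
    by (simp add: J_def pois_bracket_simps pois_bracket_zero)
  have J_add: "J (p + p') q r = J p q r + J p' q r" for p p' q r
    by (simp add: J_def pois_bracket_simps)
  have J_mult: "J (p * p') q r = p * J p' q r + J p q r * p'" for p p' q r
    using pois_bracket_anti[of r p] pois_bracket_anti[of r p'] pois_bracket_anti[of q p] pois_bracket_anti[of q p']
    by (simp add: J_def pois_bracket_simps pois_bracket_minus pois_bracket_diff algebra_simps)
  have J_ext: "J p q r = 0" if "\<And>e. J (pois_var e) q r = 0" for p q r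
    by (induction p rule: pois_induct) (simp_all add: that J_const J_add J_mult)
  have "J (pois_var e1) (pois_var e2) (pois_var e3) = 0" for e1 e2 e3
    unfolding J_def lie_incl_basis[symmetric] pois_bracket_lie_incl lie_incl_add[symmetric]
    by (simp add: free_lie.jacobi lie_incl_zero)
  then have "J p (pois_var e2) (pois_var e3) = 0" for p e2 e3 by (rule J_ext)
  then have "J (pois_var e2) (pois_var e3) p = 0" for p e2 e3
    using J_cyclic[of p "pois_var e2" "pois_var e3"] by simp
  then have "J q (pois_var e3) p = 0" for q p e3 by (rule J_ext)
  then have "J (pois_var e3) p q = 0" for q p e3
    using J_cyclic[of q "pois_var e3" p] by simp
  then have "J p q r = 0" by (rule J_ext)
  then show ?thesis by (simp only: J_def)
qed

theorem poisson_algebra_free_poisson: "poisson_algebra pois_scale pois_bracket"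
  by unfold_locales
    (simp_all add: pois_bracket_simps pois_bracket_self pois_jacobi pois_scale_def mult.assoc)

context poisson_algebra
begin

definition eval_monom :: "('i \<Rightarrow> 'a) \<Rightarrow> ('i \<Rightarrow>\<^sub>0 nat) \<Rightarrow> 'a" where
  "eval_monom v m = (\<Prod>e \<in> Poly_Mapping.keys m. v e ^ Poly_Mapping.lookup m e)"

definition eval_poly :: "('i \<Rightarrow> 'a) \<Rightarrow> (('i \<Rightarrow>\<^sub>0 nat) \<Rightarrow>\<^sub>0 'k) \<Rightarrow> 'a" where
  "eval_poly v p = (\<Sum>m \<in> Poly_Mapping.keys p. scale (Poly_Mapping.lookup p m) (eval_monom v m))"

lemma eval_monom_eq:
  "finite V \<Longrightarrow> Poly_Mapping.keys m \<subseteq> V \<Longrightarrow> eval_monom v m = (\<Prod>e \<in> V. v e ^ Poly_Mapping.lookup m e)"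
  unfolding eval_monom_def by (intro prod.mono_neutral_left) (auto simp: in_keys_iff)

lemma eval_monom_add: "eval_monom v (m + n) = eval_monom v m * eval_monom v n"
proof -
  let ?V = "Poly_Mapping.keys m \<union> Poly_Mapping.keys n \<union> Poly_Mapping.keys (m + n)"
  have "finite ?V" by simp
  then show ?thesis
    by (subst (1 2 3) eval_monom_eq[of ?V]) (auto simp: lookup_add power_add prod.distrib)
qed

lemma eval_poly_add: "eval_poly v (p + q) = eval_poly v p + eval_poly v q"
  unfolding eval_poly_def
  by (rule setsum_keys_plus_distrib) (simp_all add: scale_left_distrib)

lemma eval_poly_single: "eval_poly v (Poly_Mapping.single m c) = scale c (eval_monom v m)"
  by (cases "c = 0") (simp_all add: eval_poly_def)

lemma eval_poly_zero: "eval_poly v 0 = 0"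
  by (simp add: eval_poly_def)

lemma scale_mult_right: "x * scale c y = scale c (x * y)"
  by (metis mult.commute scale_mult_left)

lemma eval_poly_mult: "eval_poly v (p * q) = eval_poly v p * eval_poly v q"
proof (induction p rule: poly_mapping_add_induct)
  case zero
  then show ?case by (simp add: eval_poly_zero)
next
  case (add m c p)
  have "eval_poly v (Poly_Mapping.single m c * q) = eval_poly v (Poly_Mapping.single m c) * eval_poly v q"
    by (induction q rule: poly_mapping_add_induct)
      (simp_all add: eval_poly_zero distrib_left eval_poly_add eval_poly_single mult_single
        eval_monom_add scale_mult_left scale_mult_right)
  with add show ?case by (simp add: distrib_right eval_poly_add)
qed

lemma eval_poly_const: "eval_poly v (pois_const c) = scale c 1"
  by (simp add: pois_const_def eval_poly_single eval_monom_def)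

lemma eval_poly_scale: "eval_poly v (pois_scale c p) = scale c (eval_poly v p)"
  by (simp add: pois_scale_def eval_poly_mult eval_poly_const scale_mult_left)

lemma eval_poly_var: "eval_poly v (pois_var e) = v e"
  by (simp add: pois_var_def eval_poly_single eval_monom_def)

lemma bracket_anti: "bracket x y = - bracket y x"
proof -
  have "bracket x y + bracket y x = 0"
    using bracket_self[of "x + y"] bracket_self[of x] bracket_self[of y]
    by (simp add: bracket_add_left bracket_add_right add.commute)
  then show ?thesis by (simp add: eq_neg_iff_add_eq_0)
qed

lemma leibniz_left: "bracket (x * y) z = bracket x z * y + x * bracket y z"
  using leibniz[of z x y] bracket_anti[of "x * y" z] bracket_anti[of z x] bracket_anti[of z y]
  by simp

lemma bracket_one: "bracket x 1 = 0" "bracket 1 x = 0"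
  using leibniz[of x 1 1] leibniz_left[of 1 1 x] by simp_all

theorem free_poisson_universal:
  fixes f :: "'x \<Rightarrow> 'a"
  shows "\<exists>!h :: ('k, 'x) free_poisson \<Rightarrow> 'a. Vector_Spaces.linear pois_scale scale h \<and>
    h 1 = 1 \<and> (\<forall>p q. h (p * q) = h p * h q) \<and>
    (\<forall>p q. h (pois_bracket p q) = bracket (h p) (h q)) \<and> (\<forall>x. h (pois_gen x) = f x)"
proof (rule ex_ex1I)
  obtain L :: "('k, 'x) free_lie \<Rightarrow> 'a"
    where L: "Vector_Spaces.linear lie_scale scale L \<and>
      (\<forall>u v. L (lie_bracket u v) = bracket (L u) (L v)) \<and> (\<forall>x. L (lie_gen x) = f x)"
    using free_lie_universal[of f] by (rule ex1E)
  interpret L: Vector_Spaces.linear lie_scale scale L by (rule conjunct1[OF L])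
  have L_bracket: "L (lie_bracket u v) = bracket (L u) (L v)" for u v using L by blast
  define h where "h = eval_poly (\<lambda>e. L (Rep_lie_basis_elem e))"
  have h_simps: "h (p + q) = h p + h q" "h (p * q) = h p * h q" "h (pois_scale c p) = scale c (h p)"
    "h (pois_const c) = scale c 1" "h (pois_var e) = L (Rep_lie_basis_elem e)" "h 0 = 0"
    for p q c e
    by (simp_all add: h_def eval_poly_add eval_poly_mult eval_poly_scale eval_poly_const
        eval_poly_var eval_poly_zero)
  have h_incl: "h (lie_incl u) = L u" for u
    by (induction u rule: free_lie_linear_induct)
      (simp_all add: lie_incl_basis h_simps lie_incl_zero L.zero lie_incl_add L.add
        lie_incl_scale L.scale)
  have h_bracket: "h (pois_bracket p q) = bracket (h p) (h q)" for p q
  proof (induction p rule: pois_induct)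
    case (var e)
    show ?case
    proof (induction q rule: pois_induct)
      case (var e')
      show ?case
        unfolding lie_incl_basis[symmetric] pois_bracket_lie_incl h_incl L_bracket ..
    qed (simp_all add: h_simps pois_bracket_simps bracket_add_right leibniz bracket_scale_right
        bracket_one)
  qed (simp_all add: h_simps pois_bracket_simps bracket_add_left leibniz_left bracket_scale_left
      bracket_one)
  have "h 1 = 1" using h_simps(4)[of 1] by simp
  moreover have "Vector_Spaces.linear pois_scale scale h"
    unfolding Vector_Spaces.linear_iff
    by (simp add: pois.vector_space_axioms vector_space_axioms h_simps)
  moreover have "h (pois_gen x) = f x" for x
    using L by (simp add: pois_gen_def h_incl)
  ultimately show "\<exists>h. Vector_Spaces.linear pois_scale scale h \<and>
    h 1 = 1 \<and> (\<forall>p q. h (p * q) = h p * h q) \<and>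
    (\<forall>p q. h (pois_bracket p q) = bracket (h p) (h q)) \<and> (\<forall>x. h (pois_gen x) = f x)"
    using h_simps(2) h_bracket by blast
next
  fix h g :: "('k, 'x) free_poisson \<Rightarrow> 'a"
  assume h: "Vector_Spaces.linear pois_scale scale h \<and> h 1 = 1 \<and>
      (\<forall>p q. h (p * q) = h p * h q) \<and>
      (\<forall>p q. h (pois_bracket p q) = bracket (h p) (h q)) \<and> (\<forall>x. h (pois_gen x) = f x)"
    and g: "Vector_Spaces.linear pois_scale scale g \<and> g 1 = 1 \<and>
      (\<forall>p q. g (p * q) = g p * g q) \<and>
      (\<forall>p q. g (pois_bracket p q) = bracket (g p) (g q)) \<and> (\<forall>x. g (pois_gen x) = f x)"
  interpret h: Vector_Spaces.linear pois_scale scale h by (rule conjunct1[OF h])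
  interpret g: Vector_Spaces.linear pois_scale scale g by (rule conjunct1[OF g])
  have gen: "h (lie_incl (lie_gen x)) = f x" "g (lie_incl (lie_gen x)) = f x" for x
    using h g unfolding pois_gen_def by blast+
  have incl: "h (lie_incl u) = g (lie_incl u)" for u
    by (induction u rule: free_lie_induct)
      (simp_all add: gen lie_incl_zero lie_incl_add lie_incl_scale h.zero g.zero h.add g.add
        h.scale g.scale pois_bracket_lie_incl[symmetric] h g)
  have const: "h (pois_const c) = g (pois_const c)" for c
    using h.scale[of c 1] g.scale[of c 1] h g by (simp add: pois_scale_def)
  have "h p = g p" for p
  proof (induction p rule: pois_induct)
    case (var e)
    show ?case using incl[of "Rep_lie_basis_elem e"] by (simp add: lie_incl_basis)
  qed (simp_all add: const h.add g.add h g)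
  then show "h = g" by (rule ext)
qed

end

definition poisson_derivation ::
  "(('k::field, 'x) free_poisson \<Rightarrow> ('k, 'x) free_poisson) \<Rightarrow> bool" where
  "poisson_derivation D \<longleftrightarrow> Vector_Spaces.linear pois_scale pois_scale D \<and>
     (\<forall>p q. D (p * q) = D p * q + p * D q) \<and>
     (\<forall>p q. D (pois_bracket p q) = pois_bracket (D p) q + pois_bracket p (D q))"

theorem poisson_derivation_ex1:
  fixes f :: "'x \<Rightarrow> ('k::field, 'x) free_poisson"
  shows "\<exists>!D. poisson_derivation D \<and> (\<forall>x. D (pois_gen x) = f x)"
proof (rule ex_ex1I)
  let ?sc = "\<lambda>c (p :: ('k, 'x) free_poisson, q). (pois_scale c p, pois_scale c q :: ('k, 'x) free_poisson)"
  let ?br = "\<lambda>(p :: ('k, 'x) free_poisson, p') (q :: ('k, 'x) free_poisson, q').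
    (pois_bracket p q, pois_bracket p' q + pois_bracket p q')"
  interpret P: poisson_algebra "pois_scale :: 'k \<Rightarrow> ('k, 'x) free_poisson \<Rightarrow> _" pois_bracket
    by (rule poisson_algebra_free_poisson)
  interpret dual: lie_algebra ?sc ?br
  proof
    fix x y z :: "('k, 'x) free_poisson \<times> ('k, 'x) free_poisson"
    obtain a a' b b' c c' where [simp]: "x = (a, a')" "y = (b, b')" "z = (c, c')"
      by (cases x, cases y, cases z) blast
    show "?br x x = 0"
      using pois_bracket_anti[of a a'] by (simp add: zero_prod_def pois_bracket_self)
    show "?br x (?br y z) + ?br y (?br z x) + ?br z (?br x y) = 0"
      using pois_jacobi[of a b c] arg_cong2[of _ _ _ _ "(+)", OF pois_jacobi[of a' b c]
          arg_cong2[of _ _ _ _ "(+)", OF pois_jacobi[of a b' c] pois_jacobi[of a b c']]]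
      by (simp add: zero_prod_def pois_bracket_simps add_ac)
  qed (auto simp: pois_bracket_simps pois.scale_left_distrib pois.scale_right_distrib)
  obtain h :: "('k, 'x) free_lie \<Rightarrow> ('k, 'x) free_poisson \<times> ('k, 'x) free_poisson"
    where h: "Vector_Spaces.linear lie_scale ?sc h \<and> (\<forall>u v. h (lie_bracket u v) = ?br (h u) (h v)) \<and>
      (\<forall>x. h (lie_gen x) = (pois_gen x, f x))"
    using dual.free_lie_universal[of "\<lambda>x. (pois_gen x, f x)"] by (rule ex1E)
  interpret h: Vector_Spaces.linear lie_scale ?sc h by (rule conjunct1[OF h])
  have h_bracket: "h (lie_bracket u v) = ?br (h u) (h v)" for u v using h by blast
  have h_gen: "h (lie_gen x) = (pois_gen x, f x)" for x using h by blast
  have fst_h: "fst (h u) = lie_incl u" for u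
    by (induction u rule: free_lie_induct)
      (simp_all add: h_gen pois_gen_def h.zero h.add h.scale h_bracket lie_incl_zero lie_incl_add
        lie_incl_scale pois_bracket_lie_incl[symmetric] case_prod_beta)
  define d where "d u = snd (h u)" for u
  have d_bracket: "d (lie_bracket u v) = pois_bracket (d u) (lie_incl v) + pois_bracket (lie_incl u) (d v)" for u v
    by (simp add: d_def h_bracket fst_h[symmetric] case_prod_beta)
  have d_add: "d (u + v) = d u + d v" for u v by (simp add: d_def h.add)
  have d_zero: "d 0 = 0" by (simp add: d_def h.zero)
  have d_scale: "d (lie_scale c u) = pois_scale c (d u)" for c u
    by (simp add: d_def h.scale case_prod_beta)
  define D where "D = pois_der (\<lambda>e. d (Rep_lie_basis_elem e))"
  note D_simps = pois_der_add[of "\<lambda>e. d (Rep_lie_basis_elem e)", folded D_def]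
    pois_der_mult[of "\<lambda>e. d (Rep_lie_basis_elem e)", folded D_def]
    pois_der_const[of "\<lambda>e. d (Rep_lie_basis_elem e)", folded D_def]
    pois_der_scale[of "\<lambda>e. d (Rep_lie_basis_elem e)", folded D_def]
    pois_der_var[of "\<lambda>e. d (Rep_lie_basis_elem e)", folded D_def]
  have D_zero: "D 0 = 0" using D_simps(3)[of 0] by simp
  have D_incl: "D (lie_incl u) = d u" for u
    by (induction u rule: free_lie_linear_induct)
      (simp_all add: lie_incl_basis D_simps lie_incl_zero D_zero d_zero lie_incl_add d_add
        lie_incl_scale d_scale)
  have D_bracket: "D (pois_bracket p q) = pois_bracket (D p) q + pois_bracket p (D q)" for p q
  proof (induction p rule: pois_induct)
    case (var e)
    show ?case
    proof (induction q rule: pois_induct)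
      case (var e')
      show ?case
        unfolding lie_incl_basis[symmetric] pois_bracket_lie_incl D_incl d_bracket ..
    qed (simp_all add: D_simps D_zero pois_bracket_simps pois_bracket_zero algebra_simps)
  qed (simp_all add: D_simps D_zero pois_bracket_simps pois_bracket_zero algebra_simps)
  have "poisson_derivation D"
    by (simp add: poisson_derivation_def Vector_Spaces.linear_iff pois.vector_space_axioms D_simps
        D_bracket)
  moreover have "D (pois_gen x) = f x" for x
    by (simp add: pois_gen_def D_incl d_def h_gen)
  ultimately show "\<exists>D. poisson_derivation D \<and> (\<forall>x. D (pois_gen x) = f x)" by blast
next
  fix D E :: "('k, 'x) free_poisson \<Rightarrow> ('k, 'x) free_poisson"
  assume *: "poisson_derivation D \<and> (\<forall>x. D (pois_gen x) = f x)"
    and **: "poisson_derivation E \<and> (\<forall>x. E (pois_gen x) = f x)"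
  interpret D: Vector_Spaces.linear pois_scale pois_scale D
    using * unfolding poisson_derivation_def by blast
  interpret E: Vector_Spaces.linear pois_scale pois_scale E
    using ** unfolding poisson_derivation_def by blast
  have mult: "D (p * q) = D p * q + p * D q" "E (p * q) = E p * q + p * E q" for p q
    using * ** unfolding poisson_derivation_def by blast+
  have bracket: "D (pois_bracket p q) = pois_bracket (D p) q + pois_bracket p (D q)"
    "E (pois_bracket p q) = pois_bracket (E p) q + pois_bracket p (E q)" for p q
    using * ** unfolding poisson_derivation_def by blast+
  have gen: "D (lie_incl (lie_gen x)) = f x" "E (lie_incl (lie_gen x)) = f x" for x
    using * ** unfolding pois_gen_def by blast+
  have incl: "D (lie_incl u) = E (lie_incl u)" for u
    by (induction u rule: free_lie_induct)
      (simp_all add: gen lie_incl_zero lie_incl_add lie_incl_scale D.zero E.zero D.add E.add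
        D.scale E.scale pois_bracket_lie_incl[symmetric] bracket)
  have one: "D 1 = 0" "E 1 = 0" using mult[of 1 1] by simp_all
  have const: "D (pois_const c) = 0" "E (pois_const c) = 0" for c
    using D.scale[of c 1] E.scale[of c 1] by (simp_all add: pois_scale_def one)
  have "D p = E p" for p
  proof (induction p rule: pois_induct)
    case (var e)
    show ?case using incl[of "Rep_lie_basis_elem e"] by (simp add: lie_incl_basis)
  qed (simp_all add: const D.add E.add mult)
  then show "D = E" by (rule ext)
qed

text \<open>The derivation \<open>\<Sum>x. f x \<partial>/\<partial>x\<close>; existence and uniqueness are \<open>poisson_derivation_ex1\<close>.\<close>

definition derivation_of ::
  "('x \<Rightarrow> ('k::field, 'x) free_poisson) \<Rightarrow> ('k, 'x) free_poisson \<Rightarrow> ('k, 'x) free_poisson" where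
  "derivation_of f = (THE D. poisson_derivation D \<and> (\<forall>x. D (pois_gen x) = f x))"

definition locally_nilpotent :: "('a::zero \<Rightarrow> 'a) \<Rightarrow> bool" where
  "locally_nilpotent D \<longleftrightarrow> (\<forall>a. \<exists>m. (D ^^ m) a = 0)"

text \<open>Preservation of \<open>1\<close> follows from surjectivity and multiplicativity.\<close>

definition poisson_automorphism ::
  "(('k::field, 'x) free_poisson \<Rightarrow> ('k, 'x) free_poisson) \<Rightarrow> bool" where
  "poisson_automorphism \<phi> \<longleftrightarrow> bij \<phi> \<and> Vector_Spaces.linear pois_scale pois_scale \<phi> \<and>
     (\<forall>p q. \<phi> (p * q) = \<phi> p * \<phi> q) \<and>
     (\<forall>p q. \<phi> (pois_bracket p q) = pois_bracket (\<phi> p) (\<phi> q))"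

inductive_set poisson_subalgebra ::
  "('k::field, 'x) free_poisson set \<Rightarrow> ('k, 'x) free_poisson set"
  for S :: "('k::field, 'x) free_poisson set" where
  const: "pois_const c \<in> poisson_subalgebra S"
| base: "p \<in> S \<Longrightarrow> p \<in> poisson_subalgebra S"
| add: "p \<in> poisson_subalgebra S \<Longrightarrow> q \<in> poisson_subalgebra S \<Longrightarrow> p + q \<in> poisson_subalgebra S"
| mult: "p \<in> poisson_subalgebra S \<Longrightarrow> q \<in> poisson_subalgebra S \<Longrightarrow> p * q \<in> poisson_subalgebra S"
| bracket: "p \<in> poisson_subalgebra S \<Longrightarrow> q \<in> poisson_subalgebra S \<Longrightarrow>
    pois_bracket p q \<in> poisson_subalgebra S"

definition elementary_automorphism ::
  "(('k::field, 'x) free_poisson \<Rightarrow> ('k, 'x) free_poisson) \<Rightarrow> bool" where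
  "elementary_automorphism \<phi> \<longleftrightarrow> poisson_automorphism \<phi> \<and>
     (\<exists>i \<alpha> h. \<alpha> \<noteq> 0 \<and> h \<in> poisson_subalgebra {pois_gen j |j. j \<noteq> i} \<and>
        \<phi> (pois_gen i) = pois_scale \<alpha> (pois_gen i) + h \<and>
        (\<forall>j. j \<noteq> i \<longrightarrow> \<phi> (pois_gen j) = pois_gen j))"

inductive tame_automorphism ::
  "(('k::field, 'x) free_poisson \<Rightarrow> ('k, 'x) free_poisson) \<Rightarrow> bool" where
  elementary: "elementary_automorphism \<phi> \<Longrightarrow> tame_automorphism \<phi>"
| comp: "tame_automorphism \<phi> \<Longrightarrow> tame_automorphism \<psi> \<Longrightarrow> tame_automorphism (\<phi> \<circ> \<psi>)"

datatype two = X1 | X2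

definition pois_poly :: "'k::field poly \<Rightarrow> ('k, 'x) free_poisson \<Rightarrow> ('k, 'x) free_poisson" where
  "pois_poly f p = poly (map_poly pois_const f) p"

end

(* Write x, y for the generators of P = S(g). The enveloping algebra of g is the free associative
   algebra T on x, y, and in characteristic zero g embeds into T (Dynkin--Specht--Wever).

   Suppose that D x or D y involves a variable of P outside the span of x, y. Grade words by giving
   x and y the weights 1 and sqrt 2, and take linear parts of polynomials at a point of P. The top
   weight part of D then becomes a nonzero bihomogeneous derivation of T that is nilpotent on the
   generators. Such a derivation does not exist: if u and v are the last nonvanishing iterates of
   x and y, their leading words do not commute and hence generate a free monoid, so that any
   f(u, v) with f nonzero is nonzero, which contradicts the degree of the values on x and y.

   So D x and D y lie in k[x, y]. As D {x, y} is a multiple of {x, y}, it vanishes, that is, D is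
   given on k[x, y] by a Hamiltonian H, and the rest is Rentschler's theorem: the edge of the
   Newton polygon of H must be a power of x - m y^t up to exchange of x and y, and a shear
   removes it. *)

theory Submission
  imports Defs
begin

text \<open>P is commutative and has no leading words of its own. The linear part at a point turns a
  polynomial into an element of g, hence of T, where words can be compared; the point is chosen such
  that a top coefficient of D does not vanish there. A polynomial gets the weight of its heaviest
  variable, not of its heaviest monomial: coefficients then do not raise weights, and all terms in
  which a coefficient is differentiated fall below the top, because D raises weights by a positive
  amount. The irrational weight makes a single weight part bihomogeneous at once. In the plane, k
  need not be algebraically closed, so the polynomial of an edge need not split. Its roots are
  replaced by the minimal polynomial over k of a ratio of leading coefficients under exp(z E).
  Counting degrees forces it to be linear, so the shear is defined over k. The induction runs on
  bounds for the exponents of pure powers of x and y instead of on the polygon, so unattained bounds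
  can simply be lowered.\<close>

abbreviation "lookup \<equiv> Poly_Mapping.lookup"
abbreviation "keys \<equiv> Poly_Mapping.keys"
abbreviation "single \<equiv> Poly_Mapping.single"

section \<open>Free associative algebras and the Dynkin operator\<close>

text \<open>All intermediate sums keep their keys in S, so a homogeneity condition on p is available
  for every term.\<close>

lemma poly_mapping_keys_induct [consumes 1, case_names zero add]:
  fixes p :: "'i \<Rightarrow>\<^sub>0 'b::comm_monoid_add"
  assumes "keys p \<subseteq> S" and "P 0"
    and "\<And>k c p. k \<in> S \<Longrightarrow> P p \<Longrightarrow> P (single k c + p)"
  shows "P p"
proof -
  have "P (\<Sum>k\<in>K. single k (lookup p k))" if "finite K" "K \<subseteq> S" for K
    using that by (induction K) (auto simp: assms)
  moreover have "(\<Sum>k\<in>keys p. single k (lookup p k)) = p"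
    by (rule poly_mapping_eqI) (simp add: lookup_sum lookup_single when_def in_keys_iff)
  ultimately show ?thesis using assms(1) finite_keys by metis
qed

text \<open>With concatenation as addition on lists, the convolution product makes the finitely supported
  functions on words the free associative algebra.\<close>

instantiation list :: (type) monoid_add
begin

definition zero_list :: "'a list" where "zero_list = []"

definition plus_list :: "'a list \<Rightarrow> 'a list \<Rightarrow> 'a list" where "plus_list = (@)"

instance by standard (simp_all add: zero_list_def plus_list_def)

end

type_synonym ('k, 'x) free_assoc = "'x list \<Rightarrow>\<^sub>0 'k"

definition assoc_scale :: "'k::field \<Rightarrow> ('k, 'x) free_assoc \<Rightarrow> ('k, 'x) free_assoc" where
  "assoc_scale c f = single [] c * f"

lemma assoc_mult_single:
  "single v a * single w b =
    (single (v @ w) (a * b) :: ('k::field, 'x) free_assoc)"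
  by (simp add: mult_single plus_list_def)

lemma assoc_single_Nil: "(single [] 1 :: ('k::field, 'x) free_assoc) = 1"
  by (simp flip: zero_list_def)

interpretation assoc: vector_space assoc_scale
  by unfold_locales
    (simp_all add: assoc_scale_def algebra_simps single_add assoc_mult_single assoc_single_Nil
      flip: mult.assoc)

lemma assoc_scale_single: "assoc_scale c (single w d) = single w (c * d)"
  by (simp add: assoc_scale_def assoc_mult_single)

lemma lookup_assoc_scale: "lookup (assoc_scale c f) w = c * lookup f w"
  by (induction f rule: poly_mapping_add_induct)
    (simp_all add: assoc.scale_right_distrib lookup_add assoc_scale_single lookup_single when_def
      algebra_simps)

lemma assoc_scale_mult_left: "assoc_scale c f * g = assoc_scale c (f * g)"
  by (simp add: assoc_scale_def mult.assoc)

lemma assoc_scale_mult_right: "f * assoc_scale c g = assoc_scale c (f * g)"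
proof -
  have "f * single [] c = single [] c * f"
    by (induction f rule: poly_mapping_add_induct)
      (simp_all add: algebra_simps assoc_mult_single)
  then show ?thesis by (simp add: assoc_scale_def flip: mult.assoc)
qed

text \<open>Generic in the target: it serves the Dynkin operator, derivations of T, substitution
  into words, and formal integration in P.\<close>

definition lin_ext :: "('k::field \<Rightarrow> 'v \<Rightarrow> 'v) \<Rightarrow> ('i \<Rightarrow> 'v) \<Rightarrow> ('i \<Rightarrow>\<^sub>0 'k) \<Rightarrow> 'v::ab_group_add" where
  "lin_ext scale g f = (\<Sum>w \<in> keys f. scale (lookup f w) (g w))"

context
  fixes scale :: "'k::field \<Rightarrow> 'v \<Rightarrow> 'v::ab_group_add"
  assumes scale: "vector_space scale"
begin

interpretation scale: vector_space scale by (rule scale)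

lemma lin_ext_add: "lin_ext scale g (f + f') = lin_ext scale g f + lin_ext scale g f'"
  unfolding lin_ext_def
  by (rule setsum_keys_plus_distrib) (simp_all add: scale.scale_left_distrib)

lemma lin_ext_single: "lin_ext scale g (single w c) = scale c (g w)"
  by (cases "c = 0") (simp_all add: lin_ext_def)

lemma lin_ext_zero: "lin_ext scale g 0 = 0"
  by (simp add: lin_ext_def)

lemma lin_ext_diff: "lin_ext scale g (f - f') = lin_ext scale g f - lin_ext scale g f'"
  using lin_ext_add[of g "f - f'" f'] by (simp add: algebra_simps)

lemma lin_ext_scale: "lin_ext scale g (assoc_scale c f) = scale c (lin_ext scale g f)"
  by (induction f rule: poly_mapping_add_induct)
    (simp_all add: assoc.scale_right_distrib lin_ext_add lin_ext_zero lin_ext_single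
      assoc_scale_single scale.scale_right_distrib)

lemmas lin_ext_simps = lin_ext_add lin_ext_single lin_ext_zero lin_ext_diff lin_ext_scale

end

lemmas lin_ext_lie = lin_ext_simps[OF free_lie.vector_space_axioms]

interpretation assoc_lie: lie_algebra assoc_scale "\<lambda>f g. f * g - g * f"
  by unfold_locales (simp_all add: algebra_simps assoc_scale_mult_left assoc_scale_mult_right
      assoc.scale_right_diff_distrib)

section \<open>The map from the free Lie algebra to T, and the Dynkin operator\<close>

definition lie_embed :: "('k::field, 'x) free_lie \<Rightarrow> ('k, 'x) free_assoc" where
  "lie_embed = (THE h. Vector_Spaces.linear lie_scale assoc_scale h \<and>
    (\<forall>u v. h (lie_bracket u v) = h u * h v - h v * h u) \<and>
    (\<forall>x. h (lie_gen x) = single [x] 1))"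

lemmas lie_embed_props =
  theI'[OF assoc_lie.free_lie_universal[of "\<lambda>x. single [x] 1"], folded lie_embed_def]

lemmas linear_lie_embed = lie_embed_props[THEN conjunct1]
  and lie_embed_bracket = lie_embed_props[THEN conjunct2, THEN conjunct1, rule_format]
  and lie_embed_gen = lie_embed_props[THEN conjunct2, THEN conjunct2, rule_format]

interpretation lie_embed: Vector_Spaces.linear lie_scale assoc_scale lie_embed
  by (rule linear_lie_embed)

fun ad_word :: "'x list \<Rightarrow> ('k::field, 'x) free_lie \<Rightarrow> ('k, 'x) free_lie" where
  "ad_word [] u = u"
| "ad_word (x # w) u = lie_bracket (lie_gen x) (ad_word w u)"

text \<open>Right-normed brackets, from which Dynkin's map is built. The value 0 at the empty word
  does not fit the recursion, which is why \<open>dynkin_mult\<close> asks for a factor without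
  constant term.\<close>

fun bracket_word :: "'x list \<Rightarrow> ('k::field, 'x) free_lie" where
  "bracket_word [] = 0"
| "bracket_word [x] = lie_gen x"
| "bracket_word (x # y # w) = lie_bracket (lie_gen x) (bracket_word (y # w))"

text \<open>The adjoint action of g on itself, extended to the enveloping algebra T; it makes g a
  left T-module (\<open>ad_assoc_mult\<close>).\<close>

definition ad_assoc :: "('k::field, 'x) free_assoc \<Rightarrow> ('k, 'x) free_lie \<Rightarrow> ('k, 'x) free_lie" where
  "ad_assoc f u = lin_ext lie_scale (\<lambda>w. ad_word w u) f"

definition dynkin :: "('k::field, 'x) free_assoc \<Rightarrow> ('k, 'x) free_lie" where
  "dynkin = lin_ext lie_scale bracket_word"

lemma ad_word_append: "ad_word (v @ w) u = ad_word v (ad_word w u)"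
  by (induction v) simp_all

lemma ad_word_add: "ad_word w (u + v) = ad_word w u + ad_word w v"
  by (induction w) (simp_all add: free_lie.bracket_add_right)

lemma ad_word_scale: "ad_word w (lie_scale c u) = lie_scale c (ad_word w u)"
  by (induction w) (simp_all add: free_lie.bracket_scale_right)

lemma ad_word_zero: "ad_word w 0 = 0"
  using ad_word_scale[of w 0 0] by simp

lemma bracket_word_append: "w \<noteq> [] \<Longrightarrow> bracket_word (v @ w) = ad_word v (bracket_word w)"
proof (induction v)
  case (Cons x v)
  then obtain y w' where "v @ w = y # w'" by (cases "v @ w") auto
  with Cons show ?case by simp
qed simp

lemma ad_assoc_simps:
  "ad_assoc (f + g) u = ad_assoc f u + ad_assoc g u"
  "ad_assoc 0 u = 0"
  "ad_assoc (f - g) u = ad_assoc f u - ad_assoc g u"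
  "ad_assoc (assoc_scale c f) u = lie_scale c (ad_assoc f u)"
  "ad_assoc (single w c) u = lie_scale c (ad_word w u)"
  by (simp_all add: ad_assoc_def lin_ext_lie)

lemma ad_assoc_arg:
  "ad_assoc f (u + v) = ad_assoc f u + ad_assoc f v"
  "ad_assoc f (lie_scale c u) = lie_scale c (ad_assoc f u)"
  "ad_assoc f 0 = 0"
  by (induction f rule: poly_mapping_add_induct)
    (simp_all add: ad_assoc_simps ad_word_add ad_word_scale ad_word_zero
      free_lie.scale_right_distrib free_lie.scale_scale free_lie.scale_left_commute)

lemma ad_assoc_mult: "ad_assoc (f * g) u = ad_assoc f (ad_assoc g u)"
proof (induction f rule: poly_mapping_add_induct)
  case (add v c f)
  have "ad_assoc (single v c * g) u = lie_scale c (ad_word v (ad_assoc g u))"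
    by (induction g rule: poly_mapping_add_induct)
      (simp_all add: ad_assoc_simps assoc_mult_single ad_word_append ad_word_scale ad_word_add
        ad_word_zero free_lie.scale_right_distrib algebra_simps)
  with add show ?case by (simp add: ad_assoc_simps distrib_right)
qed (simp add: ad_assoc_simps)

text \<open>The Jacobi identity in the form that ad turns brackets into commutators of
  operators.\<close>

lemma lie_jacobi_ad:
  "lie_bracket (lie_bracket u v) w = lie_bracket u (lie_bracket v w) - lie_bracket v (lie_bracket u w)"
proof -
  have "lie_bracket u (lie_bracket v w) + lie_bracket v (- lie_bracket u w)
      - lie_bracket (lie_bracket u v) w = 0"
    using free_lie.jacobi[of u v w] lie_bracket_anti[of w u] lie_bracket_anti[of w "lie_bracket u v"]
    by simp
  moreover have "lie_bracket v (- lie_bracket u w) = - lie_bracket v (lie_bracket u w)"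
    using free_lie.bracket_scale_right[of v "-1" "lie_bracket u w"] by simp
  ultimately show ?thesis by (simp add: algebra_simps)
qed

text \<open>Both sides are representations of g that agree on the generators.\<close>

lemma ad_assoc_embed: "ad_assoc (lie_embed u) v = lie_bracket u v"
proof (induction u arbitrary: v rule: free_lie_induct)
  case (bracket u u')
  then show ?case by (simp add: lie_embed_bracket ad_assoc_simps ad_assoc_mult lie_jacobi_ad)
qed (simp_all add: lie_embed_gen lie_embed.add lie_embed.scale lie_embed.zero ad_assoc_simps
    free_lie.bracket_add_left free_lie.bracket_scale_left lie_bracket_zero)

lemma lookup_mult_Nil:
  "lookup (f * g :: ('k::field, 'x) free_assoc) [] =
    lookup f [] * lookup g []"
proof (induction f rule: poly_mapping_add_induct)
  case (add v c f)
  have "lookup (single v c * g) [] =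
      lookup (single v c) [] * lookup g []"
    by (induction g rule: poly_mapping_add_induct)
      (auto simp: assoc_mult_single lookup_single when_def distrib_left lookup_add)
  with add show ?case by (simp add: distrib_right lookup_add)
qed simp

lemma lie_embed_Nil: "lookup (lie_embed u) [] = 0"
  by (induction u rule: free_lie_induct)
    (simp_all add: lie_embed_gen lie_embed.add lie_embed.scale lie_embed.zero lookup_add
      lookup_assoc_scale lie_embed_bracket lookup_minus lookup_mult_Nil lookup_single)

text \<open>For nonempty w, the right-normed bracket of v @ w arises from that of w by applying the
  letters of v one after another (\<open>bracket_word_append\<close>). The rest is
  linearity.\<close>

lemma dynkin_mult:
  assumes "lookup g [] = 0"
  shows "dynkin (f * g) = ad_assoc f (dynkin g)"
proof -
  have *: "dynkin (f * single w c) = ad_assoc f (dynkin (single w c))"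
    if "w \<noteq> []" for w c
    using that
    by (induction f rule: poly_mapping_add_induct)
      (simp_all add: dynkin_def lin_ext_lie
        ad_assoc_simps assoc_mult_single bracket_word_append distrib_right ad_word_scale)
  have "keys g \<subseteq> - {[]}" using assms by (auto simp: in_keys_iff)
  then show ?thesis
  proof (induction rule: poly_mapping_keys_induct)
    case (add w c g)
    then have "w \<noteq> []" by blast
    from *[OF this, of c] add show ?case
      by (simp add: dynkin_def lin_ext_lie ad_assoc_arg distrib_left)
  qed (simp add: dynkin_def lin_ext_lie ad_assoc_arg)
qed

text \<open>The Euler operator of g: a derivation that fixes the generators, so it multiplies
  elements of degree n by n. That it factors through T is what yields the injectivity of
  \<open>lie_embed\<close>.\<close>

definition lie_euler :: "('k::field, 'x) free_lie \<Rightarrow> ('k, 'x) free_lie" where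
  "lie_euler u = dynkin (lie_embed u)"

lemma lie_euler_simps:
  "lie_euler (lie_gen x) = lie_gen x"
  "lie_euler (u + v) = lie_euler u + lie_euler v"
  "lie_euler 0 = 0"
  "lie_euler (lie_scale c u) = lie_scale c (lie_euler u)"
  by (simp_all add: lie_euler_def dynkin_def lie_embed_gen lie_embed.add lie_embed.scale
      lie_embed.zero lin_ext_lie)

text \<open>The Dynkin--Specht--Wever identity: left multiplication by \<open>lie_embed u\<close> becomes the adjoint
  action under \<open>dynkin\<close>, so \<open>dynkin \<circ> lie_embed\<close> is a derivation.\<close>

lemma lie_euler_bracket:
  "lie_euler (lie_bracket u v) = lie_bracket (lie_euler u) v + lie_bracket u (lie_euler v)"
proof -
  have "lie_euler (lie_bracket u v) = lie_bracket u (lie_euler v) - lie_bracket v (lie_euler u)"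
    by (simp add: lie_euler_def lie_embed_bracket dynkin_mult lie_embed_Nil ad_assoc_embed
        dynkin_def lin_ext_lie dynkin_mult[unfolded dynkin_def])
  then show ?thesis using lie_bracket_anti[of v "lie_euler u"] by simp
qed

lemma lie_euler_monomial:
  assumes "u \<in> lie_monomials"
  shows "\<exists>n > 0. lie_euler u = lie_scale (of_nat n) u"
  using assms
proof induction
  case (gen x)
  show ?case by (intro exI[of _ 1]) (simp add: lie_euler_simps)
next
  case (bracket u v)
  then obtain m n :: nat where "m > 0" "lie_euler u = lie_scale (of_nat m) u"
    "lie_euler v = lie_scale (of_nat n) v" by blast
  then show ?case
    by (intro exI[of _ "m + n"])
      (simp add: lie_euler_bracket free_lie.bracket_scale_left free_lie.bracket_scale_right
        free_lie.scale_left_distrib)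
qed

text \<open>The operator (E - n) ... (E - 2)(E - 1) for E = \<open>lie_euler\<close>. It kills the
  degrees 1 to n, but on the kernel of E it is the scalar (-1)^n n!. This replaces a direct sum
  decomposition of the free Lie algebra by degree.\<close>

primrec euler_prod :: "nat \<Rightarrow> ('k::field, 'x) free_lie \<Rightarrow> ('k, 'x) free_lie" where
  "euler_prod 0 u = u"
| "euler_prod (Suc n) u =
    lie_euler (euler_prod n u) - lie_scale (of_nat (Suc n)) (euler_prod n u)"

lemma euler_prod_simps:
  "euler_prod n (u + v) = euler_prod n u + euler_prod n v"
  "euler_prod n 0 = 0"
  "euler_prod n (lie_scale c u) = lie_scale c (euler_prod n u)"
  by (induction n) (simp_all add: lie_euler_simps algebra_simps free_lie.scale_right_distrib
      free_lie.scale_right_diff_distrib)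

lemma euler_prod_eigen:
  assumes "lie_euler u = lie_scale c u"
  shows "euler_prod n u = lie_scale (\<Prod>i = 1..n. c - of_nat i) u"
  by (induction n)
    (simp_all add: lie_euler_simps assms left_diff_distrib right_diff_distrib distrib_right distrib_left mult.commute
      flip: free_lie.scale_left_diff_distrib)

lemma euler_prod_eventually_zero: "\<exists>N. \<forall>n \<ge> N. euler_prod n u = 0"
proof -
  have "u \<in> free_lie.span lie_monomials" by (simp add: span_lie_monomials)
  then show ?thesis
  proof (induction rule: free_lie.span_induct_alt)
    case base
    then show ?case by (simp add: euler_prod_simps)
  next
    case (step c x y)
    then obtain N where N: "\<forall>n \<ge> N. euler_prod n y = 0" by blast
    obtain m where m: "m > 0" "lie_euler x = lie_scale (of_nat m) x"
      using lie_euler_monomial step by blast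
    have "euler_prod n x = 0" if "n \<ge> m" for n
      unfolding euler_prod_eigen[OF m(2)]
      using that m(1) by (subst prod_zero) (auto intro!: bexI[of _ m])
    then show ?case
      using N by (intro exI[of _ "max m N"]) (auto simp: euler_prod_simps)
  qed
qed

theorem lie_embed_eq_0_iff [simp]:
  fixes u :: "('k::field_char_0, 'x) free_lie"
  shows "lie_embed u = 0 \<longleftrightarrow> u = 0"
proof
  assume "lie_embed u = 0"
  \<comment> \<open>So u lies in the kernel of the Euler operator, where the product is (-1)^N N!
    times u. For large N it is also 0, and N! is invertible in characteristic zero.\<close>
  then have "lie_euler u = lie_scale 0 u"
    by (simp add: lie_euler_def dynkin_def lin_ext_lie)
  from euler_prod_eigen[OF this] euler_prod_eventually_zero[of u]
  obtain N where "lie_scale (\<Prod>i = 1..N. - of_nat i :: 'k) u = 0" by force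
  then show "u = 0" by simp
qed (simp add: lie_embed.zero)

section \<open>The Leibniz rule for iterates of a derivation\<close>

lemma Leibniz_funpow:
  fixes D :: "'a::ring_1 \<Rightarrow> 'a"
  assumes add: "\<And>f g. D (f + g) = D f + D g" and mult: "\<And>f g. D (f * g) = D f * g + f * D g"
  shows "(D ^^ n) (f * g) = (\<Sum>i\<le>n. of_nat (n choose i) * ((D ^^ i) f * (D ^^ (n - i)) g))"
proof (induction n)
  case (Suc n)
  have zero: "D 0 = 0" using add[of 0 0] by simp
  have sum: "D (sum h A) = (\<Sum>i\<in>A. D (h i))" for h and A :: "nat set"
    by (induction A rule: infinite_finite_induct) (simp_all add: zero add)
  have "D 1 = 0" using mult[of 1 1] by simp
  \<comment> \<open>Integers are constants of D, so binomial coefficients pass through it.\<close>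
  then have of_nat: "D (of_nat c) = 0" for c by (induction c) (simp_all add: zero add)
  let ?F = "\<lambda>i j. (D ^^ i) f * (D ^^ j) g"
  have "(D ^^ Suc n) (f * g) = (\<Sum>i\<le>n. of_nat (n choose i) * (?F (Suc i) (n - i) + ?F i (Suc (n - i))))"
    by (simp add: Suc sum mult of_nat)
  also have "\<dots> = (\<Sum>i\<le>n. of_nat (n choose i) * ?F (Suc i) (n - i)) +
      (\<Sum>i\<le>n. of_nat (n choose i) * ?F i (Suc n - i))"
    by (simp add: distrib_left sum.distrib Suc_diff_le)
  also have "(\<Sum>i\<le>n. of_nat (n choose i) * ?F i (Suc n - i)) =
      (\<Sum>i\<le>Suc n. of_nat (n choose i) * ?F i (Suc n - i))"
    by (simp add: binomial_eq_0)
  also have "\<dots> = ?F 0 (Suc n) + (\<Sum>i\<le>n. of_nat (n choose Suc i) * ?F (Suc i) (n - i))"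
    by (subst sum.atMost_Suc_shift) simp
  also have "(\<Sum>i\<le>n. of_nat (n choose i) * ?F (Suc i) (n - i)) +
      (?F 0 (Suc n) + (\<Sum>i\<le>n. of_nat (n choose Suc i) * ?F (Suc i) (n - i))) =
      (\<Sum>i\<le>Suc n. of_nat (Suc n choose i) * ?F i (Suc n - i))"
    by (subst sum.atMost_Suc_shift) (simp add: sum.distrib algebra_simps)
  finally show ?case .
qed simp

lemma funpow_zero_ge:
  fixes D :: "'a::zero \<Rightarrow> 'a"
  assumes "(D ^^ m) f = 0" "D 0 = 0" "m \<le> n"
  shows "(D ^^ n) f = 0"
proof -
  have "(D ^^ k) 0 = 0" for k using assms(2) by (induction k) simp_all
  moreover have "(D ^^ n) f = (D ^^ (n - m)) ((D ^^ m) f)"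
    using assms(3) by (simp flip: funpow_add comp_apply[of "D ^^ (n - m)" "D ^^ m"])
  ultimately show ?thesis using assms(1) by simp
qed

text \<open>Only the product of the last nonvanishing iterates survives in the Leibniz rule.\<close>

lemma Leibniz_funpow_top:
  fixes D :: "'a::ring_1 \<Rightarrow> 'a"
  assumes add: "\<And>f g. D (f + g) = D f + D g" and mult: "\<And>f g. D (f * g) = D f * g + f * D g"
    and f: "(D ^^ Suc m) f = 0" and g: "(D ^^ Suc n) g = 0"
  shows "(D ^^ (m + n)) (f * g) = of_nat ((m + n) choose m) * ((D ^^ m) f * (D ^^ n) g)"
    and "(D ^^ Suc (m + n)) (f * g) = 0"
proof -
  note L = Leibniz_funpow[of D, OF add mult]
  have zero: "D 0 = 0" using add[of 0 0] by simp
  have f: "(D ^^ i) f = 0" if "i > m" for i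
    using funpow_zero_ge[OF f zero, of i] that by simp
  have g: "(D ^^ i) g = 0" if "i > n" for i
    using funpow_zero_ge[OF g zero, of i] that by simp
  have "(D ^^ (m + n)) (f * g) =
      (\<Sum>i\<le>m + n. if i = m then of_nat ((m + n) choose m) * ((D ^^ m) f * (D ^^ n) g) else 0)"
    unfolding L by (intro sum.cong refl) (auto simp: f g not_less nat_neq_iff)
  then show "(D ^^ (m + n)) (f * g) = of_nat ((m + n) choose m) * ((D ^^ m) f * (D ^^ n) g)"
    by simp
  show "(D ^^ Suc (m + n)) (f * g) = 0"
    unfolding L
  proof (intro sum.neutral ballI)
    fix i
    show "of_nat (Suc (m + n) choose i) * ((D ^^ i) f * (D ^^ (Suc (m + n) - i)) g) = 0"
      by (cases "i > m") (simp_all add: f g)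
  qed
qed

lemma last_funpow_nonzero:
  fixes D :: "'a::zero \<Rightarrow> 'a"
  assumes "(D ^^ N) f = 0" "f \<noteq> 0"
  obtains m where "(D ^^ m) f \<noteq> 0" "(D ^^ Suc m) f = 0"
proof -
  have "(LEAST n. (D ^^ n) f = 0) \<noteq> 0"
    using LeastI[of "\<lambda>n. (D ^^ n) f = 0", OF assms(1)] assms(2) by (metis funpow_0)
  then obtain m where "(LEAST n. (D ^^ n) f = 0) = Suc m" by (metis not0_implies_Suc)
  with LeastI[of "\<lambda>n. (D ^^ n) f = 0", OF assms(1)] not_less_Least[of m "\<lambda>n. (D ^^ n) f = 0"]
  show ?thesis by (intro that[of m]) simp_all
qed

section \<open>Derivations of T with given values on the letters\<close>

fun der_word :: "('x \<Rightarrow> ('k::field, 'x) free_assoc) \<Rightarrow> 'x list \<Rightarrow> ('k, 'x) free_assoc" where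
  "der_word d [] = 0"
| "der_word d (x # w) = d x * single w 1 + single [x] 1 * der_word d w"

definition assoc_der ::
  "('x \<Rightarrow> ('k::field, 'x) free_assoc) \<Rightarrow> ('k, 'x) free_assoc \<Rightarrow> ('k, 'x) free_assoc" where
  "assoc_der d = lin_ext assoc_scale (der_word d)"

lemmas lin_ext_assoc = lin_ext_simps[OF assoc.vector_space_axioms]

lemma assoc_der_simps:
  "assoc_der d (f + g) = assoc_der d f + assoc_der d g"
  "assoc_der d (single w c) = assoc_scale c (der_word d w)"
  "assoc_der d 0 = 0"
  "assoc_der d (f - g) = assoc_der d f - assoc_der d g"
  "assoc_der d (assoc_scale c f) = assoc_scale c (assoc_der d f)"
  by (simp_all add: assoc_der_def lin_ext_assoc)

lemma single_assoc_scale: "single w c = assoc_scale c (single w 1)"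
  by (simp add: assoc_scale_single)

lemma der_word_append:
  fixes d :: "'x \<Rightarrow> ('k::field, 'x) free_assoc"
  shows "der_word d (v @ w) =
    der_word d v * single w 1 + single v 1 * der_word d w"
proof (induction v)
  case (Cons x v)
  have "(single (v @ w) 1 :: ('k, 'x) free_assoc) =
      single v 1 * single w 1"
    "(single (x # v) 1 :: ('k, 'x) free_assoc) =
      single [x] 1 * single v 1"
    by (simp_all add: assoc_mult_single)
  with Cons show ?case by (simp add: distrib_right distrib_left mult.assoc)
qed (simp add: assoc_single_Nil)

lemma assoc_der_mult: "assoc_der d (f * g) = assoc_der d f * g + f * assoc_der d g"
proof (induction f rule: poly_mapping_add_induct)
  case (add v a f)
  have "assoc_der d (single v a * g) =
      assoc_der d (single v a) * g + single v a * assoc_der d g"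
  proof (induction g rule: poly_mapping_add_induct)
    case (add w b g)
    have "assoc_der d (single v a * single w b) =
      assoc_der d (single v a) * single w b +
      single v a * assoc_der d (single w b)"
      by (subst (2 4 5) single_assoc_scale)
        (simp add: assoc_mult_single assoc_der_simps der_word_append assoc_scale_mult_left
          assoc_scale_mult_right assoc.scale_right_distrib mult.commute)
    with add show ?case by (simp add: assoc_der_simps distrib_left)
  qed (simp add: assoc_der_simps)
  with add show ?case by (simp add: assoc_der_simps distrib_right)
qed (simp add: assoc_der_simps)

lemma assoc_der_gen: "assoc_der d (single [x] 1) = d x"
  by (simp add: assoc_der_simps assoc_single_Nil)

definition word_prod :: "('x \<Rightarrow> ('k::field, 'x) free_assoc) \<Rightarrow> 'x list \<Rightarrow> ('k, 'x) free_assoc" where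
  "word_prod v w = prod_list (map v w)"

text \<open>The last iterate of a product is a binomial coefficient times the product of the last
  iterates. With these written as m! v, the coefficients cancel, and a word goes to a factorial
  times the substitution of v into it.\<close>

lemma assoc_der_funpow_word:
  fixes d :: "'x \<Rightarrow> ('k::field_char_0, 'x) free_assoc"
  assumes m: "\<And>x. (assoc_der d ^^ Suc (m x)) (single [x] 1) = 0"
    and v: "\<And>x. (assoc_der d ^^ m x) (single [x] 1) = assoc_scale (fact (m x)) (v x)"
  shows "(assoc_der d ^^ sum_list (map m w)) (single w 1) =
      assoc_scale (fact (sum_list (map m w))) (word_prod v w) \<and>
    (assoc_der d ^^ Suc (sum_list (map m w))) (single w 1) = 0"
proof (induction w)
  case Nil
  then show ?case using assoc_der_simps(2)[of d "[]" 1] by (simp add: word_prod_def assoc_single_Nil)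
next
  case (Cons x w)
  let ?D = "assoc_der d" and ?b = "sum_list (map m w)"
  let ?X = "single [x] 1 :: ('k, 'x) free_assoc"
    and ?W = "single w 1 :: ('k, 'x) free_assoc"
  note top = Leibniz_funpow_top[of ?D, OF assoc_der_simps(1) assoc_der_mult m[of x]
      conjunct2[OF Cons.IH]]
  have w: "single (x # w) 1 = ?X * ?W" by (simp add: assoc_mult_single)
  have "(?D ^^ (m x + ?b)) (?X * ?W) =
      of_nat ((m x + ?b) choose m x) * ((?D ^^ m x) ?X * (?D ^^ ?b) ?W)"
    by (rule top(1))
  also have "\<dots> = of_nat ((m x + ?b) choose m x) * (assoc_scale (fact (m x)) (v x) *
      assoc_scale (fact ?b) (word_prod v w))"
    using Cons.IH by (simp add: v)
  also have "\<dots> = assoc_scale (of_nat ((m x + ?b) choose m x) * (fact (m x) * fact ?b)) (v x * word_prod v w)"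
  proof -
    have "of_nat c * f = assoc_scale (of_nat c) f" for c and f :: "('k, 'x) free_assoc"
      by (induction c) (simp_all add: distrib_right assoc.scale_left_distrib)
    then show ?thesis
      by (simp add: assoc_scale_mult_left assoc_scale_mult_right mult_ac)
  qed
  also have "of_nat ((m x + ?b) choose m x) * (fact (m x) * fact ?b) = (fact (m x + ?b) :: 'k)"
    by (simp add: binomial_fact)
  finally have 1: "(?D ^^ (m x + ?b)) (?X * ?W) = assoc_scale (fact (m x + ?b)) (v x * word_prod v w)" .
  with 1 top(2) show ?case by (simp add: w word_prod_def del: funpow.simps)
qed

text \<open>All words of f reach their last iterate at the same exponent N, so up to N! the map D^N
  acts on f as a substitution.\<close>

lemma assoc_der_funpow_lin_ext:
  fixes d :: "'x \<Rightarrow> ('k::field_char_0, 'x) free_assoc"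
  assumes m: "\<And>x. (assoc_der d ^^ Suc (m x)) (single [x] 1) = 0"
    and v: "\<And>x. (assoc_der d ^^ m x) (single [x] 1) = assoc_scale (fact (m x)) (v x)"
    and "keys f \<subseteq> {w. sum_list (map m w) = N}"
  shows "(assoc_der d ^^ N) f = assoc_scale (fact N) (lin_ext assoc_scale (word_prod v) f)"
proof -
  have lin: "(assoc_der d ^^ n) (f + g) = (assoc_der d ^^ n) f + (assoc_der d ^^ n) g"
    "(assoc_der d ^^ n) (assoc_scale c f) = assoc_scale c ((assoc_der d ^^ n) f)"
    "(assoc_der d ^^ n) 0 = 0" for n f g c
    by (induction n) (simp_all add: assoc_der_simps)
  from assms(3) show ?thesis
  proof (induction rule: poly_mapping_keys_induct)
    case (add w c f)
    then have "sum_list (map m w) = N" by simp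
    with assoc_der_funpow_word[OF m v, of w]
    have "(assoc_der d ^^ N) (single w 1) = assoc_scale (fact N) (word_prod v w)"
      by simp
    with add show ?case
      by (subst single_assoc_scale)
        (simp add: lin lin_ext_assoc assoc.scale_right_distrib mult.commute)
  qed (simp add: lin lin_ext_assoc)
qed

section \<open>Leading words and nilpotent derivations of the free associative algebra\<close>

fun two_words :: "'a list \<Rightarrow> 'a list \<Rightarrow> two list \<Rightarrow> 'a list" where
  "two_words a b [] = []"
| "two_words a b (X1 # w) = a @ two_words a b w"
| "two_words a b (X2 # w) = b @ two_words a b w"

lemma two_list_induct [case_names Nil X1 X2]:
  assumes "P []" "\<And>w. P w \<Longrightarrow> P (X1 # w)" "\<And>w. P w \<Longrightarrow> P (X2 # w)"
  shows "P w"
proof (induction w)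
  case (Cons c w)
  then show ?case by (cases c) (simp_all add: assms)
qed (rule assms)

lemma two_list_cases [case_names Nil X1 X2]:
  obtains "w = []" | v where "w = X1 # v" | v where "w = X2 # v"
  by (induction w rule: two_list_induct) blast+

text \<open>One step of Euclid's algorithm: if a nonempty a is a prefix of the second word, the
  substitution factors through X1 -> X1, X2 -> X1 X2 and a pair of smaller total length.\<close>

lemma two_words_twist: "two_words a (a @ b) w = two_words a b (two_words [X1] [X1, X2] w)"
  by (induction w rule: two_list_induct) simp_all

lemma two_words_twist': "two_words (b @ a) b w = two_words a b (two_words [X2, X1] [X2] w)"
  by (induction w rule: two_list_induct) simp_all

text \<open>This makes the elementary substitutions decodable. In the first one, a letter X1 of the
  image stands alone unless X2 follows it, because every nonempty continuation starts with X1. The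
  second is the same with the letters exchanged.\<close>

lemma two_words_twist_hd:
  "two_words [X1] [X1, X2] w = [] \<or> hd (two_words [X1] [X1, X2] w) = X1"
  "two_words [X2, X1] [X2] w = [] \<or> hd (two_words [X2, X1] [X2] w) = X2"
  by (induction w rule: two_list_induct) simp_all

lemma two_words_twist_inj:
  "two_words [X1] [X1, X2] w = two_words [X1] [X1, X2] w' \<Longrightarrow> w = w'"
proof (induction w arbitrary: w' rule: two_list_induct)
  case Nil
  then show ?case by (cases w' rule: two_list_cases) auto
next
  case (X1 w)
  then show ?case using two_words_twist_hd(1)[of w]
    by (cases w' rule: two_list_cases) auto
next
  case (X2 w)
  then show ?case
  proof (cases w' rule: two_list_cases)
    case (X1 v)
    then show ?thesis using X2 two_words_twist_hd(1)[of v]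
      by (cases "two_words [X1] [X1, X2] v") auto
  qed auto
qed

lemma two_words_twist_inj':
  "two_words [X2, X1] [X2] w = two_words [X2, X1] [X2] w' \<Longrightarrow> w = w'"
proof (induction w arbitrary: w' rule: two_list_induct)
  case Nil
  then show ?case by (cases w' rule: two_list_cases) auto
next
  case (X1 w)
  then show ?case
  proof (cases w' rule: two_list_cases)
    case (X2 v)
    then show ?thesis using X1 two_words_twist_hd(2)[of v]
      by (cases "two_words [X2, X1] [X2] v") auto
  qed auto
next
  case (X2 w)
  then show ?case using two_words_twist_hd(2)[of w]
    by (cases w' rule: two_list_cases) auto
qed

text \<open>Euclid's algorithm on the lengths of the two words.\<close>

lemma two_words_inj:
  assumes "a @ b \<noteq> b @ a" "two_words a b w = two_words a b w'"
  shows "w = w'"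
  using assms
proof (induction "length a + length b" arbitrary: a b w w' rule: less_induct)
  case less
  have ne: "a \<noteq> []" "b \<noteq> []" using less.prems by auto
  consider (b) b' where "b = a @ b'" | (a) a' where "a = b @ a'"
    | (neither) "\<nexists>b'. b = a @ b'" "\<nexists>a'. a = b @ a'" by blast
  then show ?case
  proof cases
    case b
    then have "two_words [X1] [X1, X2] w = two_words [X1] [X1, X2] w'"
      using less.prems ne by (intro less.hyps[of a b']) (auto simp: two_words_twist)
    then show ?thesis by (rule two_words_twist_inj)
  next
    case a
    then have "two_words [X2, X1] [X2] w = two_words [X2, X1] [X2] w'"
      using less.prems ne by (intro less.hyps[of a' b]) (auto simp: two_words_twist')
    then show ?thesis by (rule two_words_twist_inj')
  next
    case neither
    \<comment> \<open>Neither word is a prefix of the other, so the first letter of w can be read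
      off its image. Here Euclid's algorithm ends.\<close>
    have ab: "a @ u \<noteq> b @ v" for u v
      using neither by (auto simp: append_eq_append_conv2)
    from less.prems(2) show ?thesis
    proof (induction w arbitrary: w' rule: two_list_induct)
      case Nil
      then show ?case using ne by (cases w' rule: two_list_cases) auto
    next
      case X1
      then show ?case using ne ab by (cases w' rule: two_list_cases) auto
    next
      case X2
      then show ?case using ne ab[symmetric] by (cases w' rule: two_list_cases) auto
    qed
  qed
qed

text \<open>Commuting words are powers of a common word, hence their letter counts are proportional.
  The use is contrapositive: to see that two words do not commute.\<close>

lemma count_list_commute:
  assumes "a @ b = b @ a"
  shows "count_list a x * count_list b y = count_list a y * count_list b x"
proof -
  obtain m n zs where "concat (replicate m zs) = a" "concat (replicate n zs) = b"
    using comm_append_are_replicate[OF assms] by blast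
  moreover have "count_list (concat (replicate k zs)) z = k * count_list zs z" for k z
    by (induction k) simp_all
  ultimately show ?thesis by (auto simp: mult_ac)
qed

text \<open>Words of equal length are compared through their binary values.\<close>

fun word_val :: "two list \<Rightarrow> nat" where
  "word_val [] = 0"
| "word_val (X1 # w) = word_val w"
| "word_val (X2 # w) = 2 ^ length w + word_val w"

lemma word_val_append: "word_val (v @ w) = word_val v * 2 ^ length w + word_val w"
  by (induction v rule: two_list_induct) (simp_all add: power_add algebra_simps)

lemma word_val_less: "word_val w < 2 ^ length w"
  by (induction w rule: two_list_induct) auto

lemma word_val_inj: "length v = length w \<Longrightarrow> word_val v = word_val w \<Longrightarrow> v = w"
proof (induction v arbitrary: w rule: two_list_induct)
  case (X1 v)
  then show ?case using word_val_less[of v] by (cases w rule: two_list_cases) auto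
next
  case (X2 v)
  then show ?case using word_val_less by (cases w rule: two_list_cases) (auto, metis not_add_less1)
qed simp

text \<open>Equal length of all words is part of the notion, since \<open>word_val\<close> separates
  words only at equal length (\<open>word_val_inj\<close>).\<close>

definition leading_word :: "('k::field, two) free_assoc \<Rightarrow> two list \<Rightarrow> bool" where
  "leading_word f u \<longleftrightarrow> u \<in> keys f \<and>
    (\<forall>w \<in> keys f. length w = length u \<and> word_val w \<le> word_val u)"

lemma leading_word_exists:
  assumes "f \<noteq> 0" "\<And>w. w \<in> keys f \<Longrightarrow> length w = l"
  obtains u where "leading_word f u"
proof -
  have fin: "finite (word_val ` keys f)" "word_val ` keys f \<noteq> {}"
    using assms(1) by simp_all
  from Max_in[OF this] obtain u where "u \<in> keys f"
    "word_val u = Max (word_val ` keys f)" by auto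
  with fin assms(2) show ?thesis by (intro that[of u]) (auto simp: leading_word_def)
qed

lemma lookup_assoc_mult:
  fixes f g :: "('k::field, 'x) free_assoc"
  shows "lookup (f * g) u = (\<Sum>v \<in> keys f. \<Sum>w \<in> keys g.
    if v @ w = u then lookup f v * lookup g w else 0)"
proof -
  have sum: "h = (\<Sum>v \<in> keys h. single v (lookup h v))"
    for h :: "('k, 'x) free_assoc"
    by (rule poly_mapping_eqI) (simp add: lookup_sum lookup_single when_def in_keys_iff)
  have "f * g = (\<Sum>v \<in> keys f. \<Sum>w \<in> keys g.
      single (v @ w) (lookup f v * lookup g w))"
    by (subst sum[of f], subst sum[of g]) (simp add: sum_product assoc_mult_single)
  then show ?thesis by (simp add: lookup_sum lookup_single when_def)
qed

lemma keys_assoc_mult: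
  fixes f g :: "('k::field, 'x) free_assoc"
  assumes "u \<in> keys (f * g)"
  obtains v w where "v \<in> keys f" "w \<in> keys g" "u = v @ w"
  using keys_mult[of f g] assms by (auto simp: plus_list_def)

lemma leading_wordD:
  assumes "leading_word f u"
  shows "u \<in> keys f" and "lookup f u \<noteq> 0"
    and "w \<in> keys f \<Longrightarrow> length w = length u"
    and "w \<in> keys f \<Longrightarrow> word_val w \<le> word_val u"
proof -
  note * = conjunct1[OF assms[unfolded leading_word_def]] conjunct2[OF assms[unfolded leading_word_def]]
  show "u \<in> keys f" "lookup f u \<noteq> 0"
    using *(1) by (simp_all add: in_keys_iff)
  show "w \<in> keys f \<Longrightarrow> length w = length u"
    "w \<in> keys f \<Longrightarrow> word_val w \<le> word_val u"
    using bspec[OF *(2), of w] by simp_all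
qed

text \<open>The words of f have equal length, so u @ v splits in only one way and its coefficient is
  a product of two nonzero scalars. Concatenation is monotone by
  \<open>word_val_append\<close>.\<close>

lemma leading_word_mult:
  assumes f: "leading_word f u" and g: "leading_word g v"
  shows "leading_word (f * g) (u @ v)"
  unfolding leading_word_def
proof (intro conjI ballI)
  have "(v' @ w = u @ v) = (v' = u \<and> w = v)" if "v' \<in> keys f" for v' w
    using leading_wordD(3)[OF f that] by simp
  then have "lookup (f * g) (u @ v) =
    (\<Sum>v' \<in> keys f. \<Sum>w \<in> keys g. if w = v then
      if v' = u then lookup f u * lookup g v else 0 else 0)"
    unfolding lookup_assoc_mult by (intro sum.cong) simp_all
  also have "\<dots> = lookup f u * lookup g v"
    using leading_wordD(1)[OF f] leading_wordD(1)[OF g] by (simp only: sum.delta finite_keys if_True)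
  finally show "u @ v \<in> keys (f * g)"
    using leading_wordD(2)[OF f] leading_wordD(2)[OF g] by (simp add: in_keys_iff)
next
  fix w
  assume "w \<in> keys (f * g)"
  then obtain a b where ab: "a \<in> keys f" "b \<in> keys g" "w = a @ b"
    by (rule keys_assoc_mult)
  note D = leading_wordD(3,4)[OF f ab(1)] leading_wordD(3,4)[OF g ab(2)]
  show "length w = length (u @ v)" using D ab(3) by simp
  show "word_val w \<le> word_val (u @ v)"
    unfolding ab(3) word_val_append using D by (simp add: add_mono)
qed

lemma leading_word_word_prod:
  assumes "leading_word (v X1) a" "leading_word (v X2) b"
  shows "leading_word (word_prod v w) (two_words a b w)"
  using assms
proof (induction w rule: two_list_induct)
  case Nil
  then show ?case by (simp add: word_prod_def leading_word_def zero_list_def)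
qed (simp_all add: word_prod_def leading_word_mult)

text \<open>By \<open>two_words_inj\<close>, distinct words of f acquire distinct leading words, all
  of the common length l. The largest of these cannot cancel.\<close>

lemma lin_ext_word_prod_nonzero:
  fixes v :: "two \<Rightarrow> ('k::field, two) free_assoc"
  assumes v: "leading_word (v X1) a" "leading_word (v X2) b" "a @ b \<noteq> b @ a"
    and f: "f \<noteq> 0" "\<And>w. w \<in> keys f \<Longrightarrow> length (two_words a b w) = l"
  shows "lin_ext assoc_scale (word_prod v) f \<noteq> 0"
proof -
  let ?val = "\<lambda>w. word_val (two_words a b w)"
  have fin: "finite (?val ` keys f)" "?val ` keys f \<noteq> {}"
    using f(1) by simp_all
  from Max_in[OF this] obtain u where u: "u \<in> keys f"
    "?val u = Max (?val ` keys f)" by auto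
  note lead = leading_word_word_prod[OF v(1,2)]
  have "lookup (word_prod v w) (two_words a b u) = 0"
    if w: "w \<in> keys f" "w \<noteq> u" for w
  proof (rule ccontr)
    assume "lookup (word_prod v w) (two_words a b u) \<noteq> 0"
    then have le: "?val u \<le> ?val w"
      using leading_wordD(4)[OF lead[of w]] by (simp add: in_keys_iff)
    have "?val w \<le> ?val u" using u fin w by simp
    from antisym[OF this le] have "two_words a b w = two_words a b u"
      by (intro word_val_inj) (simp add: f(2) w(1) u(1))
    then show False using two_words_inj[OF v(3)] w(2) by blast
  qed
  then have "lookup (lin_ext assoc_scale (word_prod v) f) (two_words a b u) =
      (\<Sum>w \<in> keys f. if w = u then
        lookup f u * lookup (word_prod v u) (two_words a b u) else 0)"
    unfolding lin_ext_def lookup_sum lookup_assoc_scale by (intro sum.cong refl) auto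
  also have "\<dots> \<noteq> 0"
    using u leading_wordD(2)[OF lead[of u]] by (simp add: in_keys_iff)
  finally show ?thesis by auto
qed

section \<open>Bihomogeneous derivations of T\<close>

definition bihomogeneous :: "nat \<Rightarrow> nat \<Rightarrow> ('k::field, two) free_assoc \<Rightarrow> bool" where
  "bihomogeneous i j f \<longleftrightarrow>
    keys f \<subseteq> {w. count_list w X1 = i \<and> count_list w X2 = j}"

lemma bihomogeneous_mult:
  "bihomogeneous i j f \<Longrightarrow> bihomogeneous i' j' g \<Longrightarrow> bihomogeneous (i + i') (j + j') (f * g)"
  by (auto simp: bihomogeneous_def subset_iff elim!: keys_assoc_mult)

lemma bihomogeneous_add:
  "bihomogeneous i j f \<Longrightarrow> bihomogeneous i j g \<Longrightarrow> bihomogeneous i j (f + g)"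
  using Poly_Mapping.keys_add[of f g] by (auto simp: bihomogeneous_def)

lemma bihomogeneous_scale: "bihomogeneous i j f \<Longrightarrow> bihomogeneous i j (assoc_scale c f)"
  by (auto simp: bihomogeneous_def in_keys_iff lookup_assoc_scale)

lemma bihomogeneous_single:
  "bihomogeneous (count_list w X1) (count_list w X2) (single w c)"
  by (simp add: bihomogeneous_def)

lemma bihomogeneous_der_word:
  assumes "\<And>c. bihomogeneous (p + of_bool (c = X1)) (q + of_bool (c = X2)) (d c)"
  shows "bihomogeneous (p + count_list w X1) (q + count_list w X2) (der_word d w)"
proof (induction w)
  case Nil
  then show ?case by (simp add: bihomogeneous_def)
next
  case (Cons c w)
  have "bihomogeneous (p + of_bool (c = X1) + count_list w X1) (q + of_bool (c = X2) + count_list w X2)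
      (d c * single w 1)"
    by (intro bihomogeneous_mult assms bihomogeneous_single)
  moreover have "bihomogeneous (count_list [c] X1 + (p + count_list w X1))
      (count_list [c] X2 + (q + count_list w X2)) (single [c] 1 * der_word d w)"
    by (intro bihomogeneous_mult bihomogeneous_single Cons)
  ultimately show ?case
    unfolding der_word.simps
    by (intro bihomogeneous_add) (cases c; simp add: add_ac)+
qed

lemma bihomogeneous_assoc_der:
  assumes "\<And>c. bihomogeneous (p + of_bool (c = X1)) (q + of_bool (c = X2)) (d c)"
    and "bihomogeneous i j f"
  shows "bihomogeneous (p + i) (q + j) (assoc_der d f)"
  using assms(2) unfolding bihomogeneous_def[of i j]
proof (induction rule: poly_mapping_keys_induct)
  case (add w c f)
  then show ?case
    using bihomogeneous_der_word[OF assms(1), where w=w]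
    by (auto simp: assoc_der_simps intro!: bihomogeneous_add bihomogeneous_scale)
qed (simp add: assoc_der_simps bihomogeneous_def)

theorem bihomogeneous_nilpotent_zero:
  fixes d :: "two \<Rightarrow> ('k::field_char_0, two) free_assoc"
  assumes d: "\<And>c. bihomogeneous (p + of_bool (c = X1)) (q + of_bool (c = X2)) (d c)"
    and nilp: "\<And>c. (assoc_der d ^^ N c) (single [c] 1) = 0"
  shows "d c = 0"
proof (rule ccontr)
  assume dc: "d c \<noteq> 0"
  let ?D = "assoc_der d" and ?X = "\<lambda>c. single [c] 1 :: ('k, two) free_assoc"
  have "\<exists>m. (?D ^^ m) (?X c) \<noteq> 0 \<and> (?D ^^ Suc m) (?X c) = 0" for c
  proof -
    have "?X c \<noteq> 0" by (metis lookup_single_eq lookup_zero zero_neq_one)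
    from last_funpow_nonzero[OF nilp this] show ?thesis by blast
  qed
  then obtain m where m: "\<And>c. (?D ^^ m c) (?X c) \<noteq> 0" "\<And>c. (?D ^^ Suc (m c)) (?X c) = 0"
    by metis
  define v where "v c = assoc_scale (1 / fact (m c)) ((?D ^^ m c) (?X c))" for c
  have v: "(?D ^^ m c) (?X c) = assoc_scale (fact (m c)) (v c)" for c
    by (simp add: v_def)
  have "bihomogeneous (n * p + of_bool (c = X1)) (n * q + of_bool (c = X2)) ((?D ^^ n) (?X c))"
    for n c
  proof (induction n)
    case 0
    show ?case using bihomogeneous_single[of "[c]" 1] by (cases c) simp_all
  next
    case (Suc n)
    from bihomogeneous_assoc_der[OF d this] show ?case by (simp add: add_ac)
  qed
  then have v_hom: "bihomogeneous (m c * p + of_bool (c = X1)) (m c * q + of_bool (c = X2)) (v c)" for c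
    unfolding v_def by (rule bihomogeneous_scale)
  have len: "length w = count_list w X1 + count_list w X2" for w :: "two list"
    by (induction w) (auto, metis two.exhaust)
  have "\<exists>a. leading_word (v c) a" for c
  proof -
    have "v c \<noteq> 0" using v[of c] m(1)[of c] by auto
    moreover have "length w = m c * p + of_bool (c = X1) + (m c * q + of_bool (c = X2))"
      if "w \<in> keys (v c)" for w
      using v_hom[of c] that len[of w] by (auto simp: bihomogeneous_def)
    ultimately show ?thesis by (metis leading_word_exists)
  qed
  then obtain a where a: "\<And>c. leading_word (v c) (a c)" by metis
  have a_count: "count_list (a c) X1 = m c * p + of_bool (c = X1)"
    "count_list (a c) X2 = m c * q + of_bool (c = X2)" for c
    using leading_wordD(1)[OF a[of c]] v_hom[of c] by (auto simp: bihomogeneous_def)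
  \<comment> \<open>By the bidegrees of the last iterates, the two sides differ by m X1 * p + m X2 *
    q + 1.\<close>
  have "count_list (a X1) X1 * count_list (a X2) X2 \<noteq> count_list (a X1) X2 * count_list (a X2) X1"
    by (simp add: a_count algebra_simps)
  then have nc: "a X1 @ a X2 \<noteq> a X2 @ a X1" using count_list_commute[of "a X1" "a X2" X1 X2] by blast
  have len_tw: "length (two_words (a X1) (a X2) w) =
      count_list w X1 * length (a X1) + count_list w X2 * length (a X2)" for w
    by (induction w rule: two_list_induct) simp_all
  have msum: "sum_list (map m w) = count_list w X1 * m X1 + count_list w X2 * m X2" for w
  proof (induction w)
    case (Cons c w)
    then show ?case by (cases c) simp_all
  qed simp
  let ?i = "p + of_bool (c = X1)" and ?j = "q + of_bool (c = X2)"
  \<comment> \<open>The exponent at which every word of d c reaches its last iterate.\<close>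
  let ?N = "?i * m X1 + ?j * m X2"
  have keys: "count_list w X1 = ?i" "count_list w X2 = ?j" if "w \<in> keys (d c)" for w
    using d[of c] that by (auto simp: bihomogeneous_def)
  have "lin_ext assoc_scale (word_prod v) (d c) \<noteq> 0"
    by (rule lin_ext_word_prod_nonzero[OF a a nc dc]) (simp only: len_tw keys)
  moreover have "(?D ^^ ?N) (d c) = assoc_scale (fact ?N) (lin_ext assoc_scale (word_prod v) (d c))"
    by (rule assoc_der_funpow_lin_ext[OF m(2) v]) (auto simp: msum keys)
  \<comment> \<open>As d c is the image of the letter c, D^(m c) already kills it. Since p and q are
    nonnegative, each word of d c contains c, and thus ?N is at least m c.\<close>
  moreover have "(?D ^^ ?N) (d c) = 0"
  proof (rule funpow_zero_ge)
    show "(?D ^^ m c) (d c) = 0"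
      using m(2)[of c] by (simp add: funpow_swap1 assoc_der_gen)
    show "m c \<le> ?N" by (cases c) simp_all
  qed (simp add: assoc_der_simps)
  ultimately show False by simp
qed

section \<open>Linear parts of polynomials\<close>

text \<open>With zero bracket, k and k[z] become Poisson algebras, which makes
  \<open>eval_poly\<close> available for evaluation at points and along lines.\<close>

interpretation field_poisson: poisson_algebra "(*) :: 'k::field \<Rightarrow> 'k \<Rightarrow> 'k" "\<lambda>_ _. 0"
  by unfold_locales (simp_all add: algebra_simps)

interpretation poly_poisson: poisson_algebra "smult :: 'k::field \<Rightarrow> 'k poly \<Rightarrow> 'k poly" "\<lambda>_ _. 0"
  by unfold_locales (simp_all add: smult_add_right smult_add_left)

abbreviation pois_eval ::
  "(('k::field, 'x) lie_basis_elem \<Rightarrow> 'k) \<Rightarrow> ('k, 'x) free_poisson \<Rightarrow> 'k" where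
  "pois_eval \<equiv> field_poisson.eval_poly"

lemma pois_eval_simps:
  "pois_eval v (p + q) = pois_eval v p + pois_eval v q"
  "pois_eval v (p * q) = pois_eval v p * pois_eval v q"
  "pois_eval v (pois_const c) = c"
  "pois_eval v (pois_var e) = v e"
  "pois_eval v (pois_scale c p) = c * pois_eval v p"
  "pois_eval v 0 = 0"
  by (simp_all add: field_poisson.eval_poly_add field_poisson.eval_poly_mult
      field_poisson.eval_poly_const field_poisson.eval_poly_var field_poisson.eval_poly_scale
      field_poisson.eval_poly_zero)

lemma lookup_pois_pdiff:
  "lookup (pois_pdiff e p) m =
    of_nat (Suc (lookup m e)) * lookup p (m + single e 1)"
proof (induction p rule: poly_mapping_add_induct)
  case zero
  then show ?case by (simp add: pois_pdiff_zero)
next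
  case (add m' c p)
  have "m' - single e 1 = m \<longleftrightarrow> m' = m + single e 1"
    if "lookup m' e \<noteq> 0"
    using that
    by (auto intro!: poly_mapping_eqI simp: lookup_add lookup_minus lookup_single when_def)
  moreover have "lookup m' e = Suc (lookup m e)"
    if "m' = m + single e 1"
    using that by (simp add: lookup_add)
  ultimately have "lookup (pois_pdiff e (single m' c)) m =
    of_nat (Suc (lookup m e)) *
      lookup (single m' c) (m + single e 1)"
    by (cases "lookup m' e = 0")
      (auto simp: pois_pdiff_single lookup_single when_def)
  with add show ?case by (simp add: pois_pdiff_add lookup_add algebra_simps)
qed

lemma pois_pdiff_lookup_nonzero:
  fixes p :: "('k::field_char_0, 'x) free_poisson"
  assumes "m \<in> keys p" "lookup m e \<noteq> 0"
  shows "pois_pdiff e p \<noteq> 0"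
proof -
  have "m - single e 1 + single e 1 = m"
    using assms(2)
    by (intro poly_mapping_eqI) (auto simp: lookup_add lookup_minus lookup_single when_def)
  then have "lookup (pois_pdiff e p) (m - single e 1) \<noteq> 0"
    using assms(1) by (simp add: lookup_pois_pdiff in_keys_iff del: of_nat_Suc)
  then show ?thesis by auto
qed

text \<open>On every line parallel to an axis the polynomial restricts to a function that vanishes
  on an infinite field, so the partial derivatives vanish at all points as well. Iterated
  derivatives at the origin then give all coefficients.\<close>

lemma pois_eval_all_zero:
  fixes p :: "('k::field_char_0, 'x) free_poisson"
  assumes "\<And>v. pois_eval v p = 0"
  shows "p = 0"
proof -
  have pdiff: "pois_eval v (pois_pdiff e p) = 0" if vanish: "\<And>v. pois_eval v p = 0"
    for v e and p :: "('k, 'x) free_poisson"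
  proof -
    \<comment> \<open>Restriction to the line through v in direction e.\<close>
    define E where "E = poly_poisson.eval_poly (\<lambda>e'. if e' = e then [:0, 1:] else [:v e':])"
    have E: "E (p + q) = E p + E q" "E (p * q) = E p * E q" "E (pois_const c) = [:c:]"
      "E (pois_var e') = (if e' = e then [:0, 1:] else [:v e':])" "E 0 = 0" for p q c e'
      by (simp_all add: E_def poly_poisson.eval_poly_add poly_poisson.eval_poly_mult
          poly_poisson.eval_poly_const poly_poisson.eval_poly_var poly_poisson.eval_poly_zero)
    have poly: "poly (E p) t = pois_eval (v(e := t)) p" for p t
      by (induction p rule: pois_induct) (simp_all add: E pois_eval_simps)
    have pderiv: "pderiv (E p) = E (pois_pdiff e p)" for p
    proof (induction p rule: pois_induct)
      case (var e')
      then show ?case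
        using E(3)[of 1] by (simp add: E pois_pdiff_var pderiv_pCons one_pCons)
    qed (simp_all add: E pois_pdiff_const pois_pdiff_add pois_pdiff_mult pderiv_add pderiv_mult
        pderiv_pCons)
    have "E p = 0"
      using vanish poly_all_0_iff_0[of "E p"] by (simp add: poly)
    then have "poly (E (pois_pdiff e p)) (v e) = 0" by (simp flip: pderiv)
    then show ?thesis by (simp add: poly)
  qed
  have "lookup p m = 0" if "\<And>v. pois_eval v p = 0" for p :: "('k, 'x) free_poisson" and m
    using that
  proof (induction m arbitrary: p rule: poly_mapping_add_induct)
    case zero
    have "pois_eval (\<lambda>_. 0) q = lookup q 0" for q :: "('k, 'x) free_poisson"
    proof (induction q rule: poly_mapping_add_induct)
      case (add m c q)
      have "field_poisson.eval_monom (\<lambda>_. 0 :: 'k) m = (if m = 0 then 1 else 0)"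
      proof (cases "m = 0")
        case False
        then obtain e where "lookup m e \<noteq> 0" by (metis poly_mapping_eqI lookup_zero)
        then show ?thesis
          using False by (auto simp: field_poisson.eval_monom_def in_keys_iff intro!: prod_zero)
      qed (simp add: field_poisson.eval_monom_def)
      with add show ?case
        by (simp add: pois_eval_simps field_poisson.eval_poly_single lookup_add lookup_single)
    qed (simp add: pois_eval_simps)
    then show ?case using zero by metis
  next
    case (add e n m)
    from add.prems show ?case
    proof (induction n arbitrary: p)
      case 0
      then show ?case using add.IH by simp
    next
      case (Suc n)
      from Suc.IH[OF pdiff[OF Suc.prems]]
      have "of_nat (Suc (lookup (single e n + m) e)) *
        lookup p (single e n + m + single e 1) = 0"
        by (simp only: lookup_pois_pdiff)
      then have "lookup p (single e n + m + single e 1) = 0"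
        by (simp only: mult_eq_0_iff of_nat_eq_0_iff) simp
      moreover have "single e n + m + single e 1 =
          single e (Suc n) + m"
        by (simp add: ac_simps flip: single_add)
      ultimately show ?case by simp
    qed
  qed
  with assms show ?thesis by (intro poly_mapping_eqI) simp
qed

text \<open>The linear part of a polynomial at the point \<open>v\<close>, viewed in the free associative algebra.\<close>

definition lin_part :: "(('k::field, 'x) lie_basis_elem \<Rightarrow> 'k) \<Rightarrow> ('k, 'x) free_poisson \<Rightarrow>
    ('k, 'x) free_assoc" where
  "lin_part v p = (\<Sum>e \<in> pois_vars p.
    assoc_scale (pois_eval v (pois_pdiff e p)) (lie_embed (Rep_lie_basis_elem e)))"

lemma lin_part_eq:
  assumes "finite V" "pois_vars p \<subseteq> V"
  shows "lin_part v p = (\<Sum>e \<in> V.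
    assoc_scale (pois_eval v (pois_pdiff e p)) (lie_embed (Rep_lie_basis_elem e)))"
  unfolding lin_part_def using assms
  by (intro sum.mono_neutral_left) (auto simp: pois_pdiff_notin_vars pois_eval_simps)

lemma lin_part_add: "lin_part v (p + q) = lin_part v p + lin_part v q"
proof -
  let ?V = "pois_vars p \<union> pois_vars q \<union> pois_vars (p + q)"
  have "finite ?V" by (simp add: finite_pois_vars)
  then show ?thesis
    by (subst (1 2 3) lin_part_eq[of ?V])
      (auto simp: pois_pdiff_add pois_eval_simps assoc.scale_left_distrib sum.distrib)
qed

lemma lin_part_mult:
  "lin_part v (p * q) =
    assoc_scale (pois_eval v p) (lin_part v q) + assoc_scale (pois_eval v q) (lin_part v p)"
proof -
  let ?V = "pois_vars p \<union> pois_vars q \<union> pois_vars (p * q)"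
  have "finite ?V" by (simp add: finite_pois_vars)
  then show ?thesis
    by (subst (1 2 3) lin_part_eq[of ?V])
      (auto simp: pois_pdiff_mult pois_eval_simps assoc.scale_left_distrib sum.distrib
        assoc.scale_sum_right mult.commute)
qed

lemma lin_part_const: "lin_part v (pois_const c) = 0"
  by (simp add: lin_part_def pois_pdiff_const pois_eval_simps)

lemma lin_part_zero: "lin_part v 0 = 0"
  using lin_part_const[of v 0] by simp

lemma lin_part_var: "lin_part v (pois_var e) = lie_embed (Rep_lie_basis_elem e)"
  by (subst lin_part_eq[of "insert e (pois_vars (pois_var e))"])
    (auto simp: finite_pois_vars pois_pdiff_var pois_eval_simps if_distrib if_distribR sum.If_cases
      pois_eval_simps(3)[of _ 1, simplified] cong: if_cong)

lemma lin_part_scale: "lin_part v (pois_scale c p) = assoc_scale c (lin_part v p)"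
  by (simp add: pois_scale_def lin_part_mult lin_part_const pois_eval_simps)

lemma lin_part_minus: "lin_part v (- p) = - lin_part v p"
  using lin_part_add[of v p "- p"] by (simp add: lin_part_zero eq_neg_iff_add_eq_0 add.commute)

lemma lin_part_sum: "lin_part v (sum f A) = (\<Sum>i\<in>A. lin_part v (f i))"
  by (induction A rule: infinite_finite_induct) (simp_all add: lin_part_zero lin_part_add)

lemma lin_part_lie_incl: "lin_part v (lie_incl u) = lie_embed u"
  by (induction u rule: free_lie_linear_induct)
    (simp_all add: lie_incl_basis lin_part_var lie_incl_zero lin_part_zero lie_embed.zero
      lie_incl_add lin_part_add lie_embed.add lie_incl_scale lin_part_scale lie_embed.scale)

lemma pois_vars_add: "pois_vars (p + q) \<subseteq> pois_vars p \<union> pois_vars q"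
  using Poly_Mapping.keys_add[of p q] by (auto simp: pois_vars_def)

lemma pois_vars_mult: "pois_vars (p * q) \<subseteq> pois_vars p \<union> pois_vars q"
proof
  fix e
  assume "e \<in> pois_vars (p * q)"
  then obtain m where "m \<in> keys (p * q)" "e \<in> keys m"
    by (auto simp: pois_vars_def)
  moreover from this obtain a b where "a \<in> keys p" "b \<in> keys q" "m = a + b"
    using keys_mult[of p q] by blast
  ultimately show "e \<in> pois_vars p \<union> pois_vars q"
    using Poly_Mapping.keys_add[of a b] by (auto simp: pois_vars_def)
qed

lemma pois_vars_const: "pois_vars (pois_const c) = {}"
  by (simp add: pois_vars_def pois_const_def)

lemma pois_vars_zero: "pois_vars 0 = {}"
  by (simp add: pois_vars_def)

lemma pois_vars_var: "pois_vars (pois_var e) = {e}"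
  by (simp add: pois_vars_def pois_var_def)

lemma pois_vars_scale: "pois_vars (pois_scale c p) \<subseteq> pois_vars p"
  using pois_vars_mult[of "pois_const c" p] by (simp add: pois_scale_def pois_vars_const)

lemma pois_vars_minus: "pois_vars (- p) = pois_vars p"
  by (simp add: pois_vars_def)

lemma pois_vars_sum: "pois_vars (sum f A) \<subseteq> (\<Union>i\<in>A. pois_vars (f i))"
proof (induction A rule: infinite_finite_induct)
  case (insert x A)
  then show ?case using pois_vars_add[of "f x" "sum f A"] by auto
qed (simp_all add: pois_vars_zero)

lemma pois_vars_pdiff: "pois_vars (pois_pdiff e p) \<subseteq> pois_vars p"
proof
  fix e'
  assume "e' \<in> pois_vars (pois_pdiff e p)"
  then obtain m where m: "lookup (pois_pdiff e p) m \<noteq> 0" "lookup m e' \<noteq> 0"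
    by (auto simp: pois_vars_def in_keys_iff)
  then have "m + single e 1 \<in> keys p"
    by (auto simp: lookup_pois_pdiff in_keys_iff)
  moreover have "e' \<in> keys (m + single e 1)"
    using m(2) by (simp add: in_keys_iff lookup_add)
  ultimately show "e' \<in> pois_vars p" by (auto simp: pois_vars_def)
qed

lemma pois_vars_lie_incl: "pois_vars (lie_incl u) \<subseteq> {e. lie_coord u e \<noteq> 0}"
proof -
  have "pois_vars (pois_scale (lie_coord u e) (pois_var e)) \<subseteq> {e}" for e
    using pois_vars_scale[of "lie_coord u e" "pois_var e"] by (simp add: pois_vars_var)
  then show ?thesis
    unfolding lie_incl_def by (intro order_trans[OF pois_vars_sum]) blast
qed

section \<open>Gradings\<close>

lemma square_eq_double_square: "a\<^sup>2 = 2 * b\<^sup>2 \<Longrightarrow> b = 0" for a b :: nat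
proof (induction b arbitrary: a rule: less_induct)
  case (less b)
  then have "even (a\<^sup>2)" by simp
  then obtain c where c: "a = 2 * c" by (auto elim: evenE)
  with less.prems have b: "b\<^sup>2 = 2 * c\<^sup>2" by (simp add: power2_eq_square)
  then have "even (b\<^sup>2)" by simp
  then obtain d where d: "b = 2 * d" by (auto elim: evenE)
  with b have "c\<^sup>2 = 2 * d\<^sup>2" by (simp add: power2_eq_square)
  with less.IH[of d c] d show ?case by (cases "d = 0") auto
qed

lemma sqrt_2_linear_independent:
  fixes i j i' j' :: nat
  assumes "real i + real j * sqrt 2 = real i' + real j' * sqrt 2"
  shows "i = i' \<and> j = j'"
proof -
  define a b where "a = nat \<bar>int i - int i'\<bar>" and "b = nat \<bar>int j - int j'\<bar>"
  have "real i - real i' = (real j' - real j) * sqrt 2"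
    using assms by (simp add: algebra_simps)
  then have "(real i - real i')\<^sup>2 = 2 * (real j - real j')\<^sup>2"
    by (simp add: power_mult_distrib power2_commute)
  moreover have "real (a\<^sup>2) = (real i - real i')\<^sup>2" "real (b\<^sup>2) = (real j - real j')\<^sup>2"
    by (simp_all add: a_def b_def)
  ultimately have "real (a\<^sup>2) = real (2 * b\<^sup>2)" by simp
  then have "a\<^sup>2 = 2 * b\<^sup>2" by (simp only: of_nat_eq_iff)
  from square_eq_double_square[OF this] have "j = j'" by (simp add: b_def)
  with assms show ?thesis by simp
qed

text \<open>Since \<open>sqrt 2\<close> is irrational, the weight of a word determines its bidegree.\<close>

definition word_wt :: "two list \<Rightarrow> real" where
  "word_wt w = count_list w X1 + count_list w X2 * sqrt 2"

lemma word_wt_append: "word_wt (v @ w) = word_wt v + word_wt w"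
  by (simp add: word_wt_def algebra_simps)

lemma word_wt_single_pos: "word_wt [c] > 0"
  by (cases c) (simp_all add: word_wt_def)

text \<open>The predicate Q covers three uses: \<open>s = r\<close> for homogeneous elements,
  \<open>s \<le> r\<close> for filtration bounds, and \<open>s < r\<close> for terms that are
  negligible at the top. The weights may be reals, integers or pairs.\<close>

definition gr_supp :: "('i \<Rightarrow> 'w) \<Rightarrow> ('w \<Rightarrow> bool) \<Rightarrow> ('i \<Rightarrow>\<^sub>0 'b::zero) \<Rightarrow> bool" where
  "gr_supp wt Q f \<longleftrightarrow> (\<forall>m \<in> keys f. Q (wt m))"

lemma gr_supp_zero: "gr_supp wt Q 0"
  by (simp add: gr_supp_def)

lemma gr_supp_mono: "gr_supp wt Q f \<Longrightarrow> (\<And>r. Q r \<Longrightarrow> Q' r) \<Longrightarrow> gr_supp wt Q' f"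
  by (auto simp: gr_supp_def)

lemma gr_supp_add: "gr_supp wt Q f \<Longrightarrow> gr_supp wt Q g \<Longrightarrow> gr_supp wt Q (f + g)"
  using Poly_Mapping.keys_add[of f g] by (auto simp: gr_supp_def)

lemma gr_supp_minus: "gr_supp wt Q f \<Longrightarrow> gr_supp wt Q (- f :: 'i \<Rightarrow>\<^sub>0 'b::ab_group_add)"
  by (simp add: gr_supp_def)

lemma gr_supp_diff:
  "gr_supp wt Q f \<Longrightarrow> gr_supp wt Q g \<Longrightarrow> gr_supp wt Q (f - g :: 'i \<Rightarrow>\<^sub>0 'b::ab_group_add)"
  using gr_supp_add[of wt Q f "- g"] by (simp add: gr_supp_minus)

lemma gr_supp_sum: "(\<And>i. i \<in> A \<Longrightarrow> gr_supp wt Q (f i)) \<Longrightarrow> gr_supp wt Q (sum f A)"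
  by (induction A rule: infinite_finite_induct) (simp_all add: gr_supp_zero gr_supp_add)

lemma gr_supp_single: "Q (wt m) \<Longrightarrow> gr_supp wt Q (single m c)"
  by (simp add: gr_supp_def)

lemma gr_supp_mult:
  fixes f g :: "'i::monoid_add \<Rightarrow>\<^sub>0 'b::semiring_0" and wt :: "'i \<Rightarrow> 'w::plus"
  assumes "\<And>m n. wt (m + n) = wt m + wt n" "gr_supp wt Q f" "gr_supp wt Q' g"
    "\<And>r r'. Q r \<Longrightarrow> Q' r' \<Longrightarrow> Q'' (r + r')"
  shows "gr_supp wt Q'' (f * g)"
  unfolding gr_supp_def
proof
  fix m
  assume "m \<in> keys (f * g)"
  then obtain a b where "a \<in> keys f" "b \<in> keys g" "m = a + b"
    using keys_mult[of f g] by blast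
  with assms show "Q'' (wt m)" by (simp add: gr_supp_def)
qed

lemma gr_supp_contradiction:
  "gr_supp wt Q f \<Longrightarrow> gr_supp wt Q' f \<Longrightarrow> (\<And>r. Q r \<Longrightarrow> \<not> Q' r) \<Longrightarrow> f = 0"
  unfolding gr_supp_def by (metis keys_eq_empty all_not_in_conv)

lemma gr_supp_eq_unique:
  "gr_supp wt (\<lambda>s. s = r) f \<Longrightarrow> gr_supp wt (\<lambda>s. s = r') f \<Longrightarrow> f \<noteq> 0 \<Longrightarrow> r = r'"
  using gr_supp_contradiction[of wt "\<lambda>s. s = r" f "\<lambda>s. s = r'"] by auto

definition gr_part :: "('i \<Rightarrow> 'w) \<Rightarrow> 'w \<Rightarrow> ('i \<Rightarrow>\<^sub>0 'b::comm_monoid_add) \<Rightarrow> 'i \<Rightarrow>\<^sub>0 'b" where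
  "gr_part wt r f =
    (\<Sum>m \<in> keys f. if wt m = r then single m (lookup f m) else 0)"

lemma lookup_gr_part:
  "lookup (gr_part wt r f) m = (if wt m = r then lookup f m else 0)"
proof -
  have "lookup (gr_part wt r f) m =
    (\<Sum>m' \<in> keys f. if m' = m then if wt m = r then lookup f m else 0 else 0)"
    unfolding gr_part_def lookup_sum by (intro sum.cong) (auto simp: lookup_single when_def)
  then show ?thesis by (simp add: in_keys_iff)
qed

lemma gr_part_add: "gr_part wt r (f + g) = gr_part wt r f + gr_part wt r g"
  by (rule poly_mapping_eqI) (simp add: lookup_gr_part lookup_add)

lemma gr_part_sum: "gr_part wt r (sum f A) = (\<Sum>i\<in>A. gr_part wt r (f i))"
  by (induction A rule: infinite_finite_induct)
    (simp_all add: gr_part_add poly_mapping_eqI lookup_gr_part)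

lemma gr_part_eq: "gr_supp wt (\<lambda>s. s = r') f \<Longrightarrow> gr_part wt r f = (if r = r' then f else 0)"
  by (intro poly_mapping_eqI) (auto simp: lookup_gr_part gr_supp_def in_keys_iff)

lemma gr_supp_gr_part: "gr_supp wt (\<lambda>s. s = r) (gr_part wt r f)"
  by (auto simp: gr_supp_def in_keys_iff lookup_gr_part split: if_splits)

lemma gr_supp_diff_gr_part:
  fixes f :: "'i \<Rightarrow>\<^sub>0 'b::ab_group_add" and r :: "'w::order"
  shows "gr_supp wt (\<lambda>s. s \<le> r) f \<Longrightarrow> gr_supp wt (\<lambda>s. s < r) (f - gr_part wt r f)"
  by (auto simp: gr_supp_def in_keys_iff lookup_minus lookup_gr_part less_le split: if_splits)

abbreviation wt_supp :: "(real \<Rightarrow> bool) \<Rightarrow> ('k::field, two) free_assoc \<Rightarrow> bool" where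
  "wt_supp \<equiv> gr_supp word_wt"

lemma wt_supp_scale: "wt_supp Q f \<Longrightarrow> wt_supp Q (assoc_scale c f)"
  by (auto simp: gr_supp_def in_keys_iff lookup_assoc_scale)

lemma wt_supp_mult:
  fixes f g :: "('k::field, two) free_assoc"
  assumes "wt_supp Q f" "wt_supp Q' g" "\<And>r r'. Q r \<Longrightarrow> Q' r' \<Longrightarrow> Q'' (r + r')"
  shows "wt_supp Q'' (f * g)"
  by (rule gr_supp_mult[of word_wt Q f Q' g Q''])
    (simp_all add: assms plus_list_def word_wt_append)

lemma wt_supp_commutator:
  fixes f g :: "('k::field, two) free_assoc"
  assumes "wt_supp Q f" "wt_supp Q' g" "\<And>r r'. Q r \<Longrightarrow> Q' r' \<Longrightarrow> Q'' (r + r')"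
  shows "wt_supp Q'' (f * g - g * f)"
proof (rule gr_supp_diff)
  show "wt_supp Q'' (f * g)" using assms by (rule wt_supp_mult)
  show "wt_supp Q'' (g * f)"
    using assms(2,1) by (rule wt_supp_mult) (metis assms(3) add.commute)
qed

abbreviation wt_part :: "real \<Rightarrow> ('k::field, two) free_assoc \<Rightarrow> ('k, two) free_assoc" where
  "wt_part \<equiv> gr_part word_wt"

lemma wt_part_scale: "wt_part r (assoc_scale c f) = assoc_scale c (wt_part r f)"
  by (rule poly_mapping_eqI) (simp add: lookup_gr_part lookup_assoc_scale)

lemma wt_supp_assoc_der:
  assumes d: "\<And>c. wt_supp (\<lambda>s. s = word_wt [c] + \<delta>) (d c)"
    and f: "wt_supp Q f" "\<And>r. Q r \<Longrightarrow> Q' (r + \<delta>)"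
  shows "wt_supp Q' (assoc_der d f)"
proof -
  have word: "wt_supp (\<lambda>s. s = word_wt w + \<delta>) (der_word d w)" for w
  proof (induction w)
    case (Cons c w)
    have "wt_supp (\<lambda>s. s = word_wt (c # w) + \<delta>) (d c * single w 1)"
      using wt_supp_mult[OF d gr_supp_single[of "\<lambda>s. s = word_wt w" word_wt w 1]] word_wt_append[of "[c]" w]
      by (force simp: algebra_simps)
    moreover have "wt_supp (\<lambda>s. s = word_wt (c # w) + \<delta>) (single [c] 1 * der_word d w)"
      using wt_supp_mult[OF gr_supp_single[of "\<lambda>s. s = word_wt [c]" word_wt "[c]" 1] Cons] word_wt_append[of "[c]" w]
      by (force simp: algebra_simps)
    ultimately show ?case by (simp add: gr_supp_add)
  qed (simp add: gr_supp_zero)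
  have "keys f \<subseteq> {w. Q (word_wt w)}" using f(1) by (auto simp: gr_supp_def)
  then show ?thesis
  proof (induction rule: poly_mapping_keys_induct)
    case (add w c g)
    then have "wt_supp Q' (der_word d w)" using f(2) by (intro gr_supp_mono[OF word[of w]]) auto
    with add show ?case by (simp add: assoc_der_simps gr_supp_add wt_supp_scale)
  qed (simp add: assoc_der_simps gr_supp_zero)
qed

text \<open>Basis elements are iterated brackets, so all words of the image in T have the same
  weight and any choice will do. That there is a word at all is the injectivity of
  \<open>lie_embed\<close>.\<close>

definition basis_wt :: "('k::field, two) lie_basis_elem \<Rightarrow> real" where
  "basis_wt e = word_wt (SOME w. w \<in> keys (lie_embed (Rep_lie_basis_elem e)))"

lemma lie_monomial_wt:
  assumes "u \<in> lie_monomials"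
  shows "\<exists>r > 0. wt_supp (\<lambda>s. s = r) (lie_embed u)"
  using assms
proof induction
  case (gen c)
  show ?case
    by (intro exI[of _ "word_wt [c]"])
      (simp add: lie_embed_gen gr_supp_single word_wt_single_pos)
next
  case (bracket u v)
  then obtain r s where rs: "r > 0" "s > 0" "wt_supp (\<lambda>t. t = r) (lie_embed u)"
    "wt_supp (\<lambda>t. t = s) (lie_embed v)" by blast
  then have "wt_supp (\<lambda>t. t = r + s) (lie_embed (lie_bracket u v))"
    using wt_supp_commutator[OF rs(3,4), of "\<lambda>t. t = r + s"] by (simp add: lie_embed_bracket)
  with rs show ?case by (intro exI[of _ "r + s"]) simp
qed

lemma bihomogeneous_bracket:
  "bihomogeneous i j (lie_embed u) \<Longrightarrow> bihomogeneous i' j' (lie_embed v) \<Longrightarrow>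
    bihomogeneous (i + i') (j + j') (lie_embed (lie_bracket u v))"
  unfolding bihomogeneous_def lie_embed_bracket
  using keys_diff[of "lie_embed u * lie_embed v" "lie_embed v * lie_embed u"]
  by (fastforce elim!: keys_assoc_mult)

text \<open>The bracket of a generator with itself vanishes, so a nonzero bracket contains both
  letters. This is what will make the bidegree of the top part of D nonnegative.\<close>

lemma lie_monomial_cases:
  assumes "u \<in> lie_monomials" "u \<noteq> 0"
  obtains (gen) c where "u = lie_gen c"
    | (bracket) i j where "i > 0" "j > 0" "bihomogeneous i j (lie_embed u)"
proof -
  have "(\<exists>c. u = lie_gen c) \<or> u = 0 \<or> (\<exists>i j. i > 0 \<and> j > 0 \<and> bihomogeneous i j (lie_embed u))"
    using assms(1)
  proof induction
    case (bracket u v)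
    have gen: "\<exists>i j. bihomogeneous i j (lie_embed (lie_gen c :: ('a, two) free_lie)) \<and>
      (i > 0 \<longleftrightarrow> c = X1) \<and> (j > 0 \<longleftrightarrow> c = X2)" for c
    proof -
      have "bihomogeneous (of_bool (c = X1)) (of_bool (c = X2)) (lie_embed (lie_gen c :: ('a, two) free_lie))"
        by (cases c) (simp_all add: lie_embed_gen bihomogeneous_def)
      then show ?thesis by (intro exI conjI) auto
    qed
    consider "u = 0 \<or> v = 0" | c where "u = lie_gen c" "v = lie_gen c"
      | i j i' j' where "i + i' > 0" "j + j' > 0" "bihomogeneous i j (lie_embed u)"
        "bihomogeneous i' j' (lie_embed v)"
      using bracket.IH gen by (metis (full_types) add_gr_0 two.exhaust)
    then show ?case
    proof cases
      case 3
      then show ?thesis using bihomogeneous_bracket by blast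
    qed (auto simp: lie_bracket_zero free_lie.bracket_self)
  qed blast
  then show ?thesis using assms(2) gen bracket by blast
qed

lemma Rep_lie_basis_elem_nonzero: "Rep_lie_basis_elem e \<noteq> 0"
  using Rep_lie_basis_elem[of e] independent_lie_basis free_lie.dependent_zero by metis

lemma Rep_lie_basis_elem_monomial: "Rep_lie_basis_elem e \<in> lie_monomials"
  using Rep_lie_basis_elem[of e] lie_basis_subset by blast

lemma lie_embed_Rep_keys:
  "\<exists>w. w \<in> keys (lie_embed (Rep_lie_basis_elem (e :: ('k::field_char_0, 'x) lie_basis_elem)))"
proof -
  have "lie_embed (Rep_lie_basis_elem e) \<noteq> 0" by (simp add: Rep_lie_basis_elem_nonzero)
  then show ?thesis by (metis ex_in_conv keys_eq_empty)
qed

lemma basis_wt_supp: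
  "wt_supp (\<lambda>s. s = basis_wt e) (lie_embed (Rep_lie_basis_elem (e :: ('k::field_char_0, two) lie_basis_elem)))"
proof -
  obtain r where r: "wt_supp (\<lambda>s. s = r) (lie_embed (Rep_lie_basis_elem e))"
    using lie_monomial_wt[OF Rep_lie_basis_elem_monomial] by blast
  with someI_ex[OF lie_embed_Rep_keys[of e]] show ?thesis
    by (simp add: gr_supp_def basis_wt_def)
qed

lemma basis_elem_cases:
  fixes e :: "('k::field_char_0, two) lie_basis_elem"
  obtains (gen) c where "Rep_lie_basis_elem e = lie_gen c"
    | (bracket) i j where "i > 0" "j > 0" "basis_wt e = real i + real j * sqrt 2"
proof (cases rule: lie_monomial_cases[OF Rep_lie_basis_elem_monomial[of e] Rep_lie_basis_elem_nonzero])
  case (2 i j)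
  obtain w where "w \<in> keys (lie_embed (Rep_lie_basis_elem e))"
    using lie_embed_Rep_keys[of e] by blast
  with 2(3) basis_wt_supp[of e] have "basis_wt e = real i + real j * sqrt 2"
    by (auto simp: gr_supp_def bihomogeneous_def word_wt_def)
  with 2 bracket show ?thesis by blast
qed (rule gen)

text \<open>Variables are bounded instead of monomials, so that products and partial derivatives
  respect the bound.\<close>

definition pois_wt_le :: "real \<Rightarrow> ('k::field, two) free_poisson \<Rightarrow> bool" where
  "pois_wt_le r p \<longleftrightarrow> (\<forall>e \<in> pois_vars p. basis_wt e \<le> r)"

lemma pois_wt_le_add: "pois_wt_le r p \<Longrightarrow> pois_wt_le r q \<Longrightarrow> pois_wt_le r (p + q)"
  using pois_vars_add[of p q] by (auto simp: pois_wt_le_def)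

lemma pois_wt_le_mult: "pois_wt_le r p \<Longrightarrow> pois_wt_le r q \<Longrightarrow> pois_wt_le r (p * q)"
  using pois_vars_mult[of p q] by (auto simp: pois_wt_le_def)

lemma pois_wt_le_minus: "pois_wt_le r p \<Longrightarrow> pois_wt_le r (- p)"
  by (simp add: pois_wt_le_def pois_vars_minus)

lemma pois_wt_le_pdiff: "pois_wt_le r p \<Longrightarrow> pois_wt_le r (pois_pdiff e p)"
  using pois_vars_pdiff[of e p] by (auto simp: pois_wt_le_def)

lemma pois_wt_le_mono: "pois_wt_le r p \<Longrightarrow> r \<le> s \<Longrightarrow> pois_wt_le s p"
  by (force simp: pois_wt_le_def)

lemma pois_wt_le_sum: "(\<And>i. i \<in> A \<Longrightarrow> pois_wt_le r (f i)) \<Longrightarrow> pois_wt_le r (sum f A)"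
  using pois_vars_sum[of f A] by (auto simp: pois_wt_le_def)

lemma wt_supp_lin_part:
  fixes p :: "('k::field_char_0, two) free_poisson"
  shows "pois_wt_le r p \<Longrightarrow> wt_supp (\<lambda>s. s \<le> r) (lin_part v p)"
  unfolding lin_part_def pois_wt_le_def
  by (intro gr_supp_sum wt_supp_scale gr_supp_mono[OF basis_wt_supp]) auto

lemma lie_coord_zero: "lie_coord 0 e = 0"
  using lie_coord_scale[of 0 0 e] by simp

lemma free_lie_sum_coord:
  "(\<Sum>e | lie_coord u e \<noteq> 0. lie_scale (lie_coord u e) (Rep_lie_basis_elem e)) = u"
proof -
  let ?s = "\<lambda>u e. lie_scale (lie_coord u e) (Rep_lie_basis_elem e)"
  have *: "(\<Sum>e | lie_coord u e \<noteq> 0. ?s u e) = (\<Sum>e\<in>V. ?s u e)"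
    if "finite V" "{e. lie_coord u e \<noteq> 0} \<subseteq> V" for u V
    using that by (intro sum.mono_neutral_left) auto
  show ?thesis
  proof (induction u rule: free_lie_linear_induct)
    case (basis e)
    then show ?case by (simp add: lie_coord_basis if_distrib cong: if_cong)
  next
    case (add u v)
    let ?V = "{e. lie_coord u e \<noteq> 0} \<union> {e. lie_coord v e \<noteq> 0}"
    have V: "finite ?V" by (simp add: finite_lie_coord)
    have "(\<Sum>e | lie_coord (u + v) e \<noteq> 0. ?s (u + v) e) = (\<Sum>e\<in>?V. ?s (u + v) e)"
      using V by (intro *) (auto simp: lie_coord_add)
    also have "\<dots> = (\<Sum>e\<in>?V. ?s u e) + (\<Sum>e\<in>?V. ?s v e)"
      by (simp add: lie_coord_add free_lie.scale_left_distrib sum.distrib)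
    also have "(\<Sum>e\<in>?V. ?s u e) = u"
      using *[OF V, of u] add by auto
    also have "(\<Sum>e\<in>?V. ?s v e) = v"
      using *[OF V, of v] add by auto
    finally show ?case .
  next
    case (scale c u)
    have "(\<Sum>e | lie_coord (lie_scale c u) e \<noteq> 0. ?s (lie_scale c u) e) =
        (\<Sum>e | lie_coord u e \<noteq> 0. ?s (lie_scale c u) e)"
      by (intro *) (auto simp: finite_lie_coord lie_coord_scale)
    also have "\<dots> = lie_scale c (\<Sum>e | lie_coord u e \<noteq> 0. ?s u e)"
      by (simp add: lie_coord_scale free_lie.scale_sum_right)
    finally show ?case using scale by simp
  qed (simp add: lie_coord_zero)
qed

lemma lie_coord_sum:
  assumes "finite A"
  shows "lie_coord (\<Sum>e\<in>A. lie_scale (c e) (Rep_lie_basis_elem e)) e' = (if e' \<in> A then c e' else 0)"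
  using assms by (induction A) (auto simp: lie_coord_zero lie_coord_add lie_coord_scale lie_coord_basis)

text \<open>Basis elements are homogeneous, so a weight part merely selects some of them and stays
  in g.\<close>

lemma wt_part_lie_embed:
  fixes c :: "('k::field_char_0, two) lie_basis_elem \<Rightarrow> 'k"
  assumes "finite A"
  shows "wt_part r (\<Sum>e\<in>A. assoc_scale (c e) (lie_embed (Rep_lie_basis_elem e))) =
    lie_embed (\<Sum>e | e \<in> A \<and> basis_wt e = r. lie_scale (c e) (Rep_lie_basis_elem e))"
proof -
  have "wt_part r (\<Sum>e\<in>A. assoc_scale (c e) (lie_embed (Rep_lie_basis_elem e))) =
    (\<Sum>e\<in>A. if basis_wt e = r then assoc_scale (c e) (lie_embed (Rep_lie_basis_elem e)) else 0)"
    unfolding gr_part_sum wt_part_scale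
    by (intro sum.cong refl) (auto simp: gr_part_eq[OF basis_wt_supp])
  also have "\<dots> = (\<Sum>e | e \<in> A \<and> basis_wt e = r. assoc_scale (c e) (lie_embed (Rep_lie_basis_elem e)))"
    using assms by (simp add: sum.inter_filter)
  finally show ?thesis by (simp add: lie_embed.sum lie_embed.scale)
qed

text \<open>A basis element with nonzero coordinate contributes to the part of its weight. That part
  is nonzero because \<open>lie_embed\<close> is injective, so a word of this weight occurs in the
  image of u.\<close>

lemma pois_wt_le_lie_incl:
  fixes u :: "('k::field_char_0, two) free_lie"
  assumes "wt_supp (\<lambda>s. s \<le> r) (lie_embed u)"
  shows "pois_wt_le r (lie_incl u)"
  unfolding pois_wt_le_def
proof
  fix e
  assume "e \<in> pois_vars (lie_incl u)"
  then have e: "lie_coord u e \<noteq> 0" using pois_vars_lie_incl by blast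
  let ?A = "{e. lie_coord u e \<noteq> 0}" and ?r = "basis_wt e"
  have u: "lie_embed u = (\<Sum>e\<in>?A. assoc_scale (lie_coord u e) (lie_embed (Rep_lie_basis_elem e)))"
    by (subst free_lie_sum_coord[of u, symmetric]) (simp only: lie_embed.sum lie_embed.scale)
  have part: "wt_part ?r (lie_embed u) =
      lie_embed (\<Sum>e' | e' \<in> ?A \<and> basis_wt e' = ?r. lie_scale (lie_coord u e') (Rep_lie_basis_elem e'))"
    unfolding u by (intro wt_part_lie_embed finite_lie_coord)
  have "lie_coord (\<Sum>e' | e' \<in> ?A \<and> basis_wt e' = ?r. lie_scale (lie_coord u e') (Rep_lie_basis_elem e')) e \<noteq> 0"
    using e by (subst lie_coord_sum) (auto simp: finite_lie_coord)
  then have "wt_part ?r (lie_embed u) \<noteq> 0"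
    unfolding part lie_embed_eq_0_iff by (auto simp: lie_coord_zero)
  then obtain w where "lookup (wt_part ?r (lie_embed u)) w \<noteq> 0"
    by (metis poly_mapping_eqI lookup_zero)
  then have "word_wt w = ?r" "w \<in> keys (lie_embed u)"
    by (auto simp: lookup_gr_part in_keys_iff split: if_splits)
  with assms show "?r \<le> r" by (auto simp: gr_supp_def)
qed

section \<open>Locally nilpotent derivations take the generators to polynomials in the generators\<close>

lemma
  assumes "poisson_derivation D"
  shows poisson_derivation_add: "D (p + q) = D p + D q"
    and poisson_derivation_mult: "D (p * q) = D p * q + p * D q"
    and poisson_derivation_bracket:
      "D (pois_bracket p q) = pois_bracket (D p) q + pois_bracket p (D q)"
    and poisson_derivation_scale: "D (pois_scale c p) = pois_scale c (D p)"
    and poisson_derivation_const: "D (pois_const c) = 0"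
proof -
  interpret D: Vector_Spaces.linear pois_scale pois_scale D
    using assms unfolding poisson_derivation_def by (rule conjunct1)
  show "D (p + q) = D p + D q" "D (pois_scale c p) = pois_scale c (D p)"
    by (rule D.add D.scale)+
  show mult: "D (p * q) = D p * q + p * D q"
    "D (pois_bracket p q) = pois_bracket (D p) q + pois_bracket p (D q)" for p q
    using assms unfolding poisson_derivation_def by simp_all
  show "D (pois_const c) = 0"
    using mult(1)[of 1 1] D.scale[of c 1] by (simp add: pois_scale_def)
qed

lemmas poisson_derivation_simps = poisson_derivation_add poisson_derivation_mult
  poisson_derivation_bracket poisson_derivation_scale poisson_derivation_const

lemma poisson_derivation_eq_pois_der:
  assumes "poisson_derivation D"
  shows "D p = pois_der (\<lambda>e. D (pois_var e)) p"
  by (induction p rule: pois_induct)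
    (simp_all add: poisson_derivation_const[OF assms] poisson_derivation_add[OF assms]
      poisson_derivation_mult[OF assms] pois_der_const pois_der_var pois_der_add pois_der_mult)

lemma pois_bracket_lie_incl_left:
  "pois_bracket (lie_incl u) p =
    (\<Sum>e \<in> pois_vars p. pois_pdiff e p * lie_incl (lie_bracket u (Rep_lie_basis_elem e)))"
proof -
  have "pois_der (\<lambda>e. lie_incl (lie_bracket (Rep_lie_basis_elem e) (Rep_lie_basis_elem e'))) (lie_incl u) =
      lie_incl (lie_bracket u (Rep_lie_basis_elem e'))" for e'
  proof -
    have "pois_bracket (lie_incl u) (pois_var e') =
        pois_der (\<lambda>e. lie_incl (lie_bracket (Rep_lie_basis_elem e) (Rep_lie_basis_elem e'))) (lie_incl u)"
      by (simp only: pois_bracket_right pois_der_var)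
    moreover have "pois_bracket (lie_incl u) (pois_var e') = lie_incl (lie_bracket u (Rep_lie_basis_elem e'))"
      by (simp add: pois_bracket_lie_incl flip: lie_incl_basis)
    ultimately show ?thesis by simp
  qed
  then show ?thesis by (simp add: pois_bracket_right[of "lie_incl u" p]) (simp add: pois_der_def)
qed

text \<open>Bracketing with u acts on the variables as ad u, which the linear part turns into a
  commutator in T. The other Leibniz terms carry the linear part of a derivative of p, of weight at
  most s < r + s.\<close>

lemma
  fixes p :: "('k::field_char_0, two) free_poisson"
  assumes u: "wt_supp (\<lambda>t. t = r) (lie_embed u)" "r > 0" and p: "pois_wt_le s p"
  shows pois_wt_le_bracket: "pois_wt_le (r + s) (pois_bracket (lie_incl u) p)"
    and lin_part_bracket: "wt_supp (\<lambda>t. t < r + s) (lin_part v (pois_bracket (lie_incl u) p) -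
      (lie_embed u * lin_part v p - lin_part v p * lie_embed u))"
proof -
  have pdiff: "pois_wt_le s (pois_pdiff e p)" for e
    using p by (rule pois_wt_le_pdiff)
  have bracket: "pois_wt_le (r + s) (lie_incl (lie_bracket u (Rep_lie_basis_elem e)))"
    if "e \<in> pois_vars p" for e
    unfolding lie_embed_bracket
  proof (rule pois_wt_le_lie_incl)
    have "basis_wt e \<le> s" using that p by (simp add: pois_wt_le_def)
    then show "wt_supp (\<lambda>t. t \<le> r + s) (lie_embed (lie_bracket u (Rep_lie_basis_elem e)))"
      using wt_supp_commutator[OF u(1) basis_wt_supp[of e], of "\<lambda>t. t \<le> r + s"]
      by (simp add: lie_embed_bracket)
  qed
  show "pois_wt_le (r + s) (pois_bracket (lie_incl u) p)"
    unfolding pois_bracket_lie_incl_left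
    using u(2) by (intro pois_wt_le_sum pois_wt_le_mult bracket pois_wt_le_mono[OF pdiff]) auto
  let ?c = "\<lambda>e. pois_eval v (pois_pdiff e p)" and ?e = "\<lambda>e. lie_embed (Rep_lie_basis_elem e)"
  let ?R = "\<Sum>e\<in>pois_vars p. assoc_scale (pois_eval v (lie_incl (lie_bracket u (Rep_lie_basis_elem e))))
    (lin_part v (pois_pdiff e p))"
  have "lin_part v (pois_bracket (lie_incl u) p) =
      (\<Sum>e\<in>pois_vars p. assoc_scale (?c e) (lie_embed u * ?e e - ?e e * lie_embed u)) + ?R"
    unfolding pois_bracket_lie_incl_left lin_part_sum lin_part_mult lin_part_lie_incl
      lie_embed_bracket sum.distrib ..
  also have "(\<Sum>e\<in>pois_vars p. assoc_scale (?c e) (lie_embed u * ?e e - ?e e * lie_embed u)) =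
      lie_embed u * lin_part v p - lin_part v p * lie_embed u"
    unfolding lin_part_def
    by (simp add: sum_distrib_left sum_distrib_right assoc_scale_mult_left assoc_scale_mult_right
        assoc.scale_right_diff_distrib sum_subtractf)
  finally have *: "lin_part v (pois_bracket (lie_incl u) p) -
      (lie_embed u * lin_part v p - lin_part v p * lie_embed u) = ?R" by simp
  have "wt_supp (\<lambda>t. t < r + s) ?R"
    using u(2)
    by (intro gr_supp_sum wt_supp_scale gr_supp_mono[OF wt_supp_lin_part[OF pdiff]]) auto
  then show "wt_supp (\<lambda>t. t < r + s) (lin_part v (pois_bracket (lie_incl u) p) -
      (lie_embed u * lin_part v p - lin_part v p * lie_embed u))"
    unfolding * .
qed

text \<open>If \<open>\<delta>\<close> bounds the weight by which \<open>D\<close> raises the variables, then the top weight part of the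
  linear part of \<open>D\<close> at any point is a derivation of the free associative algebra.\<close>

locale wt_derivation =
  fixes D :: "('k::field_char_0, two) free_poisson \<Rightarrow> ('k, two) free_poisson"
    and v :: "('k, two) lie_basis_elem \<Rightarrow> 'k" and \<delta> :: real
  assumes D: "poisson_derivation D" and pos: "\<delta> > 0"
    and gen_wt: "\<And>c. pois_wt_le (word_wt [c] + \<delta>) (D (pois_gen c))"
begin

definition top_der :: "two \<Rightarrow> ('k, two) free_assoc" where
  "top_der c = wt_part (word_wt [c] + \<delta>) (lin_part v (D (pois_gen c)))"

lemma top_der_supp: "wt_supp (\<lambda>t. t = word_wt [c] + \<delta>) (top_der c)"
  unfolding top_der_def by (rule gr_supp_gr_part)

lemma monomial_top:
  assumes "u \<in> lie_monomials"
  shows "\<exists>r > 0. wt_supp (\<lambda>t. t = r) (lie_embed u) \<and> pois_wt_le (r + \<delta>) (D (lie_incl u)) \<and>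
    wt_supp (\<lambda>t. t < r + \<delta>) (lin_part v (D (lie_incl u)) - assoc_der top_der (lie_embed u))"
  using assms
proof induction
  case (gen c)
  have "wt_supp (\<lambda>t. t < word_wt [c] + \<delta>) (lin_part v (D (lie_incl (lie_gen c))) - top_der c)"
    unfolding top_der_def pois_gen_def[symmetric]
    by (intro gr_supp_diff_gr_part wt_supp_lin_part gen_wt)
  then show ?case
    using gen_wt[of c] word_wt_single_pos[of c]
    by (intro exI[of _ "word_wt [c]"])
      (auto simp: lie_embed_gen gr_supp_single assoc_der_gen pois_gen_def)
next
  case (bracket u w)
  then obtain r s where r: "r > 0" "wt_supp (\<lambda>t. t = r) (lie_embed u)"
      "pois_wt_le (r + \<delta>) (D (lie_incl u))"
      "wt_supp (\<lambda>t. t < r + \<delta>) (lin_part v (D (lie_incl u)) - assoc_der top_der (lie_embed u))"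
    and s: "s > 0" "wt_supp (\<lambda>t. t = s) (lie_embed w)"
      "pois_wt_le (s + \<delta>) (D (lie_incl w))"
      "wt_supp (\<lambda>t. t < s + \<delta>) (lin_part v (D (lie_incl w)) - assoc_der top_der (lie_embed w))"
    by blast
  let ?U = "lie_embed u" and ?W = "lie_embed w" and ?d = "assoc_der top_der"
  let ?Lu = "lin_part v (D (lie_incl u))" and ?Lw = "lin_part v (D (lie_incl w))"
  let ?b = "pois_bracket (lie_incl w) (D (lie_incl u))" and ?b' = "pois_bracket (lie_incl u) (D (lie_incl w))"
  \<comment> \<open>Both brackets are written with the element of g on the left, as
    \<open>lin_part_bracket\<close> requires; hence the sign.\<close>
  have Db: "D (lie_incl (lie_bracket u w)) = - ?b + ?b'"
    unfolding pois_bracket_lie_incl[symmetric] poisson_derivation_bracket[OF D]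
    using pois_bracket_anti[of "D (lie_incl u)" "lie_incl w"] by simp
  have LDb: "lin_part v (D (lie_incl (lie_bracket u w))) = - lin_part v ?b + lin_part v ?b'"
    by (simp only: Db lin_part_add lin_part_minus)
  \<comment> \<open>The error splits into the two defects of replacing a bracket by a commutator and
    the commutators with the two errors from the induction hypothesis. Each lies below weight r + s
    + \<delta>.\<close>
  have "lin_part v (D (lie_incl (lie_bracket u w))) - ?d (lie_embed (lie_bracket u w)) =
      - (lin_part v ?b - (?W * ?Lu - ?Lu * ?W)) + (lin_part v ?b' - (?U * ?Lw - ?Lw * ?U)) +
      (((?Lu - ?d ?U) * ?W - ?W * (?Lu - ?d ?U)) + (?U * (?Lw - ?d ?W) - (?Lw - ?d ?W) * ?U))"
    by (simp add: LDb lie_embed_bracket assoc_der_simps assoc_der_mult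
        algebra_simps)
  moreover have "wt_supp (\<lambda>t. t < r + s + \<delta>) \<dots>"
  proof (intro gr_supp_add gr_supp_minus)
    show "wt_supp (\<lambda>t. t < r + s + \<delta>) (lin_part v ?b - (?W * ?Lu - ?Lu * ?W))"
      using lin_part_bracket[OF s(2,1) r(3)] by (simp add: add_ac)
    show "wt_supp (\<lambda>t. t < r + s + \<delta>) (lin_part v ?b' - (?U * ?Lw - ?Lw * ?U))"
      using lin_part_bracket[OF r(2,1) s(3)] by (simp add: add_ac)
    show "wt_supp (\<lambda>t. t < r + s + \<delta>) ((?Lu - ?d ?U) * ?W - ?W * (?Lu - ?d ?U))"
      by (rule wt_supp_commutator[OF r(4) s(2)]) simp
    show "wt_supp (\<lambda>t. t < r + s + \<delta>) (?U * (?Lw - ?d ?W) - (?Lw - ?d ?W) * ?U)"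
      by (rule wt_supp_commutator[OF r(2) s(4)]) simp
  qed
  moreover have "pois_wt_le (r + s + \<delta>) (D (lie_incl (lie_bracket u w)))"
    unfolding Db using pois_wt_le_bracket[OF s(2,1) r(3)] pois_wt_le_bracket[OF r(2,1) s(3)]
    by (intro pois_wt_le_add pois_wt_le_minus) (simp_all add: add_ac)
  moreover have "wt_supp (\<lambda>t. t = r + s) (lie_embed (lie_bracket u w))"
    unfolding lie_embed_bracket by (rule wt_supp_commutator[OF r(2) s(2)]) simp
  ultimately show ?case using r(1) s(1) by (intro exI[of _ "r + s"]) simp
qed

lemma
  shows var_wt: "pois_wt_le (basis_wt e + \<delta>) (D (pois_var e))"
    and var_top: "wt_supp (\<lambda>t. t < basis_wt e + \<delta>)
      (lin_part v (D (pois_var e)) - assoc_der top_der (lie_embed (Rep_lie_basis_elem e)))"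
proof -
  obtain r where r: "wt_supp (\<lambda>t. t = r) (lie_embed (Rep_lie_basis_elem e))"
    "pois_wt_le (r + \<delta>) (D (pois_var e))" "wt_supp (\<lambda>t. t < r + \<delta>)
      (lin_part v (D (pois_var e)) - assoc_der top_der (lie_embed (Rep_lie_basis_elem e)))"
    using monomial_top[OF Rep_lie_basis_elem_monomial[of e]] unfolding lie_incl_basis by blast
  moreover have "r = basis_wt e"
    using r(1) basis_wt_supp[of e] by (rule gr_supp_eq_unique) (simp add: Rep_lie_basis_elem_nonzero)
  ultimately show "pois_wt_le (basis_wt e + \<delta>) (D (pois_var e))"
    "wt_supp (\<lambda>t. t < basis_wt e + \<delta>)
      (lin_part v (D (pois_var e)) - assoc_der top_der (lie_embed (Rep_lie_basis_elem e)))"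
    by simp_all
qed

lemma
  assumes p: "pois_wt_le s p"
  shows derivation_wt: "pois_wt_le (s + \<delta>) (D p)"
    and derivation_top:
      "wt_supp (\<lambda>t. t < s + \<delta>) (lin_part v (D p) - assoc_der top_der (lin_part v p))"
proof -
  have Dp: "D p = (\<Sum>e\<in>pois_vars p. pois_pdiff e p * D (pois_var e))"
    unfolding poisson_derivation_eq_pois_der[OF D, of p] pois_der_def ..
  have wt: "basis_wt e \<le> s" if "e \<in> pois_vars p" for e
    using that p by (simp add: pois_wt_le_def)
  have pdiff: "pois_wt_le s (pois_pdiff e p)" for e
    using p by (rule pois_wt_le_pdiff)
  show "pois_wt_le (s + \<delta>) (D p)"
    unfolding Dp using pos wt
    by (intro pois_wt_le_sum pois_wt_le_mult pois_wt_le_mono[OF pdiff] pois_wt_le_mono[OF var_wt]) auto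
  let ?c = "\<lambda>e. pois_eval v (pois_pdiff e p)" and ?e = "\<lambda>e. lie_embed (Rep_lie_basis_elem e)"
  have sum: "assoc_der top_der (sum f A) = (\<Sum>i\<in>A. assoc_der top_der (f i))"
    for f and A :: "('k, two) lie_basis_elem set"
    by (induction A rule: infinite_finite_induct) (simp_all add: assoc_der_simps)
  \<comment> \<open>The second summand comes from differentiating the coefficients. Its weight is at
    most s, which is below s + \<delta> since \<delta> is positive.\<close>
  have "lin_part v (D p) - assoc_der top_der (lin_part v p) =
      (\<Sum>e\<in>pois_vars p. assoc_scale (?c e) (lin_part v (D (pois_var e)) - assoc_der top_der (?e e)) +
        assoc_scale (pois_eval v (D (pois_var e))) (lin_part v (pois_pdiff e p)))"
    unfolding Dp lin_part_def[of v p] lin_part_sum lin_part_mult sum assoc_der_simps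
    by (simp add: assoc.scale_right_diff_distrib sum.distrib sum_subtractf)
  also have "wt_supp (\<lambda>t. t < s + \<delta>) \<dots>"
    using pos
    by (intro gr_supp_sum gr_supp_add wt_supp_scale gr_supp_mono[OF var_top]
        gr_supp_mono[OF wt_supp_lin_part[OF pdiff]]) (auto dest: wt)
  finally show "wt_supp (\<lambda>t. t < s + \<delta>) (lin_part v (D p) - assoc_der top_der (lin_part v p))" .
qed

text \<open>The n-th iterate on the letter is homogeneous and agrees with the linear part of the
  n-th iterate of D up to lower weight. If the latter is zero, the former is both homogeneous and of
  lower weight, hence zero.\<close>

lemma top_der_nilpotent:
  assumes "(D ^^ n) (pois_gen c) = 0"
  shows "(assoc_der top_der ^^ n) (single [c] 1) = 0"
proof -
  let ?x = "single [c] 1 :: ('k, two) free_assoc"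
  let ?r = "\<lambda>n. word_wt [c] + real n * \<delta>"
  have hom: "wt_supp (\<lambda>t. t = ?r n) ((assoc_der top_der ^^ n) ?x)" for n
  proof (induction n)
    case 0
    show ?case by (simp add: gr_supp_single)
  next
    case (Suc n)
    show ?case
      unfolding funpow.simps comp_apply
      by (rule wt_supp_assoc_der[OF top_der_supp Suc]) (simp add: algebra_simps)
  qed
  have "pois_wt_le (?r n) ((D ^^ n) (pois_gen c)) \<and>
    wt_supp (\<lambda>t. t < ?r n) (lin_part v ((D ^^ n) (pois_gen c)) - (assoc_der top_der ^^ n) ?x)" for n
  proof (induction n)
    case 0
    have "pois_vars (pois_gen c :: ('k, two) free_poisson) \<subseteq> {e. basis_wt e \<le> word_wt [c]}"
      using pois_wt_le_lie_incl[of "word_wt [c]" "lie_gen c :: ('k, two) free_lie"]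
      by (auto simp: lie_embed_gen gr_supp_single pois_gen_def pois_wt_le_def)
    then show ?case
      by (auto simp: pois_gen_def lin_part_lie_incl lie_embed_gen gr_supp_zero pois_wt_le_def)
  next
    case (Suc n)
    let ?q = "(D ^^ n) (pois_gen c)" and ?y = "(assoc_der top_der ^^ n) ?x"
    have r: "?r (Suc n) = ?r n + \<delta>" by (simp add: algebra_simps)
    have "lin_part v (D ?q) - assoc_der top_der ?y =
        (lin_part v (D ?q) - assoc_der top_der (lin_part v ?q)) + assoc_der top_der (lin_part v ?q - ?y)"
      by (simp add: assoc_der_simps)
    also have "wt_supp (\<lambda>t. t < ?r (Suc n)) \<dots>"
      unfolding r using Suc
      by (intro gr_supp_add derivation_top wt_supp_assoc_der[OF top_der_supp, where Q="\<lambda>t. t < ?r n"]) auto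
    finally show ?case using derivation_wt[of "?r n" ?q] Suc unfolding r by simp
  qed
  from conjunct2[OF this[of n]] have "wt_supp (\<lambda>t. t < ?r n) ((assoc_der top_der ^^ n) ?x)"
    unfolding assms using gr_supp_minus by (fastforce simp: lin_part_zero)
  with hom[of n] show ?thesis by (rule gr_supp_contradiction) simp
qed

end

theorem locally_nilpotent_gen_vars:
  fixes D :: "('k::field_char_0, two) free_poisson \<Rightarrow> ('k, two) free_poisson"
  assumes D: "poisson_derivation D" and nilp: "locally_nilpotent D"
    and e: "e \<in> pois_vars (D (pois_gen c))"
  shows "\<exists>x. Rep_lie_basis_elem e = lie_gen x"
proof (rule ccontr)
  assume not_gen: "\<nexists>x. Rep_lie_basis_elem e = lie_gen x"
  \<comment> \<open>The amounts by which D raises the weight of a generator. Their maximum is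
    attained at some e0 in the image of some c0, not necessarily at the given e and c.\<close>
  define S where "S = (\<Union>c. (\<lambda>e. basis_wt e - word_wt [c]) ` pois_vars (D (pois_gen c)))"
  define \<delta> where "\<delta> = Max S"
  have "finite (UNIV :: two set)"
    by (rule finite_subset[of _ "{X1, X2}"]) (use two.exhaust in auto)
  then have S: "finite S" "S \<noteq> {}"
    using e by (auto simp: S_def finite_pois_vars)
  have le: "basis_wt e \<le> word_wt [c] + \<delta>" if "e \<in> pois_vars (D (pois_gen c))" for e c
    using that Max_ge[OF S(1), of "basis_wt e - word_wt [c]"] by (force simp: S_def \<delta>_def)
  have sqrt: "sqrt 2 \<ge> 1" "sqrt 2 < 2" using real_less_lsqrt[of 2 2] by simp_all
  have word: "word_wt [c] \<le> sqrt 2" for c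
    using sqrt by (cases c) (simp_all add: word_wt_def)
  have wt_ge: "basis_wt e \<ge> 1 + sqrt 2" if "\<nexists>x. Rep_lie_basis_elem e = lie_gen x"
    for e :: "('k, two) lie_basis_elem"
  proof (cases e rule: basis_elem_cases)
    case (bracket i j)
    then have "1 \<le> real i" "1 \<le> real j" by simp_all
    then have "1 + 1 * sqrt 2 \<le> real i + real j * sqrt 2" by (intro add_mono mult_right_mono) simp_all
    then show ?thesis using bracket by simp
  qed (use that in blast)
  \<comment> \<open>A basis element that is not a generator weighs at least 1 + sqrt 2, a generator
    at most sqrt 2.\<close>
  have \<delta>: "\<delta> \<ge> 1" using le[OF e] wt_ge[OF not_gen] word[of c] by linarith
  obtain c0 e0 where e0: "e0 \<in> pois_vars (D (pois_gen c0))" "basis_wt e0 = word_wt [c0] + \<delta>"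
    using Max_in[OF S] by (force simp: S_def \<delta>_def)
  obtain m where "m \<in> keys (D (pois_gen c0))" "e0 \<in> keys m"
    using e0(1) by (auto simp: pois_vars_def)
  then have "pois_pdiff e0 (D (pois_gen c0)) \<noteq> 0"
    by (intro pois_pdiff_lookup_nonzero) (simp_all add: in_keys_iff)
  \<comment> \<open>At this point the variable e0 survives in the linear part, which makes the top
    part nonzero.\<close>
  then obtain v where v: "pois_eval v (pois_pdiff e0 (D (pois_gen c0))) \<noteq> 0"
    using pois_eval_all_zero by blast
  interpret wt_derivation D v \<delta>
    using D \<delta> le by unfold_locales (auto simp: pois_wt_le_def)
  have top: "top_der c0 = lie_embed (\<Sum>e | e \<in> pois_vars (D (pois_gen c0)) \<and> basis_wt e = word_wt [c0] + \<delta>.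
      lie_scale (pois_eval v (pois_pdiff e (D (pois_gen c0)))) (Rep_lie_basis_elem e))"
    (is "_ = lie_embed ?s")
    unfolding top_der_def lin_part_def by (rule wt_part_lie_embed[OF finite_pois_vars])
  have "lie_coord ?s e0 \<noteq> 0"
    using e0 v by (subst lie_coord_sum) (simp_all add: finite_pois_vars)
  then have top_nz: "top_der c0 \<noteq> 0"
    unfolding top lie_embed_eq_0_iff by (auto simp: lie_coord_zero)
  \<comment> \<open>The variable e0 is not a generator either: its weight is at least 1 + \<delta>
    \<ge> 2, and generators weigh 1 or sqrt 2.\<close>
  obtain i j where ij: "i > 0" "j > 0" "word_wt [c0] + \<delta> = real i + real j * sqrt 2"
  proof (cases e0 rule: basis_elem_cases)
    case (gen x)
    have "basis_wt e0 = word_wt [x]"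
      using basis_wt_supp[of e0] unfolding gen lie_embed_gen
      by (simp add: gr_supp_def)
    then have "word_wt [c0] + \<delta> = word_wt [x]" using e0(2) by simp
    with word[of x] \<delta> sqrt show ?thesis
      by (cases c0) (simp_all add: word_wt_def)
  next
    case (bracket i j)
    with e0(2) that show ?thesis by simp
  qed
  \<comment> \<open>The bidegree of the top derivation. As i and j are positive, the subtractions
    are exact.\<close>
  define p q where "p = i - of_bool (c0 = X1)" and "q = j - of_bool (c0 = X2)"
  have pq: "real i = real p + of_bool (c0 = X1)" "real j = real q + of_bool (c0 = X2)"
    using ij(1,2) by (cases c0; simp add: p_def q_def of_nat_diff)+
  have "\<delta> = real p + real q * sqrt 2"
    using ij(3) unfolding pq by (cases c0) (simp_all add: word_wt_def algebra_simps)
  then have wt_c: "word_wt [c] + \<delta> =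
      real (p + of_bool (c = X1)) + real (q + of_bool (c = X2)) * sqrt 2" for c
    by (cases c) (simp_all add: word_wt_def algebra_simps)
  have "bihomogeneous (p + of_bool (c = X1)) (q + of_bool (c = X2)) (top_der c)" for c
  proof -
    have "count_list w X1 = p + of_bool (c = X1) \<and> count_list w X2 = q + of_bool (c = X2)"
      if "w \<in> keys (top_der c)" for w
      using that top_der_supp[of c] unfolding wt_c
      by (intro sqrt_2_linear_independent) (simp add: gr_supp_def word_wt_def)
    then show ?thesis by (auto simp: bihomogeneous_def)
  qed
  moreover from nilp have "\<forall>c. \<exists>N. (D ^^ N) (pois_gen c) = 0"
    unfolding locally_nilpotent_def by (intro allI) (erule spec)
  from choice[OF this] obtain N where "\<forall>c. (D ^^ N c) (pois_gen c) = 0" by (rule exE)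
  then have "(assoc_der top_der ^^ N c) (single [c] 1) = 0" for c
    by (intro top_der_nilpotent) simp
  ultimately have "top_der c0 = 0" by (rule bihomogeneous_nilpotent_zero)
  with top_nz show False by contradiction
qed

section \<open>Locally nilpotent derivations of the polynomial algebra\<close>

text \<open>An arbitrary well-order of the variables makes the monomials an ordered monoid, whence the
  free Poisson algebra is an integral domain.\<close>

instantiation lie_basis_elem :: (field, type) linorder
begin

definition less_eq_lie_basis_elem :: "('a, 'b) lie_basis_elem \<Rightarrow> ('a, 'b) lie_basis_elem \<Rightarrow> bool" where
  "less_eq_lie_basis_elem x y \<longleftrightarrow> (x, y) \<in> (SOME r. well_order_on UNIV r)"

definition less_lie_basis_elem :: "('a, 'b) lie_basis_elem \<Rightarrow> ('a, 'b) lie_basis_elem \<Rightarrow> bool" where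
  "less_lie_basis_elem x y \<longleftrightarrow> x \<le> y \<and> \<not> y \<le> x"

instance
proof
  have "well_order_on UNIV (SOME r :: ('a, 'b) lie_basis_elem rel. well_order_on UNIV r)"
    by (rule someI_ex[OF well_order_on])
  then have wo: "refl_on UNIV (SOME r :: ('a, 'b) lie_basis_elem rel. well_order_on UNIV r)"
    "trans (SOME r :: ('a, 'b) lie_basis_elem rel. well_order_on UNIV r)"
    "antisym (SOME r :: ('a, 'b) lie_basis_elem rel. well_order_on UNIV r)"
    "total_on UNIV (SOME r :: ('a, 'b) lie_basis_elem rel. well_order_on UNIV r)"
    unfolding order_on_defs by blast+
  fix x y z :: "('a, 'b) lie_basis_elem"
  show "x < y \<longleftrightarrow> x \<le> y \<and> \<not> y \<le> x" by (rule less_lie_basis_elem_def)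
  show refl: "x \<le> x" using refl_onD[OF wo(1)] by (simp add: less_eq_lie_basis_elem_def)
  show "x \<le> y \<Longrightarrow> y \<le> z \<Longrightarrow> x \<le> z"
    using transD[OF wo(2)] by (simp only: less_eq_lie_basis_elem_def)
  show "x \<le> y \<Longrightarrow> y \<le> x \<Longrightarrow> x = y"
    using antisymD[OF wo(3)] by (simp only: less_eq_lie_basis_elem_def)
  show "x \<le> y \<or> y \<le> x"
    using wo(4) refl by (cases "x = y") (auto simp: total_on_def less_eq_lie_basis_elem_def)
qed

end

text \<open>The elements killed by some power of a derivation form a subalgebra.\<close>

lemma locally_nilpotent_if_vars:
  fixes E :: "('k::field, 'x) free_poisson \<Rightarrow> ('k, 'x) free_poisson"
  assumes add: "\<And>p q. E (p + q) = E p + E q" and mult: "\<And>p q. E (p * q) = E p * q + p * E q"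
    and const: "\<And>c. E (pois_const c) = 0" and var: "\<And>e. \<exists>n. (E ^^ n) (pois_var e) = 0"
  shows "locally_nilpotent E"
  unfolding locally_nilpotent_def
proof
  fix p
  have zero: "E 0 = 0" using const[of 0] by simp
  show "\<exists>n. (E ^^ n) p = 0"
  proof (induction p rule: pois_induct)
    case (const c)
    show ?case by (intro exI[of _ 1]) (simp add: assms(3))
  next
    case (add p q)
    then obtain m n where "(E ^^ m) p = 0" "(E ^^ n) q = 0" by blast
    then have "(E ^^ (m + n)) p = 0" "(E ^^ (m + n)) q = 0"
      using zero by (auto intro: funpow_zero_ge)
    moreover have "(E ^^ k) (p + q) = (E ^^ k) p + (E ^^ k) q" for k
      by (induction k) (simp_all add: assms(1))
    ultimately show ?case by (intro exI[of _ "m + n"]) simp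
  next
    case (mult p q)
    then obtain m n where "(E ^^ m) p = 0" "(E ^^ n) q = 0" by blast
    then have "(E ^^ Suc m) p = 0" "(E ^^ Suc n) q = 0" by (simp_all add: zero)
    from Leibniz_funpow_top(2)[of E, OF assms(1,2) this] show ?case by blast
  qed (rule var)
qed

text \<open>Applying \<open>E\<close> lowers the degree with respect to \<open>E\<close>, multiplication by \<open>h\<close> does not.\<close>

lemma locally_nilpotent_multiple_zero:
  fixes E :: "'a::{idom, ring_char_0} \<Rightarrow> 'a"
  assumes add: "\<And>p q. E (p + q) = E p + E q" and mult: "\<And>p q. E (p * q) = E p * q + p * E q"
    and nilp: "locally_nilpotent E" and p: "E p = p * h"
  shows "E p = 0"
proof (rule ccontr)
  assume "E p \<noteq> 0"
  with p have nz: "p \<noteq> 0" "h \<noteq> 0" by auto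
  have zero: "E 0 = 0" using add[of 0 0] by simp
  obtain M N where "(E ^^ M) p = 0" "(E ^^ N) h = 0"
    using nilp unfolding locally_nilpotent_def by blast
  with nz obtain m n where m: "(E ^^ m) p \<noteq> 0" "(E ^^ Suc m) p = 0"
    and n: "(E ^^ n) h \<noteq> 0" "(E ^^ Suc n) h = 0"
    by (metis last_funpow_nonzero)
  have "(E ^^ (m + n)) (p * h) = 0"
    unfolding p[symmetric] using funpow_zero_ge[OF m(2) zero, of "Suc (m + n)"]
    by (simp add: funpow_swap1)
  moreover have "(E ^^ (m + n)) (p * h) = of_nat ((m + n) choose m) * ((E ^^ m) p * (E ^^ n) h)"
    by (rule Leibniz_funpow_top(1)[OF add mult m(2) n(2)])
  ultimately show False using m(1) n(1) by simp
qed

lemma pois_scale_mult: "pois_scale a p * pois_scale b q = pois_scale (a * b) (p * q)"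
  by (simp add: pois_scale_def mult_ac)

lemma of_nat_pois: "(of_nat n :: ('k::field, 'x) free_poisson) = pois_const (of_nat n)"
  by (induction n) simp_all

text \<open>Compatibility with the Poisson bracket is not asked for: the maps p ->
  \<open>jac p h\<close> are in general derivations for the commutative product only.\<close>

locale lnd =
  fixes E :: "('k::field_char_0, 'x) free_poisson \<Rightarrow> ('k, 'x) free_poisson"
  assumes add: "E (p + q) = E p + E q" and mult: "E (p * q) = E p * q + p * E q"
    and const: "E (pois_const c) = 0" and nilp: "locally_nilpotent E"
begin

lemma zero: "E 0 = 0"
  using const[of 0] by simp

lemma funpow_add: "(E ^^ n) (p + q) = (E ^^ n) p + (E ^^ n) q"
  by (induction n) (simp_all add: add)

text \<open>The algebra homomorphism exp(z E) into polynomials in z. For nonzero p its degree is the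
  last n such that the n-th iterate of E on p is nonzero, and E becomes d/dz
  (\<open>exp_map_der\<close>).\<close>

definition exp_map :: "('k, 'x) free_poisson \<Rightarrow> ('k, 'x) free_poisson poly" where
  "exp_map p = Abs_poly (\<lambda>n. pois_scale (1 / fact n) ((E ^^ n) p))"

lemma coeff_exp_map: "coeff (exp_map p) n = pois_scale (1 / fact n) ((E ^^ n) p)"
proof -
  obtain N where "(E ^^ N) p = 0" using nilp unfolding locally_nilpotent_def by blast
  then have "(E ^^ n) p = 0" if "n > N" for n
    using zero less_imp_le[OF that] by (rule funpow_zero_ge)
  then show ?thesis
    unfolding exp_map_def by (intro coeff_Abs_poly[of N, THEN fun_cong]) simp
qed

lemma exp_map_add: "exp_map (p + q) = exp_map p + exp_map q"
  by (rule poly_eqI) (simp add: coeff_exp_map funpow_add pois.scale_right_distrib)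

lemma exp_map_mult: "exp_map (p * q) = exp_map p * exp_map q"
proof (rule poly_eqI)
  fix n
  have "pois_scale (1 / fact n) (of_nat (n choose i) * ((E ^^ i) p * (E ^^ (n - i)) q)) =
      pois_scale (1 / fact i) ((E ^^ i) p) * pois_scale (1 / fact (n - i)) ((E ^^ (n - i)) q)"
    if "i \<le> n" for i
  proof -
    have "pois_scale (1 / fact n) (of_nat (n choose i) * r) =
        pois_scale (1 / fact i * (1 / fact (n - i))) r" for r :: "('k, 'x) free_poisson"
      using that
      by (simp add: of_nat_pois binomial_fact pois_scale_def flip: mult.assoc pois_const_simps(4))
    then show ?thesis by (simp add: pois_scale_mult)
  qed
  then show "coeff (exp_map (p * q)) n = coeff (exp_map p * exp_map q) n"
    by (simp add: coeff_exp_map coeff_mult Leibniz_funpow[of E, OF add mult] pois.scale_sum_right)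
qed

lemma exp_map_const: "exp_map (pois_const c) = [:pois_const c:]"
proof (rule poly_eqI)
  fix n
  have "(E ^^ Suc k) (pois_const c) = 0" for k
    by (induction k) (simp_all add: const zero)
  then show "coeff (exp_map (pois_const c)) n = coeff [:pois_const c:] n"
    by (cases n) (simp_all add: coeff_exp_map)
qed

lemma exp_map_der: "exp_map (E p) = pderiv (exp_map p)"
proof (rule poly_eqI)
  fix n
  have "of_nat (Suc n) * pois_scale (1 / fact (Suc n)) r = pois_scale (1 / fact n) r"
    for r :: "('k, 'x) free_poisson"
  proof -
    have "of_nat (Suc n) * (1 / fact (Suc n)) = (1 / fact n :: 'k)" by (simp del: of_nat_Suc)
    then show ?thesis
      unfolding of_nat_pois pois_scale_def mult.assoc[symmetric] pois_const_simps(4)[symmetric]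
      by (simp only:)
  qed
  then show "coeff (exp_map (E p)) n = coeff (pderiv (exp_map p)) n"
    by (simp add: coeff_exp_map coeff_pderiv funpow_swap1 del: of_nat_Suc fact_Suc)
qed

lemma exp_map_zero: "exp_map 0 = 0"
  using exp_map_const[of 0] by simp

lemma exp_map_eq_0_iff: "exp_map p = 0 \<longleftrightarrow> p = 0"
  using coeff_exp_map[of p 0] by (auto simp: exp_map_zero)

lemma exp_map_power: "exp_map (p ^ n) = exp_map p ^ n"
  using exp_map_const[of 1] by (induction n) (simp_all add: exp_map_mult one_pCons)

lemma exp_map_sum: "exp_map (sum f A) = (\<Sum>i\<in>A. exp_map (f i))"
  by (induction A rule: infinite_finite_induct) (simp_all add: exp_map_zero exp_map_add)

lemma degree_exp_map_der: "degree (exp_map (E p)) = degree (exp_map p) - 1"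
  by (simp add: exp_map_der degree_pderiv)

lemma degree_exp_map_eq_0_iff: "degree (exp_map p) = 0 \<longleftrightarrow> E p = 0"
  using exp_map_eq_0_iff[of "E p"] by (simp add: exp_map_der pderiv_eq_0_iff)

end

section \<open>Partial derivatives and formal integration in P\<close>

lemma pois_pdiff_commute: "pois_pdiff e (pois_pdiff e' p) = pois_pdiff e' (pois_pdiff e p)"
proof (cases "e = e'")
  case False
  show ?thesis
  proof (rule poly_mapping_eqI)
    fix m
    have "m + single e' 1 + single e 1 =
        m + single e 1 + single e' (1::nat)"
      by (simp only: add.assoc add.commute[of "single e' 1"])
    then show "lookup (pois_pdiff e (pois_pdiff e' p)) m =
        lookup (pois_pdiff e' (pois_pdiff e p)) m"
      using False by (simp add: lookup_pois_pdiff lookup_add lookup_single del: of_nat_Suc)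
  qed
qed simp

lemma pois_pdiff_minus: "pois_pdiff e (- p) = - pois_pdiff e p"
  using pois_pdiff_add[of e p "- p"] by (simp add: pois_pdiff_zero eq_neg_iff_add_eq_0 add.commute)

lemma pois_pdiff_diff: "pois_pdiff e (p - q) = pois_pdiff e p - pois_pdiff e q"
  using pois_pdiff_add[of e p "- q"] by (simp add: pois_pdiff_minus)

lemma pois_pdiff_eq_0_iff:
  fixes p :: "('k::field_char_0, 'x) free_poisson"
  shows "pois_pdiff e p = 0 \<longleftrightarrow> e \<notin> pois_vars p"
  using pois_pdiff_lookup_nonzero[of _ p e]
  by (auto simp: pois_vars_def pois_pdiff_notin_vars in_keys_iff)

lemma pois_var_dvd:
  fixes p :: "('k::field, 'x) free_poisson"
  assumes "\<And>m. m \<in> keys p \<Longrightarrow> lookup m e \<noteq> 0"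
  shows "pois_var e dvd p"
proof -
  have "keys p \<subseteq> {m. lookup m e \<noteq> 0}" using assms by auto
  then show ?thesis
  proof (induction rule: poly_mapping_keys_induct)
    case (add m c p)
    then have "single e 1 + (m - single e 1) = m"
      by (intro poly_mapping_eqI) (auto simp: lookup_add lookup_minus lookup_single when_def)
    then have "single m c = pois_var e * single (m - single e 1) c"
      by (simp add: pois_var_def mult_single)
    with add show ?case by (simp add: dvd_add)
  qed simp
qed

definition pois_int ::
  "('k::field, 'x) lie_basis_elem \<Rightarrow> ('k, 'x) free_poisson \<Rightarrow> ('k, 'x) free_poisson" where
  "pois_int e = lin_ext pois_scale (\<lambda>m. single (m + single e 1)
    (1 / of_nat (Suc (lookup m e))))"

lemma pois_scale_single: "pois_scale c (single m d) = single m (c * d)"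
  by (simp add: pois_scale_def pois_const_def mult_single)

lemma pois_int_simps:
  "pois_int e (p + q) = pois_int e p + pois_int e q"
  "pois_int e 0 = 0"
  "pois_int e (single m c) = single (m + single e 1)
    (c / of_nat (Suc (lookup m e)))"
  by (simp_all add: pois_int_def pois_scale_single lin_ext_add[OF pois.vector_space_axioms]
      lin_ext_zero[OF pois.vector_space_axioms] lin_ext_single[OF pois.vector_space_axioms])

lemma pois_pdiff_int:
  fixes p :: "('k::field_char_0, 'x) free_poisson"
  shows "pois_pdiff e (pois_int e p) = p"
  by (induction p rule: poly_mapping_add_induct)
    (simp_all add: pois_int_simps pois_pdiff_zero pois_pdiff_add pois_pdiff_single lookup_add
      del: of_nat_Suc)

lemma pois_pdiff_int_other:
  assumes "e \<noteq> e'"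
  shows "pois_pdiff e (pois_int e' p) = pois_int e' (pois_pdiff e p)"
proof (induction p rule: poly_mapping_add_induct)
  case (add m c p)
  have "m + single e' 1 - single e 1 =
      m - single e 1 + single e' 1"
    using assms
    by (intro poly_mapping_eqI) (auto simp: lookup_add lookup_minus lookup_single when_def)
  with add assms show ?case
    by (simp add: pois_int_simps pois_pdiff_add pois_pdiff_single lookup_add lookup_minus lookup_single
        del: of_nat_Suc)
qed (simp add: pois_int_simps pois_pdiff_zero)

lemma pois_vars_int: "pois_vars (pois_int e p) \<subseteq> insert e (pois_vars p)"
proof -
  define V where "V = pois_vars p"
  have "keys p \<subseteq> {m. keys m \<subseteq> V}"
    by (auto simp: pois_vars_def V_def)
  then have "pois_vars (pois_int e p) \<subseteq> insert e V"
  proof (induction rule: poly_mapping_keys_induct)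
    case (add m c q)
    have "pois_vars (pois_int e (single m c)) \<subseteq> insert e V"
      using add(1) Poly_Mapping.keys_add[of m "single e (1::nat)"]
      by (auto simp: pois_int_simps pois_vars_def)
    then show ?case
      unfolding pois_int_simps(1) by (rule order_trans[OF pois_vars_add Un_least]) (rule add(2))
  qed (simp add: pois_int_simps pois_vars_zero)
  then show ?thesis by (simp add: V_def)
qed

section \<open>Binary forms\<close>

text \<open>Coefficients of \<open>f\<close> above \<open>r\<close> are ignored, hence the degree bounds in the product rule.\<close>

definition bform :: "('k::field \<Rightarrow> 'r::comm_ring_1) \<Rightarrow> nat \<Rightarrow> 'k poly \<Rightarrow> 'r \<Rightarrow> 'r \<Rightarrow> 'r" where
  "bform \<kappa> r f a b = (\<Sum>i\<le>r. \<kappa> (coeff f i) * a ^ i * b ^ (r - i))"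

locale coeff_hom =
  fixes \<kappa> :: "'k::field \<Rightarrow> 'r::comm_ring_1"
  assumes add: "\<kappa> (c + d) = \<kappa> c + \<kappa> d" and mult: "\<kappa> (c * d) = \<kappa> c * \<kappa> d" and one: "\<kappa> 1 = 1"
begin

lemma zero: "\<kappa> 0 = 0"
  using add[of 0 0] by simp

lemma bform_add: "bform \<kappa> r (f + g) a b = bform \<kappa> r f a b + bform \<kappa> r g a b"
  by (simp add: bform_def add distrib_right sum.distrib)

lemma bform_smult: "bform \<kappa> r (smult c f) a b = \<kappa> c * bform \<kappa> r f a b"
  by (simp add: bform_def mult sum_distrib_left mult.assoc)

lemma bform_zero: "bform \<kappa> r 0 a b = 0"
  by (simp add: bform_def zero)

lemma bform_pCons: "bform \<kappa> (Suc r) (pCons c f) a b = \<kappa> c * b ^ Suc r + a * bform \<kappa> r f a b"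
  unfolding bform_def
  by (subst sum.atMost_Suc_shift) (simp add: sum_distrib_left mult_ac)

lemma bform_raise: "degree f \<le> r \<Longrightarrow> bform \<kappa> (n + r) f a b = b ^ n * bform \<kappa> r f a b"
proof (induction n)
  case (Suc n)
  have "bform \<kappa> (Suc m) f a b = b * bform \<kappa> m f a b" if "degree f \<le> m" for m
    using that
    by (simp add: bform_def coeff_eq_0 zero sum_distrib_left Suc_diff_le mult_ac)
  from this[of "n + r"] Suc show ?case by simp
qed simp

lemma bform_const: "bform \<kappa> r [:c:] a b = \<kappa> c * b ^ r"
  by (cases r) (simp add: bform_def, simp add: bform_pCons bform_zero)

lemma bform_mult:
  assumes "degree f \<le> r" "degree g \<le> s"
  shows "bform \<kappa> (r + s) (f * g) a b = bform \<kappa> r f a b * bform \<kappa> s g a b"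
  using assms(1)
proof (induction f arbitrary: r rule: pCons_induct)
  case 0
  then show ?case by (simp add: bform_zero)
next
  case (pCons c f)
  show ?case
  proof (cases "f = 0")
    case True
    then show ?thesis
      using assms(2) by (simp add: bform_const bform_smult bform_raise)
  next
    case False
    with pCons.prems obtain r' where r: "r = Suc r'" "degree f \<le> r'" by (cases r) auto
    have "bform \<kappa> (r + s) (pCons c f * g) a b =
        bform \<kappa> (r + s) (smult c g) a b + bform \<kappa> (Suc (r' + s)) (pCons 0 (f * g)) a b"
      by (simp add: r bform_add)
    also have "\<dots> = \<kappa> c * (b ^ r * bform \<kappa> s g a b) + a * (bform \<kappa> r' f a b * bform \<kappa> s g a b)"
      using pCons.IH[OF r(2)] bform_raise[OF assms(2), of r] by (simp add: bform_smult bform_pCons zero)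
    finally show ?thesis by (simp add: r(1) bform_pCons algebra_simps)
  qed
qed

lemma bform_power: "degree f \<le> r \<Longrightarrow> bform \<kappa> (n * r) (f ^ n) a b = bform \<kappa> r f a b ^ n"
proof (induction n)
  case 0
  show ?case using bform_const[of 0 1] by (simp add: one one_pCons)
next
  case (Suc n)
  then have "degree (f ^ n) \<le> n * r"
    by (metis degree_power_le mult.commute mult_le_mono1 order_trans)
  from bform_mult[OF Suc.prems this] Suc show ?case by simp
qed

lemma bform_zero_left: "bform \<kappa> r f 0 b = \<kappa> (coeff f 0) * b ^ r"
  by (cases r) (simp add: bform_def, simp add: bform_def sum.atMost_Suc_shift del: sum.atMost_Suc)

lemma bform_zero_right: "bform \<kappa> r f a 0 = \<kappa> (coeff f r) * a ^ r"
proof -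
  have "bform \<kappa> r f a 0 = (\<Sum>i\<le>r. if i = r then \<kappa> (coeff f r) * a ^ r else 0)"
    unfolding bform_def by (intro sum.cong) (auto simp: zero_power)
  then show ?thesis by simp
qed

end

interpretation pois_const: coeff_hom pois_const
  by unfold_locales simp_all

lemma pois_const_eq_0_iff [simp]: "(pois_const c :: ('k::field, 'x) free_poisson) = 0 \<longleftrightarrow> c = 0"
proof
  assume "(pois_const c :: ('k, 'x) free_poisson) = 0"
  then have "lookup (pois_const c :: ('k, 'x) free_poisson) 0 = 0" by simp
  then show "c = 0" by (simp add: pois_const_def)
qed simp

lemma coeff_mult_bounds:
  assumes "degree A \<le> m" "degree B \<le> n"
  shows "coeff (A * B) (m + n) = coeff A m * coeff B n"
proof -
  have "coeff (A * B) (m + n) = (\<Sum>i\<le>m + n. if i = m then coeff A m * coeff B n else 0)"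
    unfolding coeff_mult using assms
    by (intro sum.cong) (auto simp: coeff_eq_0 not_le nat_neq_iff)
  then show ?thesis by simp
qed

lemma coeff_power_bounds:
  assumes "degree A \<le> l"
  shows "degree (A ^ i) \<le> i * l" and "coeff (A ^ i) (i * l) = coeff A l ^ i"
proof -
  have deg: "degree (A ^ i) \<le> i * l" for i
    by (rule order_trans[OF degree_power_le]) (metis assms mult.commute mult_le_mono2)
  show "degree (A ^ i) \<le> i * l" by (rule deg)
  show "coeff (A ^ i) (i * l) = coeff A l ^ i"
    by (induction i) (simp_all add: coeff_mult_bounds[OF assms deg])
qed

text \<open>Every term has degree at most r * l and meets that degree only through the coefficients
  of A and B at l. These may vanish, so A and B need not have equal degrees.\<close>

lemma coeff_bform:
  fixes A B :: "('k::field, 'x) free_poisson poly"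
  assumes A: "degree A \<le> l" and B: "degree B \<le> l"
  shows "degree (bform (\<lambda>c. [:pois_const c:]) r f A B) \<le> r * l"
    and "coeff (bform (\<lambda>c. [:pois_const c:]) r f A B) (r * l) =
      bform pois_const r f (coeff A l) (coeff B l)"
proof -
  have i: "degree ([:pois_const (coeff f i):] * A ^ i * B ^ (r - i)) \<le> r * l \<and>
      coeff ([:pois_const (coeff f i):] * A ^ i * B ^ (r - i)) (r * l) =
      pois_const (coeff f i) * coeff A l ^ i * coeff B l ^ (r - i)" if "i \<le> r" for i
  proof -
    have deg: "degree (smult (pois_const (coeff f i)) (A ^ i)) \<le> i * l"
      using coeff_power_bounds(1)[OF A, of i] degree_smult_le order_trans by blast
    note deg' = coeff_power_bounds(1)[OF B, of "r - i"]
    have r: "r * l = i * l + (r - i) * l" using that by (simp flip: add_mult_distrib)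
    show ?thesis
      unfolding r
      using coeff_mult_bounds[OF deg deg'] degree_mult_le[of "smult (pois_const (coeff f i)) (A ^ i)" "B ^ (r - i)"]
        deg deg' coeff_power_bounds(2)[OF A, of i] coeff_power_bounds(2)[OF B, of "r - i"]
      by simp
  qed
  show "degree (bform (\<lambda>c. [:pois_const c:]) r f A B) \<le> r * l"
    unfolding bform_def using i by (intro degree_sum_le) auto
  show "coeff (bform (\<lambda>c. [:pois_const c:]) r f A B) (r * l) =
      bform pois_const r f (coeff A l) (coeff B l)"
    unfolding bform_def coeff_sum using i by (intro sum.cong) auto
qed

lemma (in lnd) exp_map_bform:
  "exp_map (bform pois_const r f a b) =
    bform (\<lambda>c. [:pois_const c:]) r f (exp_map a) (exp_map b)"
  by (simp add: bform_def exp_map_sum exp_map_mult exp_map_const exp_map_power)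

text \<open>Here \<pi> is the minimal polynomial of a / b over k, in homogeneous form to avoid the
  fraction field. Division with remainder works because powers of b can be cancelled.\<close>

lemma bform_minimal_poly:
  fixes a b :: "('k::field, 'x) free_poisson"
  assumes b: "b \<noteq> 0" and f: "f \<noteq> 0" "bform pois_const (degree f) f a b = 0"
  obtains \<pi> where "degree \<pi> > 0" "bform pois_const (degree \<pi>) \<pi> a b = 0"
    "\<And>p. bform pois_const (degree p) p a b = 0 \<Longrightarrow> \<pi> dvd p"
proof -
  let ?P = "\<lambda>p. p \<noteq> 0 \<and> bform pois_const (degree p) p a b = 0"
  define \<pi> where "\<pi> = arg_min degree ?P"
  have \<pi>: "?P \<pi>" and min: "\<And>p. ?P p \<Longrightarrow> degree \<pi> \<le> degree p"
    unfolding \<pi>_def using arg_min_natI[of ?P f degree] f arg_min_nat_le[of ?P _ degree] by blast+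
  have dvd: "\<pi> dvd p" if p: "bform pois_const (degree p) p a b = 0" for p
  proof (rule ccontr)
    assume nd: "\<not> \<pi> dvd p"
    then have "p \<noteq> 0" by auto
    with p min have le: "degree \<pi> \<le> degree p" by blast
    define q r where "q = p div \<pi>" and "r = p mod \<pi>"
    have r0: "r \<noteq> 0" using nd by (simp add: r_def mod_eq_0_iff_dvd)
    have deg_r: "degree r < degree \<pi>"
      using r0 \<pi> degree_mod_less[of \<pi> p] by (auto simp: r_def)
    have pqr: "p = q * \<pi> + r" by (simp add: q_def r_def)
    have deg_q: "degree q + degree \<pi> \<le> degree p"
    proof (cases "q = 0")
      case False
      have "q * \<pi> = p - r" using pqr by simp
      then have "degree (q * \<pi>) \<le> degree p"
        using deg_r le by (simp add: degree_diff_le)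
      then show ?thesis using False \<pi> by (simp add: degree_mult_eq)
    qed (use le in simp)
    let ?d = "degree p - degree \<pi>"
    have "bform pois_const (?d + degree \<pi>) (q * \<pi>) a b = 0"
      using deg_q \<pi> by (subst pois_const.bform_mult) auto
    moreover have "bform pois_const ((degree p - degree r) + degree r) r a b =
        b ^ (degree p - degree r) * bform pois_const (degree r) r a b"
      by (rule pois_const.bform_raise) simp
    ultimately have "b ^ (degree p - degree r) * bform pois_const (degree r) r a b = 0"
      using p le deg_r pois_const.bform_add[of "degree p" "q * \<pi>" r a b]
      by (simp flip: pqr)
    with b r0 have "?P r" by simp
    with min deg_r show False by (meson not_le)
  qed
  have "degree \<pi> > 0"
  proof (rule ccontr)
    assume "\<not> degree \<pi> > 0"
    then obtain c where "\<pi> = [:c:]" by (metis degree_eq_zeroE gr0I)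
    with \<pi> show False by (simp add: pois_const.bform_const)
  qed
  with \<pi> dvd that show ?thesis by blast
qed

lemma poly_power_decompose:
  fixes f \<pi> :: "'k::field poly"
  assumes "f \<noteq> 0" "degree \<pi> > 0"
  shows "\<exists>j g. f = \<pi> ^ j * g \<and> \<not> \<pi> dvd g"
  using assms(1)
proof (induction "degree f" arbitrary: f rule: less_induct)
  case less
  show ?case
  proof (cases "\<pi> dvd f")
    case True
    then obtain h where h: "f = \<pi> * h" by blast
    with less.prems have "h \<noteq> 0" "\<pi> \<noteq> 0" by auto
    with h assms(2) have "degree h < degree f" by (simp add: degree_mult_eq)
    from less.hyps[OF this \<open>h \<noteq> 0\<close>] obtain j g where "h = \<pi> ^ j * g" "\<not> \<pi> dvd g" by blast
    with h show ?thesis by (intro exI[of _ "Suc j"] exI[of _ g]) (simp add: mult.assoc)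
  qed (auto intro: exI[of _ 0])
qed

lemma pois_pdiff_power:
  "pois_pdiff e (p ^ Suc n) = of_nat (Suc n) * p ^ n * pois_pdiff e p"
  by (induction n) (simp_all add: pois_pdiff_mult algebra_simps)

lemma pois_pdiff_power_zero: "pois_pdiff e p = 0 \<Longrightarrow> pois_pdiff e (p ^ n) = 0"
  using pois_pdiff_const[of e 1] by (induction n) (simp_all add: pois_pdiff_mult)

lemma pois_pdiff_bform:
  assumes b: "pois_pdiff e b = 0"
  shows "pois_pdiff e (bform pois_const (Suc r) f a b) =
    bform pois_const r (pderiv f) a b * pois_pdiff e a"
proof (induction r arbitrary: f)
  case 0
  obtain c g where f: "f = pCons c g" by (cases f)
  show ?case
    unfolding f pois_const.bform_pCons
    by (simp add: bform_def pderiv_pCons pois_pdiff_add pois_pdiff_mult pois_pdiff_const b mult.commute)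
next
  case (Suc r)
  obtain c g where f: "f = pCons c g" by (cases f)
  show ?case
    unfolding f pois_const.bform_pCons[of "Suc r"] pderiv_pCons pois_const.bform_add
      pois_const.bform_pCons[of r 0]
    using pois_pdiff_power_zero[OF b, of "Suc (Suc r)"]
    by (simp add: pois_pdiff_add pois_pdiff_mult pois_pdiff_const Suc algebra_simps del: power_Suc)
qed

text \<open>The degrees of \<open>x\<close> and \<open>y\<close> with respect to \<open>E\<close> are \<open>m\<close> and \<open>n\<close>; that \<open>H\<close> has degree 0
  forces \<open>s * m = t * n\<close>, a single minimal factor \<open>\<pi>\<close> of \<open>f\<close>, and finally
  \<open>degree \<pi> * s * m = m + n - 1\<close>.\<close>

lemma lnd_binary_form:
  fixes E :: "('k::field_char_0, 'x) free_poisson \<Rightarrow> ('k, 'x) free_poisson"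
  assumes "lnd E" and H: "H = bform pois_const g f (pois_var e ^ s) (pois_var e' ^ t)"
    and ee': "e \<noteq> e'" and f: "degree f = g" "g > 0" "coeff f 0 \<noteq> 0" and st: "s > 0" "t > 0"
    and EH: "E H = 0" and Ey: "E (pois_var e') = - pois_pdiff e H"
    and nz: "E (pois_var e) \<noteq> 0" "E (pois_var e') \<noteq> 0"
  shows "(s = 1 \<or> t = 1) \<and> (\<exists>c \<mu>. c \<noteq> 0 \<and> \<mu> \<noteq> 0 \<and>
    H = pois_const c * (pois_var e ^ s - pois_const \<mu> * pois_var e' ^ t) ^ g)"
proof -
  interpret lnd E by fact
  let ?x = "pois_var e" and ?y = "pois_var e'" and ?\<kappa> = "\<lambda>c. [:pois_const c:]"
  define X Y m n where "X = exp_map ?x" and "Y = exp_map ?y" and "m = degree X" and "n = degree Y"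
  have mn: "m > 0" "n > 0"
    using degree_exp_map_eq_0_iff[of ?x] degree_exp_map_eq_0_iff[of ?y] nz
    by (simp_all add: m_def n_def X_def Y_def)
  \<comment> \<open>The larger of the degrees of x^s and y^t. Until the degrees are known to agree,
    one of the coefficients a and b at l may be zero.\<close>
  define l where "l = max (s * m) (t * n)"
  have l: "l > 0" using mn st by (simp add: l_def less_max_iff_disj)
  have XY0: "X \<noteq> 0" "Y \<noteq> 0" using mn by (auto simp: m_def n_def)
  have degX: "degree (X ^ i) = i * m" and degY: "degree (Y ^ i) = i * n" for i
    using XY0 by (simp_all add: degree_power_eq m_def n_def mult.commute)
  have le: "degree (X ^ s) \<le> l" "degree (Y ^ t) \<le> l" by (simp_all add: degX degY l_def)
  define a b where "a = coeff (X ^ s) l" and "b = coeff (Y ^ t) l"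
  have a0: "a \<noteq> 0 \<longleftrightarrow> s * m = l" and b0: "b \<noteq> 0 \<longleftrightarrow> t * n = l"
  proof -
    have "X ^ s \<noteq> 0" "Y ^ t \<noteq> 0" using XY0 by simp_all
    then have *: "coeff (X ^ s) (s * m) \<noteq> 0" "coeff (Y ^ t) (t * n) \<noteq> 0"
      using leading_coeff_neq_0 by (simp_all flip: degX degY)
    show "a \<noteq> 0 \<longleftrightarrow> s * m = l"
      using * le coeff_eq_0[of "X ^ s" l] by (cases "s * m = l") (simp_all add: a_def degX)
    show "b \<noteq> 0 \<longleftrightarrow> t * n = l"
      using * le coeff_eq_0[of "Y ^ t" l] by (cases "t * n = l") (simp_all add: b_def degY)
  qed
  have exp_bform: "degree (exp_map (bform pois_const r p (?x ^ s) (?y ^ t))) \<le> r * l"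
    "coeff (exp_map (bform pois_const r p (?x ^ s) (?y ^ t))) (r * l) = bform pois_const r p a b" for r p
    unfolding exp_map_bform exp_map_power a_def b_def X_def[symmetric] Y_def[symmetric]
    using coeff_bform[OF le] by simp_all
  have deg_bform: "degree (exp_map (bform pois_const r p (?x ^ s) (?y ^ t))) = r * l"
    if "bform pois_const r p a b \<noteq> 0" for r p
    using exp_bform that by (metis le_degree order_antisym)
  have deg_H: "degree (exp_map H) = 0" using EH by (simp add: degree_exp_map_eq_0_iff)
  \<comment> \<open>Otherwise H would have degree g * l > 0 with respect to E.\<close>
  have fab: "bform pois_const g f a b = 0"
    using deg_bform[of g f] deg_H l f(2) unfolding H by fastforce
  \<comment> \<open>If one of a and b were zero, the form would reduce to a pure power of the other
    with nonzero coefficient, as both end coefficients of f are nonzero.\<close>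
  have ab: "a \<noteq> 0" "b \<noteq> 0"
  proof -
    have "coeff f g \<noteq> 0" using f by auto
    moreover have "a \<noteq> 0 \<or> b \<noteq> 0" using a0 b0 by (auto simp: l_def)
    ultimately show "a \<noteq> 0" "b \<noteq> 0"
      using fab f(3) pois_const.bform_zero_left[of g f b] pois_const.bform_zero_right[of g f a]
      by auto
  qed
  then have l_eq: "s * m = l" "t * n = l" using a0 b0 by simp_all
  have "f \<noteq> 0" using f(3) by auto
  obtain \<pi> where \<pi>: "degree \<pi> > 0" "bform pois_const (degree \<pi>) \<pi> a b = 0"
    and dvd: "\<And>p. bform pois_const (degree p) p a b = 0 \<Longrightarrow> \<pi> dvd p"
    using bform_minimal_poly[OF ab(2) \<open>f \<noteq> 0\<close>] fab f(1) by blast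
  obtain j h where jh: "f = \<pi> ^ j * h" "\<not> \<pi> dvd h"
    using poly_power_decompose[OF \<open>f \<noteq> 0\<close> \<pi>(1)] by blast
  have h0: "h \<noteq> 0" and \<pi>0: "\<pi> \<noteq> 0" using \<open>f \<noteq> 0\<close> \<pi>(1) jh(1) by auto
  have g_eq: "g = j * degree \<pi> + degree h"
    using f(1) jh(1) h0 \<pi>0 by (simp add: degree_mult_eq degree_power_eq mult.commute)
  define \<Pi> \<Theta> where "\<Pi> = bform pois_const (degree \<pi>) \<pi> (?x ^ s) (?y ^ t)"
    and "\<Theta> = bform pois_const (degree h) h (?x ^ s) (?y ^ t)"
  have H_eq: "H = \<Pi> ^ j * \<Theta>"
    unfolding H g_eq jh(1) \<Pi>_def \<Theta>_def pois_const.bform_power[OF order_refl, symmetric]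
    using \<pi>0 by (intro pois_const.bform_mult) (simp_all add: degree_power_eq)
  have "H \<noteq> 0" using Ey nz(2) by (auto simp: pois_pdiff_zero)
  then have \<Pi>0: "j > 0 \<Longrightarrow> exp_map \<Pi> \<noteq> 0" and \<Theta>0: "exp_map \<Theta> \<noteq> 0" and "\<Pi> ^ j \<noteq> 0"
    unfolding H_eq by (auto simp: exp_map_eq_0_iff)
  have "degree (exp_map H) = degree (exp_map (\<Pi> ^ j)) + degree (exp_map \<Theta>)"
    unfolding H_eq exp_map_mult using \<Theta>0 \<open>\<Pi> ^ j \<noteq> 0\<close>
    by (intro degree_mult_eq) (simp_all add: exp_map_eq_0_iff)
  with deg_H have deg0: "degree (exp_map (\<Pi> ^ j)) = 0" "degree (exp_map \<Theta>) = 0" by simp_all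
  \<comment> \<open>As \<pi> does not divide h, no cancellation lowers the degree of \<Theta>. But
    as a factor of H it has degree 0, so h is constant.\<close>
  have "degree (exp_map \<Theta>) = degree h * l"
    unfolding \<Theta>_def using dvd jh(2) by (intro deg_bform) blast
  with deg0(2) l have deg_h: "degree h = 0" by simp
  with g_eq f(2) have j: "j > 0" by (intro gr0I) simp
  from deg_h obtain c where c: "h = [:c:]" by (rule degree_eq_zeroE)
  have c0: "c \<noteq> 0" using h0 c by simp
  have \<Theta>: "\<Theta> = pois_const c" by (simp add: \<Theta>_def c pois_const.bform_const)
  have deg_\<Pi>: "degree (exp_map \<Pi>) = 0"
    using deg0(1) j \<Pi>0 by (simp add: exp_map_power degree_power_eq)
  \<comment> \<open>In characteristic zero \<pi> does not divide its derivative, so \<Phi> has the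
    full degree too.\<close>
  have pderiv: "bform pois_const (degree \<pi> - 1) (pderiv \<pi>) a b \<noteq> 0"
  proof
    assume "bform pois_const (degree \<pi> - 1) (pderiv \<pi>) a b = 0"
    then have "\<pi> dvd pderiv \<pi>" by (intro dvd) (simp add: degree_pderiv)
    moreover have "pderiv \<pi> \<noteq> 0" using \<pi>(1) by (simp add: pderiv_eq_0_iff)
    ultimately have "degree \<pi> \<le> degree (pderiv \<pi>)" by (rule dvd_imp_degree_le)
    with \<pi>(1) show False by (simp add: degree_pderiv)
  qed
  have dy: "pois_pdiff e (?y ^ t) = 0"
    using ee' by (intro pois_pdiff_power_zero) (simp add: pois_pdiff_var)
  obtain j' s' where j': "j = Suc j'" and s': "s = Suc s'" using j st(1) by (metis gr0_implies_Suc)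
  define \<Phi> where "\<Phi> = bform pois_const (degree \<pi> - 1) (pderiv \<pi>) (?x ^ s) (?y ^ t)"
  have "pois_pdiff e \<Pi> = \<Phi> * (of_nat s * ?x ^ s')"
    unfolding \<Pi>_def \<Phi>_def using pois_pdiff_bform[OF dy, of "degree \<pi> - 1" \<pi> "?x ^ s"] \<pi>(1)
    by (simp add: s' pois_pdiff_power pois_pdiff_var del: of_nat_Suc power_Suc)
  moreover have "pois_pdiff e H = of_nat j * \<Pi> ^ j' * pois_pdiff e \<Pi> * pois_const c"
    unfolding H_eq \<Theta> j'
    by (simp only: pois_pdiff_mult pois_pdiff_const pois_pdiff_power mult_zero_right add_0_right)
  ultimately have "pois_pdiff e H =
      pois_const (c * of_nat j * of_nat s) * (\<Pi> ^ j' * (\<Phi> * ?x ^ s'))"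
    by (simp only: of_nat_pois pois_const_simps(4) mult_ac)
  then have "exp_map (pois_pdiff e H) =
      [:pois_const (c * of_nat j * of_nat s):] * (exp_map \<Pi> ^ j' * (exp_map \<Phi> * X ^ s'))"
    by (simp only: exp_map_mult exp_map_power exp_map_const X_def)
  moreover have "c * of_nat j * of_nat s \<noteq> 0" using c0 j st(1) by simp
  moreover have \<Phi>: "degree (exp_map \<Phi>) = (degree \<pi> - 1) * l"
    unfolding \<Phi>_def by (rule deg_bform[OF pderiv])
  moreover have "exp_map \<Phi> \<noteq> 0"
    using exp_bform(2)[of "degree \<pi> - 1" "pderiv \<pi>"] pderiv by (auto simp: \<Phi>_def)
  ultimately have "degree (exp_map (pois_pdiff e H)) = (degree \<pi> - 1) * l + s' * m"
    using XY0 \<Pi>0[OF j] deg_\<Pi> by (simp add: degree_mult_eq degree_power_eq degX)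
  moreover have "exp_map (E ?y) = - exp_map (pois_pdiff e H)"
    using exp_map_add[of "E ?y" "pois_pdiff e H"] by (simp add: Ey exp_map_zero eq_neg_iff_add_eq_0)
  \<comment> \<open>Degrees are compared in E y = - dH/dx; applying E lowers the degree n of y by
    one.\<close>
  ultimately have "n - 1 = (degree \<pi> - 1) * l + s' * m"
    using degree_exp_map_der[of ?y] by (simp add: n_def Y_def)
  moreover have "s' * m + m = l" using l_eq(1) by (simp add: s')
  moreover obtain d where d: "degree \<pi> = Suc d" using \<pi>(1) gr0_implies_Suc by blast
  ultimately have dl: "d * l + l + 1 = m + n" using mn by simp
  have lm: "m \<le> l" "n \<le> l" using st by (simp_all flip: l_eq(1)) (simp add: l_eq(1) flip: l_eq(2))
  \<comment> \<open>For positive d, the left side of \<open>dl\<close> is at least 2 * l + 1, the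
    right side at most 2 * l.\<close>
  have "d = 0"
  proof (rule ccontr)
    assume "d \<noteq> 0"
    then have "l \<le> d * l" by simp
    with dl lm show False by linarith
  qed
  with dl have l1: "l + 1 = m + n" by simp
  \<comment> \<open>Exponents s, t \<ge> 2 would give 2 * (m + n) \<le> 2 * l = 2 * (m + n) -
    2.\<close>
  have st1: "s = 1 \<or> t = 1"
  proof (rule ccontr)
    assume "\<not> (s = 1 \<or> t = 1)"
    with st have "2 * m \<le> s * m" "2 * n \<le> t * n" by simp_all
    with l1 l_eq show False by linarith
  qed
  obtain p0 p1 where p: "\<pi> = [:p0, p1:]"
  proof (cases \<pi>)
    case (pCons p0 q)
    with d \<open>d = 0\<close> have "degree q = 0" by (auto split: if_splits)
    then obtain p1 where "q = [:p1:]" by (rule degree_eq_zeroE)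
    with pCons that show ?thesis by blast
  qed
  have p1: "p1 \<noteq> 0" using d p by auto
  have gj: "g = j" using g_eq d \<open>d = 0\<close> deg_h by simp
  have "poly f 0 = p0 ^ j * c" using jh(1) p c by (simp add: poly_power)
  with f(3) have p0: "p0 \<noteq> 0" using j by (auto simp: poly_0_coeff_0 zero_power)
  have "\<Pi> = pois_const p0 * ?y ^ t + ?x ^ s * pois_const p1"
    unfolding \<Pi>_def d \<open>d = 0\<close> by (simp add: p pois_const.bform_pCons pois_const.bform_const)
  also have "pois_const p0 = (pois_const p1 * pois_const (p0 / p1) :: ('k, 'x) free_poisson)"
    using p1 by (simp flip: pois_const_simps(4))
  also have "pois_const (p0 / p1) = - (pois_const (- p0 / p1) :: ('k, 'x) free_poisson)"
    using pois_const_simps(3)[of "p0 / p1" "- p0 / p1"] by (simp add: eq_neg_iff_add_eq_0)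
  finally have "\<Pi> = pois_const p1 * (?x ^ s - pois_const (- p0 / p1) * ?y ^ t)"
    by (simp add: algebra_simps)
  moreover have "pois_const (q ^ i) = (pois_const q ^ i :: ('k, 'x) free_poisson)" for q i
    by (induction i) simp_all
  ultimately have "H = pois_const (c * p1 ^ g) * (?x ^ s - pois_const (- p0 / p1) * ?y ^ t) ^ g"
    unfolding H_eq \<Theta> gj by (simp add: power_mult_distrib mult_ac)
  moreover have "c * p1 ^ g \<noteq> 0" "- p0 / p1 \<noteq> 0" using c0 p0 p1 by simp_all
  ultimately show ?thesis using st1 by blast
qed

section \<open>Hamiltonian derivations of the plane\<close>

text \<open>The one-letter word must occur in some basis element, and the only nonzero iterated
  bracket in which it occurs is the generator itself. This relies on a basis chosen among the
  monomials.\<close>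

lemma lie_gen_in_basis: "(lie_gen c :: ('k::field_char_0, two) free_lie) \<in> lie_basis"
proof -
  let ?u = "lie_gen c :: ('k, two) free_lie"
  have "lie_embed ?u = (\<Sum>e | lie_coord ?u e \<noteq> 0.
      assoc_scale (lie_coord ?u e) (lie_embed (Rep_lie_basis_elem e)))"
    by (subst free_lie_sum_coord[of ?u, symmetric]) (simp only: lie_embed.sum lie_embed.scale)
  then have "(\<Sum>e | lie_coord ?u e \<noteq> 0. lie_coord ?u e *
      lookup (lie_embed (Rep_lie_basis_elem e)) [c]) = 1"
    unfolding lie_embed_gen by (metis (no_types, lifting) lookup_single_eq lookup_sum lookup_assoc_scale sum.cong)
  then obtain e where e: "lookup (lie_embed (Rep_lie_basis_elem e :: ('k, two) free_lie)) [c] \<noteq> 0"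
    by (metis (no_types, lifting) mult_zero_right sum.neutral zero_neq_one)
  show ?thesis
  proof (cases rule: lie_monomial_cases[OF Rep_lie_basis_elem_monomial[of e] Rep_lie_basis_elem_nonzero])
    case (1 x)
    with e have "x = c" by (auto simp: lie_embed_gen lookup_single when_def split: if_splits)
    with 1 show ?thesis using Rep_lie_basis_elem[of e] by simp
  next
    case (2 i j)
    with e show ?thesis by (cases c) (auto simp: bihomogeneous_def in_keys_iff subset_iff)
  qed
qed

definition gen_elem :: "two \<Rightarrow> ('k::field_char_0, two) lie_basis_elem" where
  "gen_elem c = Abs_lie_basis_elem (lie_gen c)"

lemma Rep_gen_elem: "Rep_lie_basis_elem (gen_elem c) = lie_gen c"
  by (simp add: gen_elem_def Abs_lie_basis_elem_inverse lie_gen_in_basis)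

lemma pois_gen_eq: "pois_gen c = pois_var (gen_elem c)"
  by (simp add: pois_gen_def Rep_gen_elem flip: lie_incl_basis)

lemma gen_elem_distinct: "gen_elem X1 \<noteq> (gen_elem X2 :: ('k::field_char_0, two) lie_basis_elem)"
proof
  assume "gen_elem X1 = (gen_elem X2 :: ('k, two) lie_basis_elem)"
  then have "lie_embed (lie_gen X1 :: ('k, two) free_lie) = lie_embed (lie_gen X2)"
    by (metis Rep_gen_elem)
  then show False unfolding lie_embed_gen by (metis list.inject lookup_single_eq lookup_single_not_eq two.distinct(1) zero_neq_one)
qed

lemmas gen_elem_neq [simp] = gen_elem_distinct gen_elem_distinct[symmetric]

abbreviation ex :: "('k::field_char_0, two) lie_basis_elem" where "ex \<equiv> gen_elem X1"
abbreviation ey :: "('k::field_char_0, two) lie_basis_elem" where "ey \<equiv> gen_elem X2"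

definition plane :: "('k::field_char_0, two) free_poisson \<Rightarrow> bool" where
  "plane p \<longleftrightarrow> pois_vars p \<subseteq> {ex, ey}"

lemma plane_add: "plane p \<Longrightarrow> plane q \<Longrightarrow> plane (p + q)"
  using pois_vars_add[of p q] by (auto simp: plane_def)

lemma plane_mult: "plane p \<Longrightarrow> plane q \<Longrightarrow> plane (p * q)"
  using pois_vars_mult[of p q] by (auto simp: plane_def)

lemma plane_minus: "plane p \<Longrightarrow> plane (- p)"
  by (simp add: plane_def pois_vars_minus)

lemma plane_diff: "plane p \<Longrightarrow> plane q \<Longrightarrow> plane (p - q)"
  using plane_add[of p "- q"] by (simp add: plane_minus)

lemma plane_const: "plane (pois_const c)"
  by (simp add: plane_def pois_vars_const)

lemma plane_gen: "plane (pois_gen c)"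
  by (cases c) (simp_all add: plane_def pois_gen_eq pois_vars_var)

lemma plane_power:
  assumes "plane p"
  shows "plane (p ^ n)"
proof (induction n)
  case 0
  show ?case using plane_const[of 1] by simp
qed (simp add: plane_mult assms)

lemma plane_pdiff: "plane p \<Longrightarrow> plane (pois_pdiff e p)"
  using pois_vars_pdiff[of e p] by (auto simp: plane_def)

lemma plane_keys: "plane p \<Longrightarrow> m \<in> keys p \<Longrightarrow> keys m \<subseteq> {ex, ey}"
  by (auto simp: plane_def pois_vars_def)

lemma pois_var_power: "pois_var e ^ n = single (single e n) 1"
  by (induction n) (simp_all add: pois_var_def mult_single flip: single_add)

lemma plane_monomial:
  assumes "keys m \<subseteq> {ex, ey :: ('k::field_char_0, two) lie_basis_elem}"
  shows "m = single ex (lookup m ex) +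
    single ey (lookup m ey)"
proof (rule poly_mapping_eqI)
  fix e
  show "lookup m e = lookup (single ex (lookup m ex) +
      single ey (lookup m ey)) e"
    using assms
    by (cases "e \<in> keys m") (auto simp: lookup_add lookup_single when_def in_keys_iff)
qed

lemma plane_single:
  assumes "keys m \<subseteq> {ex, ey :: ('k::field_char_0, two) lie_basis_elem}"
  shows "single m c = pois_const c * pois_gen X1 ^ lookup m ex *
    pois_gen X2 ^ lookup m ey"
  by (subst plane_monomial[OF assms])
    (simp add: pois_gen_eq pois_var_power pois_const_def mult_single)

lemma plane_monomial_induct [consumes 2, case_names zero add]:
  assumes "plane p" and "gr_supp wt Q p" and "P 0"
    and "\<And>m c p. keys m \<subseteq> {ex, ey} \<Longrightarrow> Q (wt m) \<Longrightarrow> P p \<Longrightarrow>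
      P (pois_const c * pois_gen X1 ^ lookup m ex * pois_gen X2 ^ lookup m ey + p)"
  shows "P p"
proof -
  have "keys p \<subseteq> {m. keys m \<subseteq> {ex, ey} \<and> Q (wt m)}"
    using assms(1,2) plane_keys[OF assms(1)] by (auto simp: gr_supp_def)
  then show ?thesis
  proof (induction rule: poly_mapping_keys_induct)
    case (add m c p)
    then show ?case using assms(4)[of m p c] by (simp add: plane_single)
  qed (rule assms(3))
qed

lemma plane_induct [consumes 1, case_names const gen add mult]:
  assumes "plane p" and const: "\<And>c. P (pois_const c)" and gen: "\<And>x. P (pois_gen x)"
    and add: "\<And>p q. plane p \<Longrightarrow> plane q \<Longrightarrow> P p \<Longrightarrow> P q \<Longrightarrow> P (p + q)"
    and mult: "\<And>p q. plane p \<Longrightarrow> plane q \<Longrightarrow> P p \<Longrightarrow> P q \<Longrightarrow> P (p * q)"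
  shows "P p"
proof -
  have pow: "P (pois_gen c ^ n)" for c n
    using const[of 1] by (induction n) (simp_all add: mult gen plane_gen plane_power)
  have "gr_supp id (\<lambda>_. True) p" by (simp add: gr_supp_def)
  with assms(1) have "P p \<and> plane p"
  proof (induction rule: plane_monomial_induct)
    case zero
    show ?case using const[of 0] plane_const[of 0] by simp
  next
    case (add m c p)
    then show ?case
      by (intro conjI assms(4) plane_add plane_mult mult pow const plane_const plane_power plane_gen) auto
  qed
  then show ?thesis by blast
qed

text \<open>The Jacobian determinant. For fixed h it is the Hamiltonian derivation x -> dh/dy, y ->
  - dh/dx, extended to P by zero on the other variables.\<close>

definition jac ::
  "('k::field_char_0, two) free_poisson \<Rightarrow> ('k, two) free_poisson \<Rightarrow> ('k, two) free_poisson" where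
  "jac p h = pois_pdiff ex p * pois_pdiff ey h - pois_pdiff ey p * pois_pdiff ex h"

lemma jac_simps:
  "jac (p + q) h = jac p h + jac q h"
  "jac (p - q) h = jac p h - jac q h"
  "jac p (h - h') = jac p h - jac p h'"
  "jac (p * q) h = jac p h * q + p * jac q h"
  "jac (pois_const c) h = 0"
  "jac h h = 0"
  by (simp_all add: jac_def pois_pdiff_add pois_pdiff_diff pois_pdiff_mult pois_pdiff_const
      algebra_simps)

lemma jac_gen: "jac (pois_gen X1) h = pois_pdiff ey h" "jac (pois_gen X2) h = - pois_pdiff ex h"
  by (auto simp: jac_def pois_gen_eq pois_pdiff_var)

lemma jac_zero: "jac 0 h = 0"
  by (simp add: jac_def pois_pdiff_zero)

lemma plane_jac: "plane p \<Longrightarrow> plane h \<Longrightarrow> plane (jac p h)"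
  by (simp add: jac_def plane_diff plane_mult plane_pdiff)

lemma lnd_jac:
  assumes "\<And>c. \<exists>n. ((\<lambda>p. jac p h) ^^ n) (pois_gen c) = 0"
  shows "lnd (\<lambda>p. jac p h)"
proof
  show "locally_nilpotent (\<lambda>p. jac p h)"
  proof (rule locally_nilpotent_if_vars)
    fix e :: "('a, two) lie_basis_elem"
    show "\<exists>n. ((\<lambda>p. jac p h) ^^ n) (pois_var e) = 0"
    proof (cases "e = ex \<or> e = ey")
      case True
      then show ?thesis using assms[of X1] assms[of X2] by (auto simp: pois_gen_eq)
    next
      case False
      then have "jac (pois_var e) h = 0" by (auto simp: jac_def pois_pdiff_var)
      then show ?thesis by (intro exI[of _ 1]) simp
    qed
  qed (simp_all add: jac_simps)
qed (simp_all add: jac_simps)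

section \<open>Weighted degrees on k[x, y]\<close>

definition mono_wt :: "int \<Rightarrow> int \<Rightarrow> (('k::field_char_0, two) lie_basis_elem \<Rightarrow>\<^sub>0 nat) \<Rightarrow> int" where
  "mono_wt a b m = a * int (lookup m ex) + b * int (lookup m ey)"

lemma mono_wt_add: "mono_wt a b (m + n) = mono_wt a b m + mono_wt a b n"
  by (simp add: mono_wt_def lookup_add algebra_simps)

lemma gr_supp_pdiff:
  fixes p :: "('k::field_char_0, two) free_poisson"
  assumes "gr_supp (mono_wt a b) Q p"
  shows "gr_supp (mono_wt a b) (\<lambda>r. Q (r + a)) (pois_pdiff ex p)"
    and "gr_supp (mono_wt a b) (\<lambda>r. Q (r + b)) (pois_pdiff ey p)"
proof -
  have *: "gr_supp (mono_wt a b) (\<lambda>r. Q (r + mono_wt a b (single e 1))) (pois_pdiff e p)" for e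
    using assms by (auto simp: gr_supp_def in_keys_iff lookup_pois_pdiff simp flip: mono_wt_add)
  have "mono_wt a b (single (ex :: ('k, two) lie_basis_elem) 1) = a"
    "mono_wt a b (single (ey :: ('k, two) lie_basis_elem) 1) = b"
    by (auto simp: mono_wt_def lookup_single when_def)
  with *[of ex] *[of ey] show "gr_supp (mono_wt a b) (\<lambda>r. Q (r + a)) (pois_pdiff ex p)"
    "gr_supp (mono_wt a b) (\<lambda>r. Q (r + b)) (pois_pdiff ey p)"
    by simp_all
qed

lemma gr_supp_jac:
  assumes p: "gr_supp (mono_wt a b) Q p" and h: "gr_supp (mono_wt a b) Q' h"
    and Q: "\<And>r r'. Q r \<Longrightarrow> Q' r' \<Longrightarrow> Q'' (r + r' - a - b)"
  shows "gr_supp (mono_wt a b) Q'' (jac p h)"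
  unfolding jac_def
proof (rule gr_supp_diff)
  show "gr_supp (mono_wt a b) Q'' (pois_pdiff ex p * pois_pdiff ey h)"
    by (rule gr_supp_mult[OF mono_wt_add gr_supp_pdiff(1)[OF p] gr_supp_pdiff(2)[OF h]])
      (use Q in \<open>fastforce simp: algebra_simps\<close>)
  show "gr_supp (mono_wt a b) Q'' (pois_pdiff ey p * pois_pdiff ex h)"
    by (rule gr_supp_mult[OF mono_wt_add gr_supp_pdiff(2)[OF p] gr_supp_pdiff(1)[OF h]])
      (use Q in \<open>fastforce simp: algebra_simps\<close>)
qed

text \<open>The argument of \<open>top_der_nilpotent\<close> for weighted degrees: iterates of the
  top part are homogeneous and agree with those of the whole derivation up to lower weight.\<close>

lemma lnd_jac_top:
  fixes h :: "('k::field_char_0, two) free_poisson"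
  assumes h: "gr_supp (mono_wt a b) (\<lambda>r. r \<le> \<omega>) h" and "lnd (\<lambda>p. jac p h)"
  shows "lnd (\<lambda>p. jac p (gr_part (mono_wt a b) \<omega> h))"
proof (rule lnd_jac)
  interpret lnd "\<lambda>p. jac p h" by fact
  let ?w = "mono_wt a b"
  let ?D = "\<lambda>p. jac p h" and ?E = "\<lambda>p. jac p (gr_part ?w \<omega> h)"
  fix c
  obtain n where n: "(?D ^^ n) (pois_gen c) = 0"
    using nilp unfolding locally_nilpotent_def by blast
  define r0 where "r0 = ?w (single (gen_elem c :: ('k, two) lie_basis_elem) 1)"
  \<comment> \<open>Taking the Jacobian with a polynomial of weight \<omega> shifts weights by
    \<omega> - a - b, which may be negative.\<close>
  define r where "r i = r0 + int i * (\<omega> - a - b)" for i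
  have gen: "gr_supp ?w (\<lambda>s. s = r0) (pois_gen c :: ('k, two) free_poisson)"
    by (simp add: pois_gen_eq pois_var_def r0_def gr_supp_def)
  have "gr_supp ?w (\<lambda>s. s = r i) ((?E ^^ i) (pois_gen c)) \<and>
    gr_supp ?w (\<lambda>s. s \<le> r i) ((?D ^^ i) (pois_gen c)) \<and>
    gr_supp ?w (\<lambda>s. s < r i) ((?D ^^ i) (pois_gen c) - (?E ^^ i) (pois_gen c))" for i
  proof (induction i)
    case 0
    show ?case using gr_supp_mono[OF gen, of "\<lambda>s. s \<le> r0"] gen by (simp add: r_def gr_supp_zero)
  next
    case (Suc i)
    let ?p = "(?D ^^ i) (pois_gen c)" and ?q = "(?E ^^ i) (pois_gen c)"
    have r: "r (Suc i) = r i + \<omega> - a - b" by (simp add: r_def algebra_simps)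
    have "gr_supp ?w (\<lambda>s. s = r (Suc i)) (?E ?q)"
      by (rule gr_supp_jac[OF conjunct1[OF Suc] gr_supp_gr_part]) (simp add: r)
    moreover have "gr_supp ?w (\<lambda>s. s \<le> r (Suc i)) (?D ?p)"
      by (rule gr_supp_jac[OF conjunct1[OF conjunct2[OF Suc]] h]) (simp add: r)
    moreover have "?D ?p - ?E ?q = jac (?p - ?q) h + jac ?q (h - gr_part ?w \<omega> h)"
      by (simp add: jac_simps)
    moreover have "gr_supp ?w (\<lambda>s. s < r (Suc i)) (jac (?p - ?q) h)"
      by (rule gr_supp_jac[OF conjunct2[OF conjunct2[OF Suc]] h]) (simp add: r)
    moreover have "gr_supp ?w (\<lambda>s. s < r (Suc i)) (jac ?q (h - gr_part ?w \<omega> h))"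
      by (rule gr_supp_jac[OF conjunct1[OF Suc] gr_supp_diff_gr_part[OF h]]) (simp add: r)
    ultimately show ?case by (simp add: gr_supp_add)
  qed
  from this[of n] have "gr_supp ?w (\<lambda>s. s = r n) ((?E ^^ n) (pois_gen c))"
    "gr_supp ?w (\<lambda>s. s < r n) (- (?E ^^ n) (pois_gen c))" by (simp_all add: n)
  then have "(?E ^^ n) (pois_gen c) = 0"
    using gr_supp_minus[of ?w "\<lambda>s. s < r n" "- (?E ^^ n) (pois_gen c)"]
    by (intro gr_supp_contradiction[of ?w "\<lambda>s. s = r n" _ "\<lambda>s. s < r n"]) simp_all
  then show "\<exists>n. (?E ^^ n) (pois_gen c) = 0" by blast
qed

section \<open>Automorphisms\<close>

lemma pois_const_minus: "pois_const (- c) = - pois_const c"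
  using pois_const_simps(3)[of c "- c"] by (simp add: eq_neg_iff_add_eq_0 add.commute)

lemma pois_const_power: "pois_const (c ^ n) = pois_const c ^ n"
  by (induction n) simp_all

definition poisson_endo :: "(('k::field, 'x) free_poisson \<Rightarrow> ('k, 'x) free_poisson) \<Rightarrow> bool" where
  "poisson_endo \<phi> \<longleftrightarrow> Vector_Spaces.linear pois_scale pois_scale \<phi> \<and> \<phi> 1 = 1 \<and>
    (\<forall>p q. \<phi> (p * q) = \<phi> p * \<phi> q) \<and>
    (\<forall>p q. \<phi> (pois_bracket p q) = pois_bracket (\<phi> p) (\<phi> q))"

lemma poisson_endo_ex1: "\<exists>!\<phi>. poisson_endo \<phi> \<and> (\<forall>x. \<phi> (pois_gen x) = f x)"
  using poisson_algebra.free_poisson_universal[OF poisson_algebra_free_poisson, of f]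
  unfolding poisson_endo_def by (simp only: conj_assoc)

lemma poisson_endo_eq:
  "poisson_endo \<phi> \<Longrightarrow> poisson_endo \<psi> \<Longrightarrow> (\<And>x. \<phi> (pois_gen x) = \<psi> (pois_gen x)) \<Longrightarrow> \<phi> = \<psi>"
  using poisson_endo_ex1[of "\<lambda>x. \<psi> (pois_gen x)"] by (elim ex1E) metis

lemma
  assumes "poisson_endo \<phi>"
  shows poisson_endo_add: "\<phi> (p + q) = \<phi> p + \<phi> q"
    and poisson_endo_scale: "\<phi> (pois_scale c p) = pois_scale c (\<phi> p)"
    and poisson_endo_mult: "\<phi> (p * q) = \<phi> p * \<phi> q"
    and poisson_endo_bracket: "\<phi> (pois_bracket p q) = pois_bracket (\<phi> p) (\<phi> q)"
    and poisson_endo_one: "\<phi> 1 = 1"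
    and poisson_endo_const: "\<phi> (pois_const c) = pois_const c"
    and poisson_endo_zero: "\<phi> 0 = 0"
    and poisson_endo_minus: "\<phi> (- p) = - \<phi> p"
    and poisson_endo_diff: "\<phi> (p - q) = \<phi> p - \<phi> q"
    and poisson_endo_power: "\<phi> (p ^ n) = \<phi> p ^ n"
proof -
  interpret lin: Vector_Spaces.linear pois_scale pois_scale \<phi>
    using assms unfolding poisson_endo_def by (rule conjunct1)
  show "\<phi> (p + q) = \<phi> p + \<phi> q" "\<phi> (pois_scale c p) = pois_scale c (\<phi> p)" "\<phi> 0 = 0"
    "\<phi> (- p) = - \<phi> p" "\<phi> (p - q) = \<phi> p - \<phi> q"
    by (rule lin.add lin.scale lin.zero lin.neg lin.diff)+
  show mult: "\<phi> (p * q) = \<phi> p * \<phi> q" and one: "\<phi> 1 = 1"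
    and "\<phi> (pois_bracket p q) = pois_bracket (\<phi> p) (\<phi> q)" for p q
    using assms unfolding poisson_endo_def by simp_all
  show "\<phi> (pois_const c) = pois_const c"
    using lin.scale[of c 1] by (simp add: pois_scale_def one)
  show "\<phi> (p ^ n) = \<phi> p ^ n"
    by (induction n) (simp_all add: mult one)
qed

lemmas poisson_endo_simps = poisson_endo_add poisson_endo_scale poisson_endo_mult
  poisson_endo_bracket poisson_endo_one poisson_endo_const poisson_endo_zero poisson_endo_minus
  poisson_endo_diff poisson_endo_power

lemma poisson_endo_id: "poisson_endo id"
  by (simp add: poisson_endo_def Vector_Spaces.linear_iff pois.vector_space_axioms)

lemma poisson_endo_comp: "poisson_endo \<phi> \<Longrightarrow> poisson_endo \<psi> \<Longrightarrow> poisson_endo (\<phi> \<circ> \<psi>)"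
  by (simp add: poisson_endo_def Vector_Spaces.linear_iff)

definition inverse_endos :: "(('k::field, 'x) free_poisson \<Rightarrow> ('k, 'x) free_poisson) \<Rightarrow>
    (('k, 'x) free_poisson \<Rightarrow> ('k, 'x) free_poisson) \<Rightarrow> bool" where
  "inverse_endos \<phi> \<theta> \<longleftrightarrow> poisson_endo \<phi> \<and> poisson_endo \<theta> \<and> \<phi> \<circ> \<theta> = id \<and> \<theta> \<circ> \<phi> = id"

lemma inverse_endos_gens:
  assumes "poisson_endo \<phi>" "poisson_endo \<theta>"
    and "\<And>x. \<phi> (\<theta> (pois_gen x)) = pois_gen x" "\<And>x. \<theta> (\<phi> (pois_gen x)) = pois_gen x"
  shows "inverse_endos \<phi> \<theta>"
  unfolding inverse_endos_def
  using assms by (auto intro!: poisson_endo_eq poisson_endo_comp poisson_endo_id)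

lemma
  assumes "inverse_endos \<phi> \<theta>"
  shows inverse_endos_bij: "bij \<phi>" and inverse_endos_inv: "inv \<phi> = \<theta>"
    and inverse_endos_left: "\<phi> (\<theta> p) = p" and inverse_endos_right: "\<theta> (\<phi> p) = p"
proof -
  note * = assms[unfolded inverse_endos_def]
  show "bij \<phi>" using * by (intro o_bij[of \<theta>]) simp_all
  show "inv \<phi> = \<theta>" using * by (intro inv_unique_comp) simp_all
  show "\<phi> (\<theta> p) = p" "\<theta> (\<phi> p) = p" using * by (simp_all add: fun_eq_iff)
qed

lemma inverse_endos_comp:
  "inverse_endos \<phi> \<theta> \<Longrightarrow> inverse_endos \<phi>' \<theta>' \<Longrightarrow> inverse_endos (\<phi> \<circ> \<phi>') (\<theta>' \<circ> \<theta>)"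
  by (simp add: inverse_endos_def poisson_endo_comp fun_eq_iff)

lemma poisson_endo_fixes:
  assumes "poisson_endo \<phi>" "\<And>p. p \<in> S \<Longrightarrow> \<phi> p = p" "h \<in> poisson_subalgebra S"
  shows "\<phi> h = h"
  using assms(3)
  by induction (simp_all add: assms(2) poisson_endo_simps[OF assms(1)] poisson_endo_add[OF assms(1)] poisson_endo_simps[OF assms(1)] poisson_endo_bracket[OF assms(1)])

text \<open>Both maps fix h, which lies in the subalgebra of the generators that they fix. Hence
  adding and subtracting h are mutually inverse.\<close>

lemma shear_automorphism:
  fixes h :: "('k::field, 'x) free_poisson"
  assumes h: "h \<in> poisson_subalgebra {pois_gen j |j. j \<noteq> i}"
  obtains \<phi> \<theta> where "inverse_endos \<phi> \<theta>" "tame_automorphism \<phi>"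
    "\<phi> (pois_gen i) = pois_gen i + h" "\<theta> (pois_gen i) = pois_gen i - h"
    "\<And>j. j \<noteq> i \<Longrightarrow> \<phi> (pois_gen j) = pois_gen j" "\<And>j. j \<noteq> i \<Longrightarrow> \<theta> (pois_gen j) = pois_gen j"
proof -
  obtain \<phi> \<theta> where \<phi>: "poisson_endo \<phi>" "\<And>j. \<phi> (pois_gen j) = (if j = i then pois_gen i + h else pois_gen j)"
    and \<theta>: "poisson_endo \<theta>" "\<And>j. \<theta> (pois_gen j) = (if j = i then pois_gen i - h else pois_gen j)"
    using ex1_implies_ex[OF poisson_endo_ex1[of "\<lambda>j. if j = i then pois_gen i + h else pois_gen j"]]
      ex1_implies_ex[OF poisson_endo_ex1[of "\<lambda>j. if j = i then pois_gen i - h else pois_gen j"]]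
    by blast
  have "\<phi> h = h" by (rule poisson_endo_fixes[OF \<phi>(1) _ h]) (auto simp: \<phi>(2))
  moreover have "\<theta> h = h" by (rule poisson_endo_fixes[OF \<theta>(1) _ h]) (auto simp: \<theta>(2))
  ultimately have inv: "inverse_endos \<phi> \<theta>"
    by (intro inverse_endos_gens \<phi>(1) \<theta>(1))
      (simp_all add: \<phi>(2) \<theta>(2) poisson_endo_simps[OF \<theta>(1)] poisson_endo_diff[OF \<phi>(1)])
  have "poisson_automorphism \<phi>"
    using inverse_endos_bij[OF inv] \<phi>(1) by (simp add: poisson_automorphism_def poisson_endo_def)
  then have "elementary_automorphism \<phi>"
    using h \<phi>(2) unfolding elementary_automorphism_def
    by (intro conjI exI[of _ i] exI[of _ 1] exI[of _ h]) auto
  then show ?thesis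
    using inv \<phi>(2) \<theta>(2) by (intro that[of \<phi> \<theta>] tame_automorphism.elementary) auto
qed

text \<open>The inductive definition has no clause for the identity, but it is elementary with
  \<alpha> = 1 and h = 0.\<close>

lemma tame_automorphism_id: "tame_automorphism id"
proof (rule tame_automorphism.elementary)
  have "poisson_automorphism (id :: ('a, 'b) free_poisson \<Rightarrow> _)"
    using poisson_endo_id by (simp add: poisson_automorphism_def poisson_endo_def)
  moreover have "0 \<in> poisson_subalgebra {pois_gen j |j. j \<noteq> i}" for i :: 'b
    using poisson_subalgebra.const[of 0] by simp
  ultimately show "elementary_automorphism (id :: ('a, 'b) free_poisson \<Rightarrow> _)"
    unfolding elementary_automorphism_def
    by (intro conjI exI[of _ undefined] exI[of _ 1] exI[of _ 0]) auto
qed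

lemma tame_automorphism_bij: "tame_automorphism \<phi> \<Longrightarrow> bij \<phi>"
proof (induction rule: tame_automorphism.induct)
  case (comp \<phi> \<psi>)
  then show ?case by (intro bij_comp)
qed (simp add: elementary_automorphism_def poisson_automorphism_def)

section \<open>Conjugation of Hamiltonian derivations\<close>

definition triangulable :: "(('k::field, two) free_poisson \<Rightarrow> ('k, two) free_poisson) \<Rightarrow> bool" where
  "triangulable D \<longleftrightarrow> (\<exists>\<phi> f. tame_automorphism \<phi> \<and> inv \<phi> \<circ> D \<circ> \<phi> =
    derivation_of (\<lambda>x. case x of X1 \<Rightarrow> pois_poly f (pois_gen X2) | X2 \<Rightarrow> 0))"

lemma triangulable_conj:
  assumes "tame_automorphism \<psi>" "triangulable (inv \<psi> \<circ> D \<circ> \<psi>)"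
  shows "triangulable D"
proof -
  obtain \<phi> f where \<phi>: "tame_automorphism \<phi>" "inv \<phi> \<circ> (inv \<psi> \<circ> D \<circ> \<psi>) \<circ> \<phi> =
      derivation_of (\<lambda>x. case x of X1 \<Rightarrow> pois_poly f (pois_gen X2) | X2 \<Rightarrow> 0)"
    using assms(2) unfolding triangulable_def by blast
  have "inv (\<psi> \<circ> \<phi>) = inv \<phi> \<circ> inv \<psi>"
    using assms(1) \<phi>(1) by (intro o_inv_distrib tame_automorphism_bij)
  then have "inv (\<psi> \<circ> \<phi>) \<circ> D \<circ> (\<psi> \<circ> \<phi>) = inv \<phi> \<circ> (inv \<psi> \<circ> D \<circ> \<psi>) \<circ> \<phi>"
    by (simp add: comp_assoc)
  with \<phi> tame_automorphism.comp[OF assms(1) \<phi>(1)] show ?thesis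
    unfolding triangulable_def by metis
qed

lemma derivation_of_eq:
  "poisson_derivation D \<Longrightarrow> (\<And>x. D (pois_gen x) = f x) \<Longrightarrow> derivation_of f = D"
  unfolding derivation_of_def by (rule the1_equality[OF poisson_derivation_ex1]) simp

text \<open>H describes D on k[x, y] only. On the other variables D is dictated by the Poisson
  bracket, whereas the Jacobian with H vanishes there.\<close>

definition ham :: "(('k::field_char_0, two) free_poisson \<Rightarrow> ('k, two) free_poisson) \<Rightarrow>
    ('k, two) free_poisson \<Rightarrow> bool" where
  "ham D H \<longleftrightarrow> poisson_derivation D \<and> locally_nilpotent D \<and> plane H \<and>
    (\<forall>p. plane p \<longrightarrow> D p = jac p H)"

lemma poisson_endo_plane:
  assumes "poisson_endo \<theta>" "\<And>x. plane (\<theta> (pois_gen x))" "plane p"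
  shows "plane (\<theta> p)"
  using assms(3)
  by (induction rule: plane_induct)
    (simp_all add: poisson_endo_simps[OF assms(1)] poisson_endo_add[OF assms(1)] poisson_endo_simps[OF assms(1)] plane_const plane_add plane_mult assms(2))

lemma pdiff_poisson_endo:
  assumes \<theta>: "poisson_endo \<theta>" and "plane p"
  shows "pois_pdiff e (\<theta> p) = \<theta> (pois_pdiff ex p) * pois_pdiff e (\<theta> (pois_gen X1)) +
    \<theta> (pois_pdiff ey p) * pois_pdiff e (\<theta> (pois_gen X2))"
  using assms(2)
proof (induction rule: plane_induct)
  case (gen x)
  then show ?case
    by (cases x) (simp_all add: pois_gen_eq pois_pdiff_var poisson_endo_simps[OF \<theta>] poisson_endo_one[OF \<theta>])
qed (simp_all add: poisson_endo_simps[OF \<theta>] poisson_endo_add[OF \<theta>] poisson_endo_simps[OF \<theta>]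
    poisson_endo_zero[OF \<theta>] pois_pdiff_const pois_pdiff_add pois_pdiff_mult algebra_simps)

lemma jac_poisson_endo:
  assumes \<theta>: "poisson_endo \<theta>" and "plane p" "plane h"
  shows "jac (\<theta> p) (\<theta> h) = \<theta> (jac p h) * jac (\<theta> (pois_gen X1)) (\<theta> (pois_gen X2))"
  by (simp add: jac_def pdiff_poisson_endo[OF \<theta>] assms(2,3) poisson_endo_simps[OF \<theta>]
      poisson_endo_mult[OF \<theta>] algebra_simps)

text \<open>By the chain rule, Jacobians are multiplied by that of \<theta>. Determinant 1 carries H
  to \<theta> H without a factor, and is the reason for the sign in
  \<open>rotation_automorphism\<close>.\<close>

lemma ham_conj:
  assumes ham: "ham D H" and inv: "inverse_endos \<phi> \<theta>"
    and plane: "\<And>x. plane (\<phi> (pois_gen x))" "\<And>x. plane (\<theta> (pois_gen x))"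
    and jac: "jac (\<theta> (pois_gen X1)) (\<theta> (pois_gen X2)) = 1"
  shows "ham (\<theta> \<circ> D \<circ> \<phi>) (\<theta> H)"
  unfolding ham_def
proof (intro conjI allI impI)
  have D: "poisson_derivation D" "locally_nilpotent D" and H: "plane H"
    and DH: "\<And>p. plane p \<Longrightarrow> D p = jac p H"
    using ham by (simp_all add: ham_def)
  have \<phi>: "poisson_endo \<phi>" and \<theta>: "poisson_endo \<theta>" using inv by (simp_all add: inverse_endos_def)
  note [simp] = inverse_endos_left[OF inv] inverse_endos_right[OF inv]
  show "poisson_derivation (\<theta> \<circ> D \<circ> \<phi>)"
    unfolding poisson_derivation_def Vector_Spaces.linear_iff
    by (simp add: pois.vector_space_axioms poisson_endo_simps[OF \<phi>] poisson_endo_add[OF \<theta>] poisson_endo_simps[OF \<phi>] poisson_endo_mult[OF \<theta>] poisson_endo_simps[OF \<phi>]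
        poisson_endo_bracket[OF \<theta>] poisson_endo_simps[OF \<phi>] poisson_endo_scale[OF \<theta>]
        poisson_derivation_simps[OF D(1)])
  show "locally_nilpotent (\<theta> \<circ> D \<circ> \<phi>)"
    unfolding locally_nilpotent_def
  proof
    fix p
    have "((\<theta> \<circ> D \<circ> \<phi>) ^^ n) p = \<theta> ((D ^^ n) (\<phi> p))" for n
      by (induction n) simp_all
    moreover obtain n where "(D ^^ n) (\<phi> p) = 0"
      using D(2) unfolding locally_nilpotent_def by blast
    ultimately show "\<exists>n. ((\<theta> \<circ> D \<circ> \<phi>) ^^ n) p = 0"
      by (intro exI[of _ n]) (simp add: poisson_endo_zero[OF \<theta>])
  qed
  show "plane (\<theta> H)" using \<theta> plane(2) H by (rule poisson_endo_plane)
  fix p :: "('a, two) free_poisson"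
  assume "plane p"
  then have p: "plane (\<phi> p)" by (rule poisson_endo_plane[OF \<phi> plane(1)])
  then show "(\<theta> \<circ> D \<circ> \<phi>) p = jac p (\<theta> H)"
    using jac_poisson_endo[OF \<theta> p H] by (simp add: DH jac)
qed

lemma pois_poly_exists:
  fixes p :: "('k::field, 'x) free_poisson"
  assumes "pois_vars p \<subseteq> {e}"
  shows "\<exists>f. p = pois_poly f (pois_var e)"
proof -
  have "keys p \<subseteq> {m. keys m \<subseteq> {e}}"
    using assms by (auto simp: pois_vars_def)
  then show ?thesis
  proof (induction rule: poly_mapping_keys_induct)
    case zero
    show ?case by (intro exI[of _ 0]) (simp add: pois_poly_def)
  next
    case (add m c p)
    then obtain f where f: "p = pois_poly f (pois_var e)" by blast
    have m: "m = single e (lookup m e)"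
      using add(1) by (intro poly_mapping_eqI) (auto simp: lookup_single when_def in_keys_iff)
    have "map_poly pois_const (monom c (lookup m e) + f) =
        monom (pois_const c :: ('k, 'x) free_poisson) (lookup m e) + map_poly pois_const f"
      by (rule poly_eqI) (simp add: coeff_map_poly)
    then have "pois_poly (monom c (lookup m e) + f) (pois_var e) =
        pois_const c * pois_var e ^ lookup m e + p"
      by (simp add: pois_poly_def f poly_monom)
    also have "pois_const c * pois_var e ^ lookup m e = single m c"
      by (subst (2) m) (simp add: pois_var_power pois_const_def mult_single)
    finally show ?case by metis
  qed
qed

definition bidegree :: "(('k::field_char_0, two) lie_basis_elem \<Rightarrow>\<^sub>0 nat) \<Rightarrow> nat \<times> nat" where
  "bidegree m = (lookup m ex, lookup m ey)"

text \<open>H has no nonconstant pure power of x, so y divides dH/dx = - D y. A locally nilpotent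
  derivation cannot multiply y by a nonzero factor, so D y = 0, and then D x = dH/dy does not
  involve x.\<close>

lemma triangulable_base:
  assumes ham: "ham D H" and H: "gr_supp bidegree (\<lambda>(i, j). j = 0 \<longrightarrow> i = 0) H"
  shows "triangulable D"
proof -
  have D: "poisson_derivation D" "locally_nilpotent D" and plane: "plane H"
    and DH: "\<And>p. plane p \<Longrightarrow> D p = jac p H"
    using ham by (simp_all add: ham_def)
  have Dx: "D (pois_gen X1) = pois_pdiff ey H" and Dy: "D (pois_gen X2) = - pois_pdiff ex H"
    by (simp_all add: DH plane_gen jac_gen)
  have "pois_var ey dvd pois_pdiff ex H"
  proof (rule pois_var_dvd)
    fix m
    assume "m \<in> keys (pois_pdiff ex H)"
    then have "m + single ex 1 \<in> keys H"
      by (auto simp: in_keys_iff lookup_pois_pdiff)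
    with H show "lookup m ey \<noteq> 0"
      by (force simp: gr_supp_def bidegree_def lookup_add lookup_single)
  qed
  then have "pois_gen X2 dvd D (pois_gen X2)" unfolding Dy unfolding pois_gen_eq by simp
  then obtain q where "D (pois_gen X2) = pois_gen X2 * q" by blast
  then have Dy0: "D (pois_gen X2) = 0"
    by (rule locally_nilpotent_multiple_zero[OF poisson_derivation_add[OF D(1)]
        poisson_derivation_mult[OF D(1)] D(2)])
  then have "pois_pdiff ex (D (pois_gen X1)) = 0"
    using Dy pois_pdiff_commute[of ex ey H] by (simp add: Dx pois_pdiff_zero)
  moreover have "plane (D (pois_gen X1))" using plane by (simp add: Dx plane_pdiff)
  ultimately have "pois_vars (D (pois_gen X1)) \<subseteq> {ey}"
    by (auto simp: pois_pdiff_eq_0_iff plane_def)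
  then obtain f where f: "D (pois_gen X1) = pois_poly f (pois_gen X2)"
    using pois_poly_exists pois_gen_eq by metis
  have "derivation_of (\<lambda>x. case x of X1 \<Rightarrow> pois_poly f (pois_gen X2) | X2 \<Rightarrow> 0) = D"
    using D(1) by (rule derivation_of_eq) (simp add: f Dy0 split: two.split)
  then have "inv id \<circ> D \<circ> id = derivation_of (\<lambda>x. case x of X1 \<Rightarrow> pois_poly f (pois_gen X2) | X2 \<Rightarrow> 0)"
    by simp
  then show ?thesis
    using tame_automorphism_id unfolding triangulable_def by blast
qed

section \<open>Reduction of the Newton polygon\<close>

lemma jac_minus_left: "jac (- p) h = - jac p h"
  using jac_simps(1)[of p "- p" h] by (simp add: jac_zero eq_neg_iff_add_eq_0 add.commute)

text \<open>A product of three shears.\<close>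

lemma rotation_automorphism:
  obtains \<phi> \<theta> :: "('k::field, two) free_poisson \<Rightarrow> ('k, two) free_poisson" where
    "inverse_endos \<phi> \<theta>" "tame_automorphism \<phi>"
    "\<phi> (pois_gen X1) = pois_gen X2" "\<phi> (pois_gen X2) = - pois_gen X1"
    "\<theta> (pois_gen X1) = - pois_gen X2" "\<theta> (pois_gen X2) = pois_gen X1"
proof -
  have "(pois_gen X2 :: ('k, two) free_poisson) \<in> poisson_subalgebra {pois_gen j |j. j \<noteq> X1}"
    by (rule poisson_subalgebra.base) blast
  then obtain a a' where a: "inverse_endos a a'" "tame_automorphism a"
    "a (pois_gen X1) = pois_gen X1 + (pois_gen X2 :: ('k, two) free_poisson)"
    "\<And>j. j \<noteq> X1 \<Longrightarrow> a (pois_gen j) = pois_gen j"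
    by (rule shear_automorphism) blast
  have "pois_const (-1) * (pois_gen X1 :: ('k, two) free_poisson) \<in> poisson_subalgebra {pois_gen j |j. j \<noteq> X2}"
    by (intro poisson_subalgebra.mult poisson_subalgebra.const poisson_subalgebra.base) blast
  then obtain b b' where b: "inverse_endos b b'" "tame_automorphism b"
    "b (pois_gen X2) = pois_gen X2 + pois_const (-1) * (pois_gen X1 :: ('k, two) free_poisson)"
    "\<And>j. j \<noteq> X2 \<Longrightarrow> b (pois_gen j) = pois_gen j"
    by (rule shear_automorphism) blast
  let ?\<phi> = "a \<circ> b \<circ> a" and ?\<theta> = "a' \<circ> (b' \<circ> a')"
  have inv: "inverse_endos ?\<phi> ?\<theta>"
    by (intro inverse_endos_comp a(1) b(1))
  have endo: "poisson_endo a" "poisson_endo b" "poisson_endo ?\<theta>"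
    using a(1) b(1) inv by (simp_all add: inverse_endos_def)
  have \<phi>: "?\<phi> (pois_gen X1) = pois_gen X2" "?\<phi> (pois_gen X2) = - pois_gen X1"
    by (simp_all add: a(3,4) b(3,4) poisson_endo_simps[OF endo(1)] poisson_endo_add[OF endo(2)] poisson_endo_simps[OF endo(1)] pois_const_minus)
  then have "?\<theta> (pois_gen X2) = pois_gen X1" "?\<theta> (- pois_gen X1) = pois_gen X2"
    using inverse_endos_right[OF inv] by metis+
  then have \<theta>: "?\<theta> (pois_gen X2) = pois_gen X1" "?\<theta> (pois_gen X1) = - pois_gen X2"
    unfolding poisson_endo_minus[OF endo(3)] by (simp_all add: minus_equation_iff)
  have "tame_automorphism ?\<phi>" by (intro tame_automorphism.comp a(2) b(2))
  from that[OF inv this \<phi> \<theta>(2,1)] show ?thesis .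
qed

text \<open>The rotation exchanges the exponents of x and y, up to signs of coefficients. As a
  reduction rule this lets the smaller bound always belong to x.\<close>

lemma ham_rotation:
  fixes D :: "('k::field_char_0, two) free_poisson \<Rightarrow> ('k, two) free_poisson"
  assumes ham: "ham D H" and H: "gr_supp bidegree Q H"
    and triang: "\<And>(D' :: ('k, two) free_poisson \<Rightarrow> _) H'. ham D' H' \<Longrightarrow> gr_supp bidegree (\<lambda>(i, j). Q (j, i)) H' \<Longrightarrow> triangulable D'"
  shows "triangulable D"
proof -
  obtain \<phi> \<theta> :: "('k, two) free_poisson \<Rightarrow> ('k, two) free_poisson" where
    inv: "inverse_endos \<phi> \<theta>" "tame_automorphism \<phi>"
    and \<phi>: "\<phi> (pois_gen X1) = pois_gen X2" "\<phi> (pois_gen X2) = - pois_gen X1"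
    and \<theta>: "\<theta> (pois_gen X1) = - pois_gen X2" "\<theta> (pois_gen X2) = pois_gen X1"
    by (rule rotation_automorphism) blast
  have endo: "poisson_endo \<theta>" using inv(1) by (simp add: inverse_endos_def)
  have "plane (\<phi> (pois_gen x))" "plane (\<theta> (pois_gen x))" for x
    by (cases x; simp add: \<phi> \<theta> plane_gen plane_minus)+
  moreover have "jac (\<theta> (pois_gen X1)) (\<theta> (pois_gen X2)) = 1"
    by (simp add: \<theta> jac_minus_left jac_gen) (simp add: pois_gen_eq pois_pdiff_var)
  ultimately have "ham (\<theta> \<circ> D \<circ> \<phi>) (\<theta> H)" by (intro ham_conj[OF ham inv(1)])
  moreover have "gr_supp bidegree (\<lambda>(i, j). Q (j, i)) (\<theta> H)"
  proof -
    have "plane H" using ham by (simp add: ham_def)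
    then show ?thesis using H
    proof (induction rule: plane_monomial_induct)
      case zero
      then show ?case by (simp add: poisson_endo_zero[OF endo] gr_supp_zero)
    next
      case (add m c p)
      let ?i = "lookup m ex" and ?j = "lookup m ey"
      let ?m = "single ex ?j + single (ey :: ('k, two) lie_basis_elem) ?i"
      have "\<theta> (pois_const c * pois_gen X1 ^ ?i * pois_gen X2 ^ ?j) =
          pois_const c * (- pois_gen X2) ^ ?i * pois_gen X1 ^ ?j"
        by (simp add: poisson_endo_simps[OF endo] poisson_endo_power[OF endo] poisson_endo_simps[OF endo] \<theta>)
      also have "\<dots> = pois_const (c * (-1) ^ ?i) * (pois_gen X1 ^ ?j * pois_gen X2 ^ ?i)"
        by (subst power_minus) (simp add: pois_const_power pois_const_minus mult_ac)
      also have "\<dots> = single ?m (c * (-1) ^ ?i)"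
        by (simp add: pois_gen_eq pois_var_power pois_const_def mult_single)
      finally have "\<theta> (pois_const c * pois_gen X1 ^ ?i * pois_gen X2 ^ ?j) =
        single ?m (c * (-1) ^ ?i)" .
      moreover have "gr_supp bidegree (\<lambda>(i, j). Q (j, i)) (single ?m (c * (-1) ^ ?i))"
        using add(2) by (simp add: gr_supp_def bidegree_def lookup_add lookup_single)
      ultimately show ?case
        using add(3) by (simp add: poisson_endo_add[OF endo] gr_supp_add)
    qed
  qed
  ultimately have "triangulable (inv \<phi> \<circ> D \<circ> \<phi>)"
    unfolding inverse_endos_inv[OF inv(1)] by (rule triang)
  with inv(2) show ?thesis by (rule triangulable_conj)
qed

lemma gr_supp_const: "gr_supp (mono_wt a b) (\<lambda>s. s = 0) (pois_const c)"
  by (simp add: gr_supp_def pois_const_def mono_wt_def)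

lemma gr_supp_power:
  fixes f :: "('k::field_char_0, two) free_poisson"
  assumes "gr_supp (mono_wt a b) (\<lambda>s. s = r) f"
  shows "gr_supp (mono_wt a b) (\<lambda>s. s = int n * r) (f ^ n)"
proof (induction n)
  case 0
  have "gr_supp (mono_wt a b) (\<lambda>s. s = 0) (pois_const 1 :: ('k, two) free_poisson)"
    by (rule gr_supp_const)
  then show ?case by simp
next
  case (Suc n)
  show ?case
    unfolding power_Suc
    by (rule gr_supp_mult[OF mono_wt_add assms Suc]) (simp add: algebra_simps)
qed

lemma gr_supp_gen: "gr_supp (mono_wt a b) (\<lambda>s. s = (case x of X1 \<Rightarrow> a | X2 \<Rightarrow> b)) (pois_gen x)"
  by (cases x) (simp_all add: gr_supp_def pois_gen_eq pois_var_def mono_wt_def lookup_single)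

lemma gr_supp_poisson_endo:
  assumes \<theta>: "poisson_endo \<theta>" and "plane p" "gr_supp (mono_wt a b) Q p"
    and x: "gr_supp (mono_wt a b) (\<lambda>s. s = a) (\<theta> (pois_gen X1))"
    and y: "gr_supp (mono_wt a b) (\<lambda>s. s = b) (\<theta> (pois_gen X2))"
  shows "gr_supp (mono_wt a b) Q (\<theta> p)"
  using assms(2,3)
proof (induction rule: plane_monomial_induct)
  case zero
  then show ?case by (simp add: poisson_endo_zero[OF \<theta>] gr_supp_zero)
next
  case (add m c p)
  let ?i = "lookup m ex" and ?j = "lookup m ey"
  have 1: "gr_supp (mono_wt a b) (\<lambda>s. s = int ?i * a) (pois_const c * \<theta> (pois_gen X1) ^ ?i)"
    by (rule gr_supp_mult[OF mono_wt_add gr_supp_const gr_supp_power[OF x]]) simp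
  have "gr_supp (mono_wt a b) (\<lambda>s. s = mono_wt a b m)
      (pois_const c * \<theta> (pois_gen X1) ^ ?i * \<theta> (pois_gen X2) ^ ?j)"
    by (rule gr_supp_mult[OF mono_wt_add 1 gr_supp_power[OF y]]) (simp add: mono_wt_def algebra_simps)
  then have "gr_supp (mono_wt a b) Q (pois_const c * \<theta> (pois_gen X1) ^ ?i * \<theta> (pois_gen X2) ^ ?j)"
    by (rule gr_supp_mono) (simp add: add(2))
  with add(3) show ?case
    by (simp add: poisson_endo_simps[OF \<theta>] poisson_endo_mult[OF \<theta>] poisson_endo_simps[OF \<theta>]
        poisson_endo_const[OF \<theta>] gr_supp_add)
qed

text \<open>Iterates on the generators stay in k[x, y], where D and the Jacobian agree.\<close>

lemma ham_lnd: "ham D H \<Longrightarrow> lnd (\<lambda>p. jac p H)"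
proof (rule lnd_jac)
  fix c
  assume ham: "ham D H"
  have "plane (((\<lambda>p. jac p H) ^^ n) (pois_gen c)) \<and> (D ^^ n) (pois_gen c) = ((\<lambda>p. jac p H) ^^ n) (pois_gen c)" for n
    using ham by (induction n) (simp_all add: ham_def plane_gen plane_jac)
  moreover obtain n where "(D ^^ n) (pois_gen c) = 0"
    using ham unfolding ham_def locally_nilpotent_def by blast
  ultimately show "\<exists>n. ((\<lambda>p. jac p H) ^^ n) (pois_gen c) = 0" by metis
qed

text \<open>The weights M of x and N of y give x^N and y^M the same weight N * M. Pure powers do not
  exceed it. A top part above it would have mixed monomials only, so x would divide its derivative
  by y, the image of x; by local nilpotence this image would be zero.\<close>

lemma ham_Newton_edge:
  fixes H :: "('k::field_char_0, two) free_poisson"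
  assumes lnd: "lnd (\<lambda>p. jac p H)" and plane: "plane H" and NM: "N > 0" "N \<le> M"
    and H: "gr_supp bidegree (\<lambda>(i, j). (j = 0 \<longrightarrow> i \<le> N) \<and> (i = 0 \<longrightarrow> j \<le> M)) H"
    and pure: "single ex N \<in> keys H" "single ey M \<in> keys H"
  shows "gr_supp (mono_wt (int M) (int N)) (\<lambda>r. r \<le> int (N * M)) H"
    and "\<exists>t \<mu> c. M = N * t \<and> c \<noteq> 0 \<and>
      gr_part (mono_wt (int M) (int N)) (int (N * M)) H =
        pois_const c * (pois_gen X1 - pois_const \<mu> * pois_gen X2 ^ t) ^ N"
proof -
  let ?w = "mono_wt (int M) (int N) :: (('k, two) lie_basis_elem \<Rightarrow>\<^sub>0 nat) \<Rightarrow> int"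
  have bound: "lookup m ey = 0 \<Longrightarrow> lookup m ex \<le> N"
    "lookup m ex = 0 \<Longrightarrow> lookup m ey \<le> M" if "m \<in> keys H" for m
    using H that by (auto simp: gr_supp_def bidegree_def)
  define \<omega> where "\<omega> = Max (?w ` keys H)"
  have fin: "finite (?w ` keys H)" "?w ` keys H \<noteq> {}" using pure by auto
  have \<omega>: "gr_supp ?w (\<lambda>r. r \<le> \<omega>) H"
    using fin by (auto simp: gr_supp_def \<omega>_def)
  have "\<omega> \<le> int (N * M)"
  proof (rule ccontr)
    assume gt: "\<not> \<omega> \<le> int (N * M)"
    let ?T = "gr_part ?w \<omega> H"
    have T: "m \<in> keys H \<and> ?w m = \<omega>" if "m \<in> keys ?T" for m
      using that by (auto simp: in_keys_iff lookup_gr_part split: if_splits)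
    have mixed: "lookup m ex \<noteq> 0 \<and> lookup m ey \<noteq> 0"
      if "m \<in> keys ?T" for m
    proof (intro conjI notI)
      assume 0: "lookup m ex = 0"
      with bound(2) T[OF that] have "int N * int (lookup m ey) \<le> int N * int M"
        by (intro mult_left_mono) auto
      with 0 T[OF that] gt show False by (simp add: mono_wt_def)
    next
      assume 0: "lookup m ey = 0"
      with bound(1) T[OF that] have "int M * int (lookup m ex) \<le> int M * int N"
        by (intro mult_left_mono) auto
      with 0 T[OF that] gt show False by (simp add: mono_wt_def mult.commute)
    qed
    interpret T: lnd "\<lambda>p. jac p ?T" by (rule lnd_jac_top[OF \<omega> lnd])
    have "pois_var ex dvd pois_pdiff ey ?T"
    proof (rule pois_var_dvd)
      fix m
      assume "m \<in> keys (pois_pdiff ey ?T)"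
      then have "m + single ey 1 \<in> keys ?T"
        by (auto simp: in_keys_iff lookup_pois_pdiff)
      from mixed[OF this] show "lookup m ex \<noteq> 0"
        by (simp add: lookup_add lookup_single)
    qed
    then have "pois_gen X1 dvd jac (pois_gen X1) ?T" unfolding jac_gen unfolding pois_gen_eq .
    then obtain q where "jac (pois_gen X1) ?T = pois_gen X1 * q" by blast
    then have "jac (pois_gen X1) ?T = 0"
      by (rule locally_nilpotent_multiple_zero[OF T.add T.mult T.nilp])
    then have "pois_pdiff ey ?T = 0" by (simp add: jac_gen)
    moreover obtain m where "m \<in> keys H" "?w m = \<omega>"
      using Max_in[OF fin] by (auto simp: \<omega>_def)
    then have "m \<in> keys ?T" by (simp add: in_keys_iff lookup_gr_part)
    ultimately show False using mixed pois_pdiff_lookup_nonzero by blast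
  qed
  with \<omega> show le: "gr_supp ?w (\<lambda>r. r \<le> int (N * M)) H"
    by (auto intro: gr_supp_mono)
  let ?T = "gr_part ?w (int (N * M)) H"
  \<comment> \<open>As s and t are coprime, the lattice points on the edge are the exponents of x^(s
    i) y^(t (g - i)). So the edge part is a binary form of degree g in x^s and y^t.\<close>
  define g s t where "g = gcd N M" and "s = N div g" and "t = M div g"
  have g: "g > 0" "N = s * g" "M = t * g" "coprime s t"
    using NM by (auto simp: g_def s_def t_def div_gcd_coprime)
  have st: "s > 0" "t > 0" using g NM by (auto intro: gr0I)
  define mon where "mon i = single ex (s * i) + single (ey :: ('k, two) lie_basis_elem) (t * (g - i))" for i
  define f where "f = (\<Sum>i\<le>g. monom (lookup ?T (mon i)) i)"
  have coeff_f: "coeff f i = (if i \<le> g then lookup ?T (mon i) else 0)" for i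
    by (simp add: f_def coeff_sum)
  have mon_inj: "mon i = mon j \<Longrightarrow> i = j" for i j
    using st by (auto dest!: arg_cong[where f = "\<lambda>m. lookup m ex"]
        simp: mon_def lookup_add lookup_single)
  have mon_exists: "\<exists>i\<le>g. m = mon i" if "m \<in> keys ?T" for m
  proof -
    let ?i = "lookup m ex" and ?j = "lookup m ey"
    from that have m: "m \<in> keys H" "?w m = int (N * M)"
      by (auto simp: in_keys_iff lookup_gr_part split: if_splits)
    then have "int (M * ?i + N * ?j) = int (N * M)" by (simp add: mono_wt_def)
    then have "M * ?i + N * ?j = N * M" by (simp only: of_nat_eq_iff)
    then have "g * (t * ?i + s * ?j) = g * (s * g * t)" by (simp add: g(2,3) algebra_simps)
    then have eq: "t * ?i + s * ?j = s * g * t" using g(1) by simp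
    then have "s dvd t * ?i" by (metis dvd_add_left_iff dvd_triv_left mult.assoc)
    then have "s dvd ?i" using g(4) by (simp add: coprime_dvd_mult_right_iff)
    then obtain k where k: "?i = s * k" by blast
    with eq have "s * (t * k + ?j) = s * (g * t)" by (simp add: algebra_simps)
    then have j: "t * k + ?j = g * t" using st by simp
    then have "t * k \<le> t * g" by (metis le_add1 mult.commute)
    then have "k \<le> g" using st by simp
    moreover have "?j = t * (g - k)" using j by (simp add: diff_mult_distrib2 mult.commute)
    ultimately show ?thesis
      using plane_monomial[OF plane_keys[OF plane m(1)]] k by (auto simp: mon_def)
  qed
  have T_eq: "?T = bform pois_const g f (pois_var ex ^ s) (pois_var ey ^ t)"
  proof -
    have "bform pois_const g f (pois_var ex ^ s) (pois_var ey ^ t) =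
        (\<Sum>i\<le>g. single (mon i) (lookup ?T (mon i)))"
      unfolding bform_def power_mult[symmetric] unfolding pois_var_power
      by (intro sum.cong) (simp_all add: coeff_f mon_def pois_const_def mult_single)
    also have "\<dots> = ?T"
    proof (rule poly_mapping_eqI)
      fix m
      have "(\<Sum>i\<le>g. lookup (single (mon i) (lookup ?T (mon i))) m) =
          (\<Sum>i\<le>g. if m = mon i then lookup ?T m else 0)"
        by (intro sum.cong refl) (auto simp: lookup_single when_def)
      also have "\<dots> = lookup ?T m"
      proof (cases "m \<in> keys ?T")
        case True
        then obtain k where k: "k \<le> g" "m = mon k" using mon_exists by blast
        then have "(\<Sum>i\<le>g. if m = mon i then lookup ?T m else 0) =
            (\<Sum>i\<le>g. if i = k then lookup ?T m else 0)"
          using mon_inj by (intro sum.cong) auto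
        with k show ?thesis by simp
      next
        case False
        then have "lookup ?T m = 0" by (simp only: in_keys_iff not_not)
        then show ?thesis by (simp only: if_cancel sum.neutral_const)
      qed
      finally show "lookup (\<Sum>i\<le>g. single (mon i) (lookup ?T (mon i))) m =
          lookup ?T m" by (simp add: lookup_sum)
    qed
    finally show ?thesis by simp
  qed
  have pure_T: "single ex N \<in> keys ?T" "single ey M \<in> keys ?T"
    using pure by (simp_all add: in_keys_iff lookup_gr_part mono_wt_def lookup_single)
  have mon: "mon g = single ex N" "mon 0 = single ey M"
    by (simp_all add: mon_def g(2,3))
  have "coeff f g \<noteq> 0" "coeff f 0 \<noteq> 0"
    using pure_T by (simp_all add: coeff_f mon in_keys_iff)
  moreover from this have "degree f = g"
    by (intro order_antisym degree_le le_degree) (simp_all add: coeff_f)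
  moreover have "pois_pdiff ex ?T \<noteq> 0" "pois_pdiff ey ?T \<noteq> 0"
    using pois_pdiff_lookup_nonzero[OF pure_T(1), of ex] pois_pdiff_lookup_nonzero[OF pure_T(2), of ey] NM
    by (simp_all add: lookup_single)
  ultimately have "(s = 1 \<or> t = 1) \<and> (\<exists>c \<mu>. c \<noteq> 0 \<and> \<mu> \<noteq> 0 \<and>
      ?T = pois_const c * (pois_var ex ^ s - pois_const \<mu> * pois_var ey ^ t) ^ g)"
    using jac_gen[of ?T] g(1) st
    by (intro lnd_binary_form[OF lnd_jac_top[OF le lnd] T_eq])
      (simp_all add: jac_simps pois_gen_eq)
  then obtain c \<mu> where "s = 1 \<or> t = 1" "c \<noteq> 0"
    and T: "?T = pois_const c * (pois_var ex ^ s - pois_const \<mu> * pois_var ey ^ t) ^ g" by blast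
  \<comment> \<open>With N \<le> M, even t = 1 implies s = 1, so the shear can always act on
    x.\<close>
  moreover have "s \<le> t" using NM(2) g by simp
  ultimately have "s = 1" using st by auto
  with g(2,3) T \<open>c \<noteq> 0\<close> show "\<exists>t \<mu> c. M = N * t \<and> c \<noteq> 0 \<and>
      ?T = pois_const c * (pois_gen X1 - pois_const \<mu> * pois_gen X2 ^ t) ^ N"
    by (intro exI[of _ t] exI[of _ \<mu>] exI[of _ c]) (simp add: pois_gen_eq mult.commute)
qed

lemma plane_gr_part: "plane p \<Longrightarrow> plane (gr_part wt r p)"
  unfolding plane_def pois_vars_def
  by (force simp: in_keys_iff lookup_gr_part split: if_splits)

lemma poisson_subalgebra_power: "p \<in> poisson_subalgebra S \<Longrightarrow> p ^ n \<in> poisson_subalgebra S"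
  using poisson_subalgebra.const[of 1 S] by (induction n) (auto intro: poisson_subalgebra.mult)

text \<open>The bounds \<open>N\<close> and \<open>M\<close> on the exponents of the pure powers of \<open>x\<close> and \<open>y\<close> in \<open>H\<close> need
  not be sharp. If they are, then a shear removes an edge of the Newton polygon.\<close>

lemma ham_triangulable:
  fixes D :: "('k::field_char_0, two) free_poisson \<Rightarrow> ('k, two) free_poisson"
  assumes "ham D H" "gr_supp bidegree (\<lambda>(i, j). (j = 0 \<longrightarrow> i \<le> N) \<and> (i = 0 \<longrightarrow> j \<le> M)) H"
  shows "triangulable D"
  using assms
proof (induction "N + M" arbitrary: N M D H rule: less_induct)
  case less
  let ?Q = "\<lambda>N M (i, j). (j = 0 \<longrightarrow> i \<le> (N::nat)) \<and> (i = 0 \<longrightarrow> j \<le> (M::nat))"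
  \<comment> \<open>Stated for any bounds with the same sum, so that it applies also after a
    rotation has exchanged N and M.\<close>
  have main: "triangulable D'" if NM: "N' + M' = N + M" "N' > 0" "N' \<le> M'" and ham: "ham D' H'"
    and H': "gr_supp bidegree (?Q N' M') H'"
    for N' M' H' and D' :: "('k, two) free_poisson \<Rightarrow> ('k, two) free_poisson"
  proof -
    have plane: "plane H'" using ham by (simp add: ham_def)
    have mon: "m = single ex (lookup m ex) +
        single ey (lookup m ey)" if "m \<in> keys H'" for m
      by (rule plane_monomial[OF plane_keys[OF plane that]])
    have bound: "?Q N' M' (bidegree m)" if "m \<in> keys H'" for m
      using H' that by (simp add: gr_supp_def)
    consider "single ex N' \<notin> keys H'"
      | "single ey M' \<notin> keys H'"
      | "single ex N' \<in> keys H'" "single ey M' \<in> keys H'"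
      by blast
    then show ?thesis
    proof cases
      \<comment> \<open>A bound that is not attained can be lowered by one.\<close>
      case 1
      have "?Q (N' - 1) M' (bidegree m)" if m: "m \<in> keys H'" for m
      proof -
        have "lookup m ey = 0 \<Longrightarrow> lookup m ex \<noteq> N'"
          using mon[OF m] 1 m by auto
        with bound[OF m] show ?thesis by (auto simp: bidegree_def)
      qed
      then show ?thesis
        using NM by (intro less.hyps[OF _ ham, of "N' - 1" M']) (auto simp: gr_supp_def)
    next
      case 2
      have "?Q N' (M' - 1) (bidegree m)" if m: "m \<in> keys H'" for m
      proof -
        have "lookup m ex = 0 \<Longrightarrow> lookup m ey \<noteq> M'"
          using mon[OF m] 2 m by auto
        with bound[OF m] show ?thesis by (auto simp: bidegree_def)
      qed
      then show ?thesis
        using NM by (intro less.hyps[OF _ ham, of N' "M' - 1"]) (auto simp: gr_supp_def)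
    next
      case 3
      let ?w = "mono_wt (int M') (int N') :: (('k, two) lie_basis_elem \<Rightarrow>\<^sub>0 nat) \<Rightarrow> int"
      let ?T = "gr_part ?w (int (N' * M')) H'"
      note edge = ham_Newton_edge[OF ham_lnd[OF ham] plane NM(2,3) H' 3]
      from edge(2) obtain t \<mu> c where t: "M' = N' * t" and c: "c \<noteq> 0"
        and T: "?T = pois_const c * (pois_gen X1 - pois_const \<mu> * pois_gen X2 ^ t) ^ N'" by blast
      let ?h = "- pois_const \<mu> * pois_gen X2 ^ t :: ('k, two) free_poisson"
      have "?h \<in> poisson_subalgebra {pois_gen j |j. j \<noteq> X1}"
        unfolding pois_const_minus[symmetric]
        by (intro poisson_subalgebra.mult poisson_subalgebra.const poisson_subalgebra_power
            poisson_subalgebra.base) blast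
      then obtain \<phi> \<theta> where inv: "inverse_endos \<phi> \<theta>" "tame_automorphism \<phi>"
        and \<phi>: "\<phi> (pois_gen X1) = pois_gen X1 + ?h" "\<phi> (pois_gen X2) = pois_gen X2"
        and \<theta>: "\<theta> (pois_gen X1) = pois_gen X1 - ?h" "\<theta> (pois_gen X2) = pois_gen X2"
        by (rule shear_automorphism) blast
      have endo: "poisson_endo \<theta>" using inv(1) by (simp add: inverse_endos_def)
      have h: "plane ?h"
        unfolding pois_const_minus[symmetric] by (intro plane_mult plane_const plane_power plane_gen)
      have "plane (\<phi> (pois_gen x))" "plane (\<theta> (pois_gen x))" for x
        using plane_add[OF plane_gen[of X1] h] plane_diff[OF plane_gen[of X1] h]
        by (cases x; simp add: \<phi> \<theta> plane_gen)+
      moreover have "jac (\<theta> (pois_gen X1)) (\<theta> (pois_gen X2)) = 1"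
      proof -
        have "pois_pdiff ex (pois_gen X2 ^ t :: ('k, two) free_poisson) = 0"
          by (intro pois_pdiff_power_zero) (simp add: pois_gen_eq pois_pdiff_var)
        then have "pois_pdiff ex ?h = 0"
          by (simp add: pois_pdiff_mult pois_pdiff_const flip: pois_const_minus)
        then show ?thesis
          unfolding \<theta> jac_def pois_pdiff_diff by (simp add: pois_gen_eq pois_pdiff_var)
      qed
      ultimately have ham': "ham (\<theta> \<circ> D' \<circ> \<phi>) (\<theta> H')" by (intro ham_conj[OF ham inv(1)])
      \<comment> \<open>Since M' = N' * t, the shear is homogeneous for these weights and lifts
        nothing from below onto the edge.\<close>
      have "gr_supp ?w (\<lambda>r. r < int (N' * M')) (\<theta> (H' - ?T))"
      proof (rule gr_supp_poisson_endo[OF endo])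
        show "plane (H' - ?T)" by (intro plane_diff plane plane_gr_part)
        show "gr_supp ?w (\<lambda>r. r < int (N' * M')) (H' - ?T)"
          by (rule gr_supp_diff_gr_part[OF edge(1)])
        have x: "gr_supp ?w (\<lambda>s. s = int M') (pois_gen X1)"
          and y: "gr_supp ?w (\<lambda>s. s = int N') (pois_gen X2)"
          using gr_supp_gen[of "int M'" "int N'" X1] gr_supp_gen[of "int M'" "int N'" X2] by simp_all
        have "gr_supp ?w (\<lambda>s. s = int M') ?h"
          unfolding pois_const_minus[symmetric]
          by (rule gr_supp_mult[OF mono_wt_add gr_supp_const gr_supp_power[OF y]]) (simp add: t)
        then show "gr_supp ?w (\<lambda>s. s = int M') (\<theta> (pois_gen X1))"
          unfolding \<theta> using x by (rule gr_supp_diff[rotated])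
        show "gr_supp ?w (\<lambda>s. s = int N') (\<theta> (pois_gen X2))"
          unfolding \<theta> by (rule y)
      qed
      moreover have "\<theta> H' = single (single ex N') c + \<theta> (H' - ?T)"
      proof -
        have "\<theta> ?T = pois_const c * pois_gen X1 ^ N'"
          unfolding T
          by (simp add: poisson_endo_simps[OF endo] poisson_endo_const[OF endo] poisson_endo_simps[OF endo]
              poisson_endo_diff[OF endo] \<theta>)
        also have "\<dots> = single (single ex N') c"
          by (simp add: pois_gen_eq pois_var_power pois_const_def mult_single)
        finally show ?thesis by (simp add: poisson_endo_diff[OF endo])
      qed
      ultimately have key: "m = single ex N' \<or> ?w m < int (N' * M')"
        if "m \<in> keys (\<theta> H')" for m
        using that Poly_Mapping.keys_add[of "single (single ex N') c" "\<theta> (H' - ?T)"]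
        by (auto simp: gr_supp_def split: if_splits)
      \<comment> \<open>The edge has shrunk to x^N'. Every other monomial lies strictly below it, so
        y^M' is gone and the bound for y drops by one.\<close>
      have "?Q N' (M' - 1) (bidegree m)" if m: "m \<in> keys (\<theta> H')" for m
        using key[OF m]
      proof
        assume "m = single ex N'"
        with NM(2) show ?thesis by (simp add: bidegree_def lookup_single)
      next
        assume "?w m < int (N' * M')"
        then have less: "int (M' * lookup m ex + N' * lookup m ey) < int (N' * M')"
          by (simp add: mono_wt_def)
        then have "M' * lookup m ex + N' * lookup m ey < N' * M'"
          by (simp only: of_nat_less_iff)
        then have "M' * lookup m ex < N' * M'" "N' * lookup m ey < N' * M'"
          by linarith+
        then have "lookup m ex < N'" "lookup m ey < M'"
          by (simp_all add: mult.commute[of N'])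
        then show ?thesis by (auto simp: bidegree_def)
      qed
      then have "triangulable (\<theta> \<circ> D' \<circ> \<phi>)"
        using NM by (intro less.hyps[OF _ ham', of N' "M' - 1"]) (auto simp: gr_supp_def)
      then have "triangulable (inv \<phi> \<circ> D' \<circ> \<phi>)"
        by (simp only: inverse_endos_inv[OF inv(1)])
      with inv(2) show ?thesis by (rule triangulable_conj)
    qed
  qed
  consider "N = 0" | "M = 0" | "N > 0" "N \<le> M" | "M > 0" "M \<le> N" by linarith
  then show ?case
  proof cases
    case 1
    show ?thesis
      by (rule triangulable_base[OF less.prems(1) gr_supp_mono[OF less.prems(2)]]) (auto simp: 1)
  next
    case 2
    show ?thesis
    proof (rule ham_rotation[OF less.prems])
      fix D' :: "('k, two) free_poisson \<Rightarrow> ('k, two) free_poisson" and H'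
      assume "ham D' H'" and H': "gr_supp bidegree (\<lambda>(i, j). ?Q N M (j, i)) H'"
      then show "triangulable D'"
        by (intro triangulable_base[OF _ gr_supp_mono[OF H']]) (auto simp: 2)
    qed
  next
    case 3
    then show ?thesis using less.prems by (intro main[of N M D H]) simp_all
  next
    case 4
    show ?thesis
    proof (rule ham_rotation[OF less.prems])
      fix D' :: "('k, two) free_poisson \<Rightarrow> ('k, two) free_poisson" and H'
      assume "ham D' H'" and H': "gr_supp bidegree (\<lambda>(i, j). ?Q N M (j, i)) H'"
      moreover have "gr_supp bidegree (?Q M N) H'" by (rule gr_supp_mono[OF H']) auto
      ultimately show "triangulable D'" using 4 by (intro main[of M N D' H']) simp_all
    qed
  qed
qed

section \<open>Existence of the Hamiltonian\<close>

lemma pois_bracket_gen_plane: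
  assumes "plane p"
  shows "pois_bracket p (pois_gen X2) = pois_pdiff ex p * pois_bracket (pois_gen X1) (pois_gen X2)"
    and "pois_bracket (pois_gen X1) p = pois_pdiff ey p * pois_bracket (pois_gen X1) (pois_gen X2)"
  using assms
proof (induction rule: plane_induct)
  case (gen x)
  case 1
  show ?case by (cases x) (simp_all add: pois_gen_eq pois_pdiff_var pois_bracket_self)
next
  case (gen x)
  case 2
  show ?case by (cases x) (simp_all add: pois_gen_eq pois_pdiff_var pois_bracket_self)
qed (simp_all add: pois_bracket_simps pois_pdiff_const pois_pdiff_add pois_pdiff_mult algebra_simps)

lemma pois_bracket_gens_nonzero:
  "pois_bracket (pois_gen X1) (pois_gen X2) \<noteq> (0 :: ('k::field, two) free_poisson)"
proof
  assume "pois_bracket (pois_gen X1) (pois_gen X2) = (0 :: ('k, two) free_poisson)"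
  then have "lin_part (\<lambda>_. 0) (lie_incl (lie_bracket (lie_gen X1) (lie_gen X2)) :: ('k, two) free_poisson) = 0"
    by (simp add: pois_gen_def pois_bracket_lie_incl lin_part_zero)
  then have "lie_embed (lie_bracket (lie_gen X1) (lie_gen X2) :: ('k, two) free_lie) = 0"
    by (simp only: lin_part_lie_incl)
  then have "lookup (lie_embed (lie_bracket (lie_gen X1) (lie_gen X2) :: ('k, two) free_lie)) [X1, X2] = 0"
    by simp
  then show False
    by (simp add: lie_embed_bracket lie_embed_gen assoc_mult_single lookup_minus lookup_single)
qed

lemma Hamiltonian_exists:
  assumes "plane a" "plane b" and div: "pois_pdiff ex a + pois_pdiff ey b = 0"
  obtains H where "plane H" "pois_pdiff ey H = a" "pois_pdiff ex H = - b"
proof -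
  \<comment> \<open>The y-integral of a misses the required x-derivative - b by c. By
    \<open>div\<close>, c is free of y, so its x-integral can be subtracted without disturbing the
    y-derivative.\<close>
  define c where "c = b + pois_pdiff ex (pois_int ey a)"
  have plane_int: "plane (pois_int e p)" if "plane p" "e \<in> {ex, ey}" for e and p :: "('a, two) free_poisson"
    using that pois_vars_int[of e p] by (auto simp: plane_def)
  have "pois_pdiff ey c = 0"
    using div by (simp add: c_def pois_pdiff_add pois_pdiff_commute[of ey ex] pois_pdiff_int add.commute)
  then have "pois_pdiff ey (pois_int ex c) = 0"
    by (simp add: pois_pdiff_int_other pois_int_simps)
  then have "pois_pdiff ey (pois_int ey a - pois_int ex c) = a"
    by (simp add: pois_pdiff_diff pois_pdiff_int)
  moreover have "pois_pdiff ex (pois_int ey a - pois_int ex c) = - b"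
    by (simp add: pois_pdiff_diff pois_pdiff_int c_def)
  moreover have "plane (pois_int ey a - pois_int ex c)"
    unfolding c_def using assms(1,2)
    by (intro plane_diff plane_int plane_add plane_pdiff) auto
  ultimately show ?thesis using that by blast
qed

lemma locally_nilpotent_ham:
  assumes D: "poisson_derivation D" "locally_nilpotent D"
  obtains H where "ham D H"
proof -
  let ?z = "pois_bracket (pois_gen X1) (pois_gen X2) :: ('a, two) free_poisson"
  have plane: "plane (D (pois_gen c))" for c
  proof -
    have "e \<in> {ex, ey}" if "e \<in> pois_vars (D (pois_gen c))" for e
      using locally_nilpotent_gen_vars[OF D that] Rep_lie_basis_elem_inject[of e]
      by (metis Rep_gen_elem insertCI two.exhaust)
    then show ?thesis by (auto simp: plane_def)
  qed
  \<comment> \<open>The factor is the divergence of (D x, D y). Once D ?z = 0 is known, it vanishes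
    because ?z is nonzero and P is a domain.\<close>
  have "D ?z = ?z * (pois_pdiff ex (D (pois_gen X1)) + pois_pdiff ey (D (pois_gen X2)))"
    by (simp add: poisson_derivation_bracket[OF D(1)] pois_bracket_gen_plane[OF plane] algebra_simps)
  moreover from this have "D ?z = 0"
    by (rule locally_nilpotent_multiple_zero[OF poisson_derivation_add[OF D(1)]
        poisson_derivation_mult[OF D(1)] D(2)])
  ultimately have "pois_pdiff ex (D (pois_gen X1)) + pois_pdiff ey (D (pois_gen X2)) = 0"
    by (simp add: pois_bracket_gens_nonzero)
  from Hamiltonian_exists[OF plane plane this] obtain H where H: "plane H"
    "pois_pdiff ey H = D (pois_gen X1)" "pois_pdiff ex H = - D (pois_gen X2)" by blast
  have "D p = jac p H" if "plane p" for p
    using that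
  proof (induction rule: plane_induct)
    case (gen x)
    then show ?case by (cases x) (simp_all add: jac_gen H)
  qed (simp_all add: poisson_derivation_simps[OF D(1)] jac_simps)
  then show ?thesis using D H(1) by (intro that[of H]) (simp add: ham_def)
qed

theorem theorem1:
  fixes D :: "('k::field_char_0, two) free_poisson \<Rightarrow> ('k, two) free_poisson"
  assumes "poisson_derivation D"
    and "locally_nilpotent D"
  shows "\<exists>(\<phi> :: ('k, two) free_poisson \<Rightarrow> ('k, two) free_poisson) (f :: 'k poly).
    tame_automorphism \<phi> \<and>
    inv \<phi> \<circ> D \<circ> \<phi> = derivation_of (\<lambda>x. case x of X1 \<Rightarrow> pois_poly f (pois_gen X2) | X2 \<Rightarrow> 0)"
proof -
  obtain H where H: "ham D H"
    using assms by (rule locally_nilpotent_ham)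
  \<comment> \<open>A bound for the total degree serves as both N and M; the inserted 0 covers H =
    0.\<close>
  define n where "n = Max (insert 0 ((\<lambda>m. fst (bidegree m) + snd (bidegree m)) ` keys H))"
  have "fst (bidegree m) + snd (bidegree m) \<le> n" if "m \<in> keys H" for m
    unfolding n_def using that by (intro Max_ge) auto
  then have "gr_supp bidegree (\<lambda>(i, j). (j = 0 \<longrightarrow> i \<le> n) \<and> (i = 0 \<longrightarrow> j \<le> n)) H"
    by (force simp: gr_supp_def)
  with H have "triangulable D" by (rule ham_triangulable)
  then show ?thesis unfolding triangulable_def .
qed

end
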